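(* Let $Y$ be a real-valued polynomial jump-diffusion process with extended generator $\mathcal G$ and filtration $\{\mathcal F_t\}_{t\ge0}$. For every $m\ge 1$, let $p_k\in\mathrm{Pol}_{n_k}(\mathbb R)$ for $k=0,\dots,m$, let $n=\max\{n_0,\dots,n_m\}\ge 1$, and let $\vec p_k\in\mathbb R^{n+1}$ be the coefficient vector of $p_k$, i.e. $p_k(x)=\vec p_k^{\top}H_n(x)$. Let $0\le t<s_0<s_1<\dots<s_m$ and set $$C_{p_0,\dots,p_m}(s_0,\dots,s_m;t):=\mathbb E\left[p_m(Y(s_0))\,p_{m-1}(Y(s_1))\cdots p_0(Y(s_m))\,\middle|\,\mathcal F_t\right].$$ Then there exist $m+1$ matrices $\tilde G_n^{(r)}\in\mathbb R^{(n+1)^{r+1}\times(n+1)^{r+1}}$, $r=0,\dots,m$, such that $$C_{p_0,\dots,p_m}(s_0,\dots,s_m;t)=\vec p_m^{\top}\left\{vec^{-1}\circ e^{\tilde G_n^{(m)}(s_0-t)}\circ vec\left(X_n^{(m)}(Y(t))\right)\right\}\prod_{k=1}^{m}e^{\tilde G_n^{(m-k)\top}(s_k-s_{k-1})}\left\{I_{n+1}\otimes^{m-k}\vec p_{m-k}\right\},$$ where $\prod_{k=1}^m$ is the product obtained starting with the matrix corresponding to $k=1$ and multiplying on the right by the following matrices until the matrix corresponding to $k=m$. In particular, $$\tilde G_n^{(r)}=D_{n+1}^{(r)}\,G_{n(r+1)}\,E_{n+1}^{(r)}\qquad\text{and}\qquad e^{\tilde G_n^{(r)}t}=D_{n+1}^{(r)}\,e^{G_{n(r+1)}t}\,E_{n+1}^{(r)}\qquad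 (1\le r\le m),$$ with $\tilde G_n^{(0)}=G_n$.
   Context: Polynomial process. Let $(\Omega,\mathcal F,\mathbb P)$ be a stochastic basis with filtration $\{\mathcal F_t\}_{t\ge0}$. Consider $$\mathcal G f(x)=b(x)f'(x)+\tfrac12\sigma^2(x)f''(x)+\int_{\mathbb R}\left(f(x+z)-f(x)-f'(x)z\right)\ell(x,dz),$$ with $b,\sigma:\mathbb R\to\mathbb R$ measurable and $\ell$ a transition kernel with $\ell(x,\{0\})=0$ and $\int_{\mathbb R}|z|\wedge|z|^2\,\ell(x,dz)<\infty$ for all $x$. $Y$ is a jump-diffusion with extended generator $\mathcal G$: for every bounded $C^2$ function $f$ and every $y\in\mathbb R$, $f(Y(t))-f(y)-\int_0^t\mathcal G f(Y(s))ds$ is an $(\mathcal F_t,\mathbb P_y)$-local martingale ($\mathbb P_y$: law with $Y(0)=y$). Let $\mathrm{Pol}_n(\mathbb R)$ be the real polynomials of degree at most $n$. $\mathcal G$ is well defined on polynomials if $\int|z|^n\ell(x,dz)<\infty$ for all $x$ and $n\ge2$, and $\mathcal G f=0$ for $f\equiv 0$; it is polynomial if moreover it maps $\mathrm{Pol}_n(\mathbb R)$ into itself for each $n\in\mathbb N$; then $Y$ is called a polynomial jump-diffusion process. Known fact: in this case, for every polynomial $p$ and $y\in\mathbb R$, $p(Y(t))-p(y)-\int_0^t\mathcal G p(Y(s))ds$ is an $(\mathcal F_t,\mathbb P_y)$-martingale. $H_n(x)=(1,x,\dots,x^n)^{\top}$, and $G_n\in\mathbb R^{(n+1)\times(n+1)}$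 is the generator matrix, defined by $\mathcal G H_n(x)=G_nH_n(x)$ ($\mathcal G$ acting componentwise). Linear algebra. $\otimes$ is the Kronecker product; $I_k$ is the $k\times k$ identity; $\vec e_{k,j}$ is the $j$-th canonical basis (column) vector of $\mathbb R^k$. For $d\ge1$, $A\otimes^dB:=A^{\otimes d}\otimes B$, and $A\otimes^0B:=B$. $X_n^{(r)}(x):=H_n(x)^{\top}\otimes^rH_n(x)\in\mathbb R^{(n+1)\times(n+1)^r}$ for $r\ge 0$. $vec$ stacks the columns of a matrix into one column vector, and $vec^{-1}$ is its inverse, returning a matrix of the same shape as the argument to which $vec$ was previously applied (here $(n+1)\times(n+1)^m$). For $a,c\ge1$, $$E_{a,c}=\sum_{i=1}^{a}\vec e_{a+c-1,i}\otimes\vec e_{c,1}^{\top}\otimes\vec e_{a,i}^{\top}+\sum_{i=2}^{c}\vec e_{a+c-1,a+i-1}\otimes\vec e_{c,i}^{\top}\otimes\vec e_{a,a}^{\top}\in\mathbb R^{(a+c-1)\times ac},$$ $$D_{a,c}=\sum_{i=1}^{a}\sum_{j=1}^{c}\vec e_{a+c-1,i+j-1}^{\top}\otimes\vec e_{c,j}\otimes\vec e_{a,i}\in\mathbb R^{ac\times(a+c-1)}.$$ The $r$-th L-eliminating and L-duplicating matrices are defined by $E_{n+1}^{(1)}=E_{n+1,n+1}$, $D_{n+1}^{(1)}=D_{n+1,n+1}$ and, for $r\ge2$, $E_{n+1}^{(r)}=E_{nr+1,n+1}(I_{n+1}\otimes E_{n+1}^{(r-1)})$, $D_{n+1}^{(r)}=(I_{n+1}\otimes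 D_{n+1}^{(r-1)})D_{nr+1,n+1}$.
   Formalization: The identity e^{G̃t}=D e^{Gt} E is false for n,r≥1 (left side invertible, right side rank-deficient); proved instead: e^{G̃t}=D e^{Gt} E+(I−DE), and the original identity applied to vec(X_n^{(r)}(x)). Y is taken with càdlàg paths; expectation is under P_y. *)

theory Defs
  imports "HOL-Probability.Probability" "Jordan_Normal_Form.Matrix"
begin

section \<open>Martingales in continuous time\<close>

text \<open>
  Only times \<open>t \<ge> 0\<close> matter. The index type of the filtration is nevertheless all of \<open>real\<close>,
  as in the library's locale \<^locale>\<open>filtration\<close>; a filtration given on \<open>[0,\<infinity>)\<close> extends by
  \<open>F t = F 0\<close> for \<open>t < 0\<close>.
\<close>

definition adapted_process ::
    "(real \<Rightarrow> 'w measure) \<Rightarrow> (real \<Rightarrow> 'w \<Rightarrow> real) \<Rightarrow> bool" where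
  "adapted_process F X \<longleftrightarrow> (\<forall>t\<ge>0. X t \<in> borel_measurable (F t))"

definition martingale_process ::
    "'w measure \<Rightarrow> (real \<Rightarrow> 'w measure) \<Rightarrow> (real \<Rightarrow> 'w \<Rightarrow> real) \<Rightarrow> bool" where
  "martingale_process P F X \<longleftrightarrow>
     adapted_process F X \<and>
     (\<forall>t\<ge>0. integrable P (X t)) \<and>
     (\<forall>s t. 0 \<le> s \<longrightarrow> s \<le> t \<longrightarrow> (AE \<omega> in P. real_cond_exp P (F s) (X t) \<omega> = X s \<omega>))"

text \<open>
  Real-valued localizing times are no restriction: a localizing sequence \<open>\<tau> k\<close> with values in
  \<open>[0,\<infinity>]\<close> may be replaced by \<open>min (\<tau> k) k\<close>.
\<close>

definition local_martingale_process ::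
    "'w measure \<Rightarrow> (real \<Rightarrow> 'w measure) \<Rightarrow> (real \<Rightarrow> 'w \<Rightarrow> real) \<Rightarrow> bool" where
  "local_martingale_process P F X \<longleftrightarrow>
     adapted_process F X \<and>
     (\<exists>\<tau> :: nat \<Rightarrow> 'w \<Rightarrow> real.
        (\<forall>k. stopping_time F (\<tau> k)) \<and>
        (\<forall>k. \<forall>\<omega>\<in>space P. 0 \<le> \<tau> k \<omega>) \<and>
        (AE \<omega> in P. incseq (\<lambda>k. \<tau> k \<omega>) \<and> filterlim (\<lambda>k. \<tau> k \<omega>) at_top sequentially) \<and>
        (\<forall>k. martingale_process P F (\<lambda>t \<omega>. X (min t (\<tau> k \<omega>)) \<omega>)))"

definition cadlag_on_nonneg :: "(real \<Rightarrow> real) \<Rightarrow> bool" where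
  "cadlag_on_nonneg f \<longleftrightarrow>
     (\<forall>t\<ge>0. continuous (at_right t) f) \<and>
     (\<forall>t>0. \<exists>l. (f \<longlongrightarrow> l) (at_left t))"


section \<open>The generator and polynomial jump-diffusions\<close>

definition generator ::
    "(real \<Rightarrow> real) \<Rightarrow> (real \<Rightarrow> real) \<Rightarrow> (real \<Rightarrow> real measure) \<Rightarrow> (real \<Rightarrow> real) \<Rightarrow> real \<Rightarrow> real" where
  "generator b \<sigma> l f x =
     b x * deriv f x + (1/2) * (\<sigma> x)\<^sup>2 * deriv (deriv f) x +
     (\<integral>z. (f (x + z) - f x - deriv f x * z) \<partial>(l x))"

definition bounded_C2 :: "(real \<Rightarrow> real) \<Rightarrow> bool" where
  "bounded_C2 f \<longleftrightarrow>
     bounded (range f) \<and>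
     (\<forall>x. f differentiable (at x)) \<and>
     (\<forall>x. deriv f differentiable (at x)) \<and>
     continuous_on UNIV (deriv (deriv f))"

text \<open>A kernel on the reals whose values need not be finite measures.\<close>

definition transition_kernel :: "(real \<Rightarrow> real measure) \<Rightarrow> bool" where
  "transition_kernel l \<longleftrightarrow>
     (\<forall>x. sets (l x) = sets borel) \<and>
     (\<forall>B\<in>sets borel. (\<lambda>x. emeasure (l x) B) \<in> borel_measurable borel)"

definition generator_characteristics ::
    "(real \<Rightarrow> real) \<Rightarrow> (real \<Rightarrow> real) \<Rightarrow> (real \<Rightarrow> real measure) \<Rightarrow> bool" where
  "generator_characteristics b \<sigma> l \<longleftrightarrow>
     b \<in> borel_measurable borel \<and> \<sigma> \<in> borel_measurable borel \<and>
     transition_kernel l \<and>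
     (\<forall>x. emeasure (l x) {0} = 0) \<and>
     (\<forall>x. integrable (l x) (\<lambda>z. min \<bar>z\<bar> (\<bar>z\<bar>\<^sup>2)))"

definition well_defined_on_polynomials ::
    "(real \<Rightarrow> real) \<Rightarrow> (real \<Rightarrow> real) \<Rightarrow> (real \<Rightarrow> real measure) \<Rightarrow> bool" where
  "well_defined_on_polynomials b \<sigma> l \<longleftrightarrow>
     (\<forall>x. \<forall>n\<ge>2. integrable (l x) (\<lambda>z. \<bar>z\<bar> ^ n)) \<and>
     generator b \<sigma> l (\<lambda>_. 0) = (\<lambda>_. 0)"

definition polynomial_generator ::
    "(real \<Rightarrow> real) \<Rightarrow> (real \<Rightarrow> real) \<Rightarrow> (real \<Rightarrow> real measure) \<Rightarrow> bool" where
  "polynomial_generator b \<sigma> l \<longleftrightarrow>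
     well_defined_on_polynomials b \<sigma> l \<and>
     (\<forall>n. \<forall>p. degree p \<le> n \<longrightarrow> (\<exists>q. degree q \<le> n \<and> generator b \<sigma> l (poly p) = poly q))"

text \<open>
  \<open>M\<close> only carries the sample space and its sigma-algebra. The probability measures on it are the
  laws \<open>P y\<close>, under which the process starts in \<open>y\<close>.
\<close>

locale jump_diffusion = filtration "space M" F
  for M :: "'w measure" and F :: "real \<Rightarrow> 'w measure" +
  fixes P :: "real \<Rightarrow> 'w measure"
    and Y :: "real \<Rightarrow> 'w \<Rightarrow> real"
    and b \<sigma> :: "real \<Rightarrow> real"
    and l :: "real \<Rightarrow> real measure"
  assumes subalgebra_F: "\<And>t. subalgebra M (F t)"
    and prob_space_P: "\<And>y. prob_space (P y)"
    and sets_P: "\<And>y. sets (P y) = sets M"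
    and adapted_Y: "adapted_process F Y"
    and cadlag_Y: "\<And>\<omega>. \<omega> \<in> space M \<Longrightarrow> cadlag_on_nonneg (\<lambda>t. Y t \<omega>)"
    and initial_value: "\<And>y. AE \<omega> in P y. Y 0 \<omega> = y"
    and characteristics: "generator_characteristics b \<sigma> l"
    and extended_generator: "\<And>f y. bounded_C2 f \<Longrightarrow>
      local_martingale_process (P y) F
        (\<lambda>t \<omega>. f (Y t \<omega>) - f y - (LBINT s:{0..t}. generator b \<sigma> l f (Y s \<omega>)))"

locale polynomial_jump_diffusion = jump_diffusion +
  assumes polynomial: "polynomial_generator b \<sigma> l"


section \<open>Matrices\<close>

text \<open>
  Column vectors are matrices with one column. Entries of library matrices are indexed from 0,
  whereas the index \<open>j\<close> of \<open>canon_col k j\<close> runs from 1 to \<open>k\<close>.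
\<close>

definition canon_col :: "nat \<Rightarrow> nat \<Rightarrow> real mat" where
  "canon_col k j = mat k 1 (\<lambda>(i, _). if i + 1 = j then 1 else 0)"

definition kron :: "real mat \<Rightarrow> real mat \<Rightarrow> real mat" (infixr \<open>\<otimes>\<^sub>K\<close> 72) where
  "A \<otimes>\<^sub>K B = mat (dim_row A * dim_row B) (dim_col A * dim_col B)
     (\<lambda>(i, j). A $$ (i div dim_row B, j div dim_col B) * B $$ (i mod dim_row B, j mod dim_col B))"

primrec kron_power :: "real mat \<Rightarrow> nat \<Rightarrow> real mat" where
  "kron_power A 0 = 1\<^sub>m 1"
| "kron_power A (Suc d) = A \<otimes>\<^sub>K kron_power A d"

definition kron_prefix :: "nat \<Rightarrow> real mat \<Rightarrow> real mat \<Rightarrow> real mat" where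
  "kron_prefix d A B = (if d = 0 then B else kron_power A d \<otimes>\<^sub>K B)"

definition vectorize :: "real mat \<Rightarrow> real mat" where
  "vectorize A = mat (dim_row A * dim_col A) 1 (\<lambda>(k, _). A $$ (k mod dim_row A, k div dim_row A))"

text \<open>The inverse of \<^const>\<open>vectorize\<close> on matrices with \<open>r\<close> rows and \<open>c\<close> columns.\<close>

definition unvectorize :: "nat \<Rightarrow> nat \<Rightarrow> real mat \<Rightarrow> real mat" where
  "unvectorize r c v = mat r c (\<lambda>(i, j). v $$ (j * r + i, 0))"

definition mat_exp :: "real mat \<Rightarrow> real mat" where
  "mat_exp A = mat (dim_row A) (dim_row A) (\<lambda>(i, j). \<Sum>k. (A ^\<^sub>m k) $$ (i, j) / fact k)"

text \<open>\<open>mat_sum r c f I\<close> is the sum of the \<open>r \<times> c\<close> matrices \<open>f i\<close>, and \<open>mat_prod d f m\<close> the ordered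
  product \<open>f 1 * f 2 * \<dots> * f m\<close>, where \<open>f 1\<close> has \<open>d\<close> rows.\<close>

definition mat_sum :: "nat \<Rightarrow> nat \<Rightarrow> ('i \<Rightarrow> real mat) \<Rightarrow> 'i set \<Rightarrow> real mat" where
  "mat_sum r c f I = mat r c (\<lambda>ij. \<Sum>i\<in>I. f i $$ ij)"

primrec mat_prod :: "nat \<Rightarrow> (nat \<Rightarrow> real mat) \<Rightarrow> nat \<Rightarrow> real mat" where
  "mat_prod d f 0 = 1\<^sub>m d"
| "mat_prod d f (Suc k) = mat_prod d f k * f (Suc k)"


section \<open>Generator matrix, L-eliminating and L-duplicating matrices\<close>

definition monomials :: "nat \<Rightarrow> real \<Rightarrow> real mat" where
  "monomials n x = mat (n + 1) 1 (\<lambda>(i, _). x ^ i)"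

definition generator_matrix ::
    "(real \<Rightarrow> real) \<Rightarrow> (real \<Rightarrow> real) \<Rightarrow> (real \<Rightarrow> real measure) \<Rightarrow> nat \<Rightarrow> real mat" where
  "generator_matrix b \<sigma> l n = (THE G. G \<in> carrier_mat (n + 1) (n + 1) \<and>
     (\<forall>x. mat (n + 1) 1 (\<lambda>ij. generator b \<sigma> l (\<lambda>y. monomials n y $$ ij) x) = G * monomials n x))"

definition coeff_col :: "nat \<Rightarrow> real poly \<Rightarrow> real mat" where
  "coeff_col n p = mat (n + 1) 1 (\<lambda>(i, _). coeff p i)"

definition X_mat :: "nat \<Rightarrow> nat \<Rightarrow> real \<Rightarrow> real mat" where
  "X_mat n r x = kron_prefix r (monomials n x)\<^sup>T (monomials n x)"

definition E_mat :: "nat \<Rightarrow> nat \<Rightarrow> real mat" where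
  "E_mat a c =
     mat_sum (a + c - 1) (a * c)
       (\<lambda>i. canon_col (a + c - 1) i \<otimes>\<^sub>K (canon_col c 1)\<^sup>T \<otimes>\<^sub>K (canon_col a i)\<^sup>T) {1..a} +
     mat_sum (a + c - 1) (a * c)
       (\<lambda>i. canon_col (a + c - 1) (a + i - 1) \<otimes>\<^sub>K (canon_col c i)\<^sup>T \<otimes>\<^sub>K (canon_col a a)\<^sup>T) {2..c}"

definition D_mat :: "nat \<Rightarrow> nat \<Rightarrow> real mat" where
  "D_mat a c =
     mat_sum (a * c) (a + c - 1)
       (\<lambda>(i, j). (canon_col (a + c - 1) (i + j - 1))\<^sup>T \<otimes>\<^sub>K canon_col c j \<otimes>\<^sub>K canon_col a i)
       ({1..a} \<times> {1..c})"

text \<open>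
  \<open>L_elim n r\<close> and \<open>L_dup n r\<close> are the \<open>r\<close>-th matrices attached to \<open>n + 1\<close>, for \<open>r \<ge> 1\<close>.
  The value at \<open>r = 0\<close> is a dummy.

  \<open>L_elim n r * L_dup n r\<close> is the identity, but \<open>L_dup n r * L_elim n r\<close> is only a projection, onto
  the span of the vectors \<open>vectorize (X_mat n r x)\<close>. Hence conjugation \<open>L_dup n r * _ * L_elim n r\<close>
  commutes with \<open>mat_exp\<close> on that span, and on the whole space up to the complementary projection.
\<close>

fun L_elim :: "nat \<Rightarrow> nat \<Rightarrow> real mat" where
  "L_elim n 0 = 1\<^sub>m (n + 1)"
| "L_elim n (Suc 0) = E_mat (n + 1) (n + 1)"
| "L_elim n (Suc (Suc r)) =
     E_mat (n * Suc (Suc r) + 1) (n + 1) * (1\<^sub>m (n + 1) \<otimes>\<^sub>K L_elim n (Suc r))"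

fun L_dup :: "nat \<Rightarrow> nat \<Rightarrow> real mat" where
  "L_dup n 0 = 1\<^sub>m (n + 1)"
| "L_dup n (Suc 0) = D_mat (n + 1) (n + 1)"
| "L_dup n (Suc (Suc r)) =
     (1\<^sub>m (n + 1) \<otimes>\<^sub>K L_dup n (Suc r)) * D_mat (n * Suc (Suc r) + 1) (n + 1)"


section \<open>Correlators\<close>

definition correlator_integrand ::
    "(real \<Rightarrow> 'w \<Rightarrow> real) \<Rightarrow> nat \<Rightarrow> (nat \<Rightarrow> real poly) \<Rightarrow> (nat \<Rightarrow> real) \<Rightarrow> 'w \<Rightarrow> real" where
  "correlator_integrand Y m p s \<omega> = (\<Prod>k\<le>m. poly (p (m - k)) (Y (s k) \<omega>))"

definition correlator ::
    "'w measure \<Rightarrow> (real \<Rightarrow> 'w measure) \<Rightarrow> (real \<Rightarrow> 'w \<Rightarrow> real) \<Rightarrow>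
     nat \<Rightarrow> (nat \<Rightarrow> real poly) \<Rightarrow> (nat \<Rightarrow> real) \<Rightarrow> real \<Rightarrow> 'w \<Rightarrow> real" where
  "correlator P F Y m p s t = real_cond_exp P (F t) (correlator_integrand Y m p s)"

end

theory Submission
  imports Defs
begin

text \<open>
  The definition of the process only provides local martingales for bounded \<open>C\<^sup>2\<close> functions. They are
  used for the functions \<open>- 1 / U\<close> with \<open>U\<close> a polynomial of even degree, bounded below by a multiple of
  \<open>(1 + x\<^sup>2) ^ K\<close>. Since \<open>u \<mapsto> - 1 / u\<close> is concave and increasing, the generator of \<open>- 1 / U\<close> is at most
  \<open>\<G>U / U\<^sup>2\<close>, which is bounded. With \<open>U = 1 + e V\<close> and \<open>e \<rightarrow> 0\<close> this gives first moment bounds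
  (Gronwall) and then the supermartingale inequality for \<open>V(Y\<^sub>t) - \<integral> \<G>V(Y\<^sub>s) ds\<close>. Applying it to
  \<open>V = d (1 + x\<^sup>2) ^ (2 K) - p\<close> plus a constant and letting \<open>d \<rightarrow> 0\<close> turns it into an equality for every
  polynomial \<open>p\<close>. The conditional moments therefore solve the linear differential equation of the
  generator matrix, and \<open>E [H\<^sub>n(Y\<^sub>t) | F\<^sub>s] = exp ((t - s) G\<^sub>n) H\<^sub>n(Y\<^sub>s)\<close>.

  On the algebraic side, \<open>L_dup n r\<close> maps \<open>H\<^bsub>n (r + 1)\<^esub>(x)\<close> to the vectorization \<open>H\<^sub>n(x) \<otimes> \<dots> \<otimes> H\<^sub>n(x)\<close> of
  \<open>X_mat n r x\<close> and has \<open>L_elim n r\<close> as a left inverse. The formula for the correlator follows by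
  conditioning successively on the times \<open>s m, \<dots>, s 0\<close>, where multiplication by a further polynomial
  \<open>p\<close> is the Kronecker product with its coefficient vector.
\<close>

subsection \<open>Kernels\<close>

text \<open>Truncating a polynomial by a cut-off would leave jump terms that are hard to control,
  because jumps of every size are allowed. Composition with a concave increasing function needs no
  error estimate: the tangent inequality holds for each jump separately. Its price is that the
  generator is controlled only from above, so the argument yields inequalities, and equality returns
  only by treating \<open>p\<close> and \<open>- p\<close> alike. No polynomial of the process is
  known to be integrable at the outset; hence the first estimates concern the bounded quantities
  \<open>V / (1 + e V)\<close>, uniformly in \<open>e\<close>. Moments are handled as functions of
  time for a fixed event of \<open>F s\<close>, and only in integrated form. They are bounded and
  measurable, but no continuity in time is established, so uniqueness for the linear system rests on
  a Gronwall inequality for bounded integrable functions. Along a path, the generator of a test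
  function must be integrable in time; this asks for Borel measurability of the jump integral, in
  which both the integrand and the measure depend on the point.\<close>

lemma nn_integral_transition_kernel_measurable:
  assumes l: "transition_kernel l" and f: "f \<in> borel_measurable borel"
  shows "(\<lambda>x. \<integral>\<^sup>+z. f z \<partial>l x) \<in> borel_measurable borel"
  using f
proof (induct f rule: borel_measurable_induct)
  have [measurable_cong]: "sets (l x) = sets borel" for x
    using l by (simp add: transition_kernel_def)
  {
    case (cong f g)
    then have "f = g"
      by auto
    with cong show ?case
      by simp
  next
    case (set A)
    then show ?case
      using l by (simp add: transition_kernel_def)
  next
    case (mult u c)
    then show ?case
      by (subst nn_integral_cmult) auto
  next
    case (add u v)
    then show ?case
      by (subst nn_integral_add) auto
  next
    case (seq U)
    then show ?case
      by (subst SUP_apply[abs_def], subst nn_integral_monotone_convergence_SUP) auto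
  }
qed

text \<open>The kernel may have infinite mass near 0, but \<open>z\<^sup>2 l(x, dz)\<close> is finite, and normalizing it
  gives a subprobability kernel.\<close>

lemma nn_integral_transition_kernel_measurable_pair:
  assumes l: "transition_kernel l" and l0: "\<And>x. emeasure (l x) {0} = 0"
    and sq: "\<And>x. integrable (l x) (\<lambda>z. z\<^sup>2)"
    and g[measurable]: "(\<lambda>(x, z). g x z) \<in> borel_measurable (borel \<Otimes>\<^sub>M borel)"
  shows "(\<lambda>x. \<integral>\<^sup>+z. g x z \<partial>l x) \<in> borel_measurable borel"
proof -
  have sl[measurable_cong]: "sets (l x) = sets borel" for x
    using l by (simp add: transition_kernel_def)
  have spl: "space (l x) = UNIV" for x
    using sets_eq_imp_space_eq[OF sl] by simp
  define m where "m x = (\<integral>\<^sup>+z. ennreal (z\<^sup>2) \<partial>l x)" for x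
  have m[measurable]: "m \<in> borel_measurable borel"
    unfolding m_def by (intro nn_integral_transition_kernel_measurable[OF l]) measurable
  have mfin: "m x < \<infinity>" for x
    using integrableD(2)[OF sq[of x]] by (simp add: m_def top.not_eq_extremum)
  \<comment> \<open>Dividing by \<open>1 + m x\<close> instead of \<open>m x\<close> keeps the
    quotient meaningful where \<open>l x\<close> is the null measure, at the cost of total mass
    below 1.\<close>
  define L where "L x = density (l x) (\<lambda>z. ennreal (z\<^sup>2) / (1 + m x))" for x
  have em: "emeasure (L x) B = (\<integral>\<^sup>+z. ennreal (z\<^sup>2) * indicator B z \<partial>l x) / (1 + m x)"
    if B[measurable]: "B \<in> sets borel" for x B
  proof -
    have "emeasure (L x) B = (\<integral>\<^sup>+z. (ennreal (z\<^sup>2) * indicator B z) * inverse (1 + m x) \<partial>l x)"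
      unfolding L_def
      by (subst emeasure_density) (auto simp: divide_ennreal_def mult_ac)
    also have "\<dots> = (\<integral>\<^sup>+z. ennreal (z\<^sup>2) * indicator B z \<partial>l x) * inverse (1 + m x)"
      by (rule nn_integral_multc) auto
    finally show ?thesis
      by (simp add: divide_ennreal_def)
  qed
  have subprob: "subprob_space (L x)" for x
  proof
    have "emeasure (L x) (space (L x)) = m x / (1 + m x)"
      using em[of UNIV x] by (simp add: L_def spl m_def)
    also have "\<dots> \<le> 1"
      by (rule divide_le_posI_ennreal) (auto simp: add_pos_nonneg)
    finally show "emeasure (L x) (space (L x)) \<le> 1" .
    show "space (L x) \<noteq> {}"
      by (simp add: L_def spl)
  qed
  have Lm[measurable]: "L \<in> measurable borel (subprob_algebra borel)"
  proof (rule measurable_subprob_algebra)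
    show "subprob_space (L a)" for a by (rule subprob)
    show "sets (L a) = sets borel" for a by (simp add: L_def sl)
    fix B :: "real set" assume B[measurable]: "B \<in> sets borel"
    have [measurable]: "(\<lambda>x. \<integral>\<^sup>+z. ennreal (z\<^sup>2) * indicator B z \<partial>l x) \<in> borel_measurable borel"
      by (intro nn_integral_transition_kernel_measurable[OF l]) measurable
    show "(\<lambda>a. emeasure (L a) B) \<in> borel_measurable borel"
      unfolding em[OF B] by measurable
  qed
  have "(\<integral>\<^sup>+z. g x z \<partial>l x) = (\<integral>\<^sup>+z. g x z * ((1 + m x) / ennreal (z\<^sup>2)) \<partial>L x)" for x
  proof -
    have [measurable]: "(\<lambda>z. g x z) \<in> borel_measurable borel"
      using measurable_compose[OF measurable_Pair1' g, of x] by simp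
    \<comment> \<open>The density \<open>z^2\<close> vanishes only at 0, which \<open>l x\<close>
      does not charge, so it can be divided out again.\<close>
    have "AE z in l x. z \<noteq> 0"
      using l0[of x] by (intro AE_I[where N="{0}"]) (auto simp: sl)
    then have "(\<integral>\<^sup>+z. g x z \<partial>l x)
        = (\<integral>\<^sup>+z. ennreal (z\<^sup>2) / (1 + m x) * (g x z * ((1 + m x) / ennreal (z\<^sup>2))) \<partial>l x)"
    proof (intro nn_integral_cong_AE, eventually_elim)
      fix z :: real assume "z \<noteq> 0"
      then have z: "ennreal (z\<^sup>2) \<noteq> 0" "ennreal (z\<^sup>2) \<noteq> \<infinity>"
        by auto
      have mm: "(1 + m x) / (1 + m x) = 1"
        using mfin[of x] by (intro ennreal_divide_self) auto
      have "ennreal (z\<^sup>2) / (1 + m x) * (g x z * ((1 + m x) / ennreal (z\<^sup>2)))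
          = g x z * ((ennreal (z\<^sup>2) * inverse (ennreal (z\<^sup>2))) * ((1 + m x) * inverse (1 + m x)))"
        by (simp add: divide_ennreal_def mult_ac)
      also have "\<dots> = g x z"
        using z mm by (simp flip: divide_ennreal_def)
      finally show "g x z = ennreal (z\<^sup>2) / (1 + m x) * (g x z * ((1 + m x) / ennreal (z\<^sup>2)))"
        by simp
    qed
    also have "\<dots> = (\<integral>\<^sup>+z. g x z * ((1 + m x) / ennreal (z\<^sup>2)) \<partial>L x)"
      unfolding L_def by (subst nn_integral_density) auto
    finally show ?thesis .
  qed
  moreover have "(\<lambda>x. \<integral>\<^sup>+z. g x z * ((1 + m x) / ennreal (z\<^sup>2)) \<partial>L x) \<in> borel_measurable borel"
    by (rule nn_integral_measurable_subprob_algebra2[where N=borel]) measurable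
  ultimately show ?thesis
    by simp
qed

lemma integral_transition_kernel_measurable_pair:
  fixes g :: "real \<Rightarrow> real \<Rightarrow> real"
  assumes l: "transition_kernel l" and l0: "\<And>x. emeasure (l x) {0} = 0"
    and sq: "\<And>x. integrable (l x) (\<lambda>z. z\<^sup>2)"
    and g[measurable]: "(\<lambda>(x, z). g x z) \<in> borel_measurable (borel \<Otimes>\<^sub>M borel)"
    and int: "\<And>x. integrable (l x) (g x)"
  shows "(\<lambda>x. \<integral>z. g x z \<partial>l x) \<in> borel_measurable borel"
proof -
  have [measurable]: "(\<lambda>x. \<integral>\<^sup>+z. ennreal (g x z) \<partial>l x) \<in> borel_measurable borel"
    "(\<lambda>x. \<integral>\<^sup>+z. ennreal (- g x z) \<partial>l x) \<in> borel_measurable borel"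
    by (intro nn_integral_transition_kernel_measurable_pair[OF l l0 sq]; measurable)+
  show ?thesis
    unfolding real_lebesgue_integral_def[OF int] by measurable
qed

subsection \<open>Calculus\<close>

text \<open>Lagrange form of the remainder. The factor 1/2 is given away: the bound only serves
  integrability against \<open>z^2 l(x, dz)\<close> and crude estimates of the generator.\<close>

lemma taylor_quadratic_bound:
  fixes f f' f'' :: "real \<Rightarrow> real"
  assumes "\<And>x. (f has_real_derivative f' x) (at x)"
    and "\<And>x. (f' has_real_derivative f'' x) (at x)"
    and C: "\<And>x. \<bar>f'' x\<bar> \<le> C"
  shows "\<bar>f (x + z) - f x - f' x * z\<bar> \<le> C * z\<^sup>2"
proof (cases "z = 0")
  case False
  define d where "d m = (if m = 0 then f else if m = 1 then f' else f'')" for m :: nat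
  have "\<exists>t. (if x + z < x then x + z < t \<and> t < x else x < t \<and> t < x + z) \<and>
      f (x + z) = (\<Sum>m<2. d m x / fact m * (x + z - x) ^ m) + d 2 t / fact 2 * (x + z - x) ^ 2"
    using assms False
    by (intro Taylor[where a="min x (x + z)" and b="max x (x + z)"])
       (auto simp: d_def less_2_cases_iff)
  then obtain t where "f (x + z) = f x + f' x * z + f'' t / 2 * z\<^sup>2"
    by (auto simp: d_def numeral_2_eq_2)
  then have "f (x + z) - f x - f' x * z = f'' t / 2 * z\<^sup>2"
    by simp
  then have "\<bar>f (x + z) - f x - f' x * z\<bar> = \<bar>f'' t\<bar> / 2 * z\<^sup>2"
    by (simp only: abs_mult) simp
  also have "\<dots> \<le> C * z\<^sup>2"
    using C[of t] by (intro mult_right_mono) auto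
  finally show ?thesis .
qed simp

text \<open>The weight replaces powers of the absolute value because it is itself a polynomial and
  at least 1, so the generator can be applied to it and it can stand in denominators.\<close>

lemma poly_le_weight:
  fixes q :: "real poly"
  assumes "degree q \<le> 2 * K"
  obtains C where "0 < C" "\<And>x. \<bar>poly q x\<bar> \<le> C * (1 + x\<^sup>2) ^ K"
proof
  \<comment> \<open>The leading 1 keeps the constant positive for \<open>q = 0\<close>.\<close>
  let ?C = "1 + (\<Sum>i\<le>degree q. \<bar>coeff q i\<bar>)"
  show "0 < ?C"
    by (smt (verit) sum_nonneg abs_ge_zero)
  fix x :: real
  have pow: "\<bar>x\<bar> ^ i \<le> (1 + x\<^sup>2) ^ K" if "i \<le> 2 * K" for i
  proof -
    have "\<bar>x\<bar> ^ i \<le> sqrt (1 + x\<^sup>2) ^ i"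
      by (intro power_mono real_le_rsqrt) auto
    also have "\<dots> \<le> sqrt (1 + x\<^sup>2) ^ (2 * K)"
      using that by (intro power_increasing) auto
    also have "\<dots> = (1 + x\<^sup>2) ^ K"
      by (simp add: power_mult)
    finally show ?thesis .
  qed
  have "\<bar>poly q x\<bar> \<le> (\<Sum>i\<le>degree q. \<bar>coeff q i\<bar> * \<bar>x\<bar> ^ i)"
    unfolding poly_altdef by (rule order.trans[OF sum_abs]) (simp add: abs_mult power_abs)
  also have "\<dots> \<le> (\<Sum>i\<le>degree q. \<bar>coeff q i\<bar> * (1 + x\<^sup>2) ^ K)"
    using assms by (intro sum_mono mult_left_mono pow) auto
  also have "\<dots> \<le> ?C * (1 + x\<^sup>2) ^ K"
    by (simp add: distrib_right flip: sum_distrib_right)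
  finally show "\<bar>poly q x\<bar> \<le> ?C * (1 + x\<^sup>2) ^ K" .
qed

lemma deriv_poly: "deriv (poly p) = poly (pderiv p)" for p :: "real poly"
  by (intro ext DERIV_imp_deriv poly_DERIV)

text \<open>By bisection it is enough to bound \<open>f\<close> on all short intervals around each
  point, and there the one-sided limits provide bounds on either side.\<close>

lemma cadlag_bounded:
  assumes f: "cadlag_on_nonneg f" and t: "0 \<le> t"
  shows "bounded (f ` {0..t})"
proof -
  \<comment> \<open>Around the point 0 the bisection also asks about intervals that reach below 0,
    where nothing is known of \<open>f\<close>; the premise makes those trivial.\<close>
  define B where "B a c \<longleftrightarrow> (0 \<le> a \<longrightarrow> bounded (f ` {a..c}))" for a c
  have "B 0 t"
    using t
  proof (induction rule: Bolzano)
    case (trans a b c)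
    then have "{a..c} = {a..b} \<union> {b..c}"
      by auto
    then show ?case
      using trans by (auto simp: image_Un B_def)
  next
    case (local x)
    have "\<exists>e>0. \<exists>B. \<forall>u. x \<le> u \<and> u < x + e \<longrightarrow> \<bar>f u\<bar> \<le> B"
    proof -
      have "(f \<longlongrightarrow> f x) (at_right x)"
        using f local by (auto simp: cadlag_on_nonneg_def continuous_within)
      then have "eventually (\<lambda>u. dist (f u) (f x) < 1) (at_right x)"
        by (rule tendstoD) simp
      then obtain c where c: "c > x" "\<And>u. x < u \<Longrightarrow> u < c \<Longrightarrow> dist (f u) (f x) < 1"
        unfolding eventually_at_right_field by auto
      have "\<bar>f u\<bar> \<le> \<bar>f x\<bar> + 1" if "x \<le> u" "u < c" for u
        using c(2)[of u] that by (cases "u = x") (auto simp: dist_real_def)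
      then show ?thesis
        using c(1) by (intro exI[of _ "c - x"]) auto
    qed
    then obtain e1 B1 where 1: "e1 > 0" "\<And>u. x \<le> u \<Longrightarrow> u < x + e1 \<Longrightarrow> \<bar>f u\<bar> \<le> B1"
      by auto
    have "\<exists>e>0. \<exists>B. \<forall>u. 0 \<le> u \<and> x - e < u \<and> u < x \<longrightarrow> \<bar>f u\<bar> \<le> B"
    proof (cases "x = 0")
      case True
      then show ?thesis
        by (intro exI[of _ 1]) auto
    next
      case False
      then obtain L where "(f \<longlongrightarrow> L) (at_left x)"
        using f local unfolding cadlag_on_nonneg_def by (metis order_le_less)
      then have "eventually (\<lambda>u. dist (f u) L < 1) (at_left x)"
        by (rule tendstoD) simp
      then obtain c where c: "c < x" "\<And>u. c < u \<Longrightarrow> u < x \<Longrightarrow> dist (f u) L < 1"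
        unfolding eventually_at_left_field by auto
      have "\<bar>f u\<bar> \<le> \<bar>L\<bar> + 1" if "c < u" "u < x" for u
        using c(2)[of u] that by (auto simp: dist_real_def)
      then show ?thesis
        using c(1) by (intro exI[of _ "x - c"]) auto
    qed
    then obtain e2 B2 where 2: "e2 > 0" "\<And>u. 0 \<le> u \<Longrightarrow> x - e2 < u \<Longrightarrow> u < x \<Longrightarrow> \<bar>f u\<bar> \<le> B2"
      by auto
    have "bounded (f ` {a..c})" if "0 \<le> a" "a \<le> x \<and> x \<le> c \<and> c - a < min e1 e2" for a c
    proof (rule boundedI[where B="max B1 B2"])
      fix v assume "v \<in> f ` {a..c}"
      then obtain u where u: "v = f u" "a \<le> u" "u \<le> c"
        by auto
      show "norm v \<le> max B1 B2"
        using 1(2)[of u] 2(2)[of u] u that by (cases "u < x") auto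
    qed
    then show ?case
      using 1(1) 2(1) by (intro exI[of _ "min e1 e2"]) (auto simp: B_def)
  qed
  then show ?thesis
    by (simp add: B_def)
qed

subsection \<open>The generator on polynomials and on test functions\<close>

text \<open>Comparability with the weight from both sides: the degree bounds \<open>U\<close> from
  above, the constant \<open>c\<close> from below. Every polynomial of degree at most
  \<open>2 * K\<close>, in particular the derivatives of \<open>U\<close> and its image under a
  polynomial generator, is then bounded by a multiple of \<open>U\<close>.\<close>

definition dominating :: "nat \<Rightarrow> real poly \<Rightarrow> bool" where
  "dominating K U \<longleftrightarrow> degree U \<le> 2 * K \<and> (\<exists>c>0. \<forall>x. c * (1 + x\<^sup>2) ^ K \<le> poly U x)"

lemma dominating_lower:
  assumes "dominating K U"
  obtains c where "0 < c" "\<And>x. c \<le> poly U x"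
proof -
  obtain c where c: "0 < c" "\<And>x. c * (1 + x\<^sup>2) ^ K \<le> poly U x"
    using assms by (auto simp: dominating_def)
  have "c \<le> poly U x" for x
  proof -
    have "c * 1 \<le> c * (1 + x\<^sup>2) ^ K"
      using c(1) by (intro mult_left_mono one_le_power) auto
    then show ?thesis
      using c(2)[of x] by simp
  qed
  with c(1) show ?thesis
    by (rule that)
qed

lemma dominating_upper:
  assumes "dominating K U" "degree q \<le> 2 * K"
  obtains C where "0 < C" "\<And>x. \<bar>poly q x\<bar> \<le> C * poly U x"
proof -
  obtain c where c: "0 < c" "\<And>x. c * (1 + x\<^sup>2) ^ K \<le> poly U x"
    using assms by (auto simp: dominating_def)
  obtain C where C: "0 < C" "\<And>x. \<bar>poly q x\<bar> \<le> C * (1 + x\<^sup>2) ^ K"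
    using poly_le_weight[OF assms(2)] by blast
  have "\<bar>poly q x\<bar> \<le> C / c * poly U x" for x
  proof -
    have "C / c * (c * (1 + x\<^sup>2) ^ K) \<le> C / c * poly U x"
      using c C(1) by (intro mult_left_mono) auto
    then show ?thesis
      using c(1) C(2)[of x] by simp
  qed
  then show ?thesis
    using c(1) C(1) by (intro that[of "C / c"]) auto
qed

context polynomial_jump_diffusion
begin

section \<open>The generator as a linear operator on polynomials\<close>

lemma kernel: "transition_kernel l" "emeasure (l x) {0} = 0"
  using characteristics by (auto simp: generator_characteristics_def)

lemma sets_kernel[measurable_cong, simp]: "sets (l x) = sets borel"
  using kernel by (auto simp: transition_kernel_def)

lemma integrable_power_kernel:
  assumes "2 \<le> k"
  shows "integrable (l x) (\<lambda>z. z ^ k)"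
proof -
  have "integrable (l x) (\<lambda>z. \<bar>z\<bar> ^ k)"
    using polynomial assms by (auto simp: polynomial_generator_def well_defined_on_polynomials_def)
  then show ?thesis
    by (subst integrable_abs_iff[symmetric]) (auto simp: power_abs)
qed

text \<open>In the expansion of \<open>p\<close> around \<open>x\<close> the constant and the linear
  term cancel. What remains are powers of \<open>z\<close> with exponent at least 2, exactly those
  whose integrals are known to be finite.\<close>

lemma integrable_poly_increment:
  "integrable (l x) (\<lambda>z. poly p (x + z) - poly p x - poly (pderiv p) x * z)"
proof -
  define q where "q = pcompose p [:x, 1:]"
  obtain a q' where q': "q = pCons a q'"
    by (cases q)
  obtain c r where r: "q' = pCons c r"
    by (cases q')
  have q: "poly p (x + z) = a + z * (c + z * poly r z)" for z
  proof -
    have "poly p (x + z) = poly q z"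
      by (simp add: q_def poly_pcompose)
    then show ?thesis
      by (simp add: q' r)
  qed
  have "poly (pderiv p) x = poly (pderiv q) 0"
    by (simp add: q_def pderiv_pcompose poly_pcompose pderiv_pCons)
  then have c: "poly (pderiv p) x = c"
    by (simp add: q' r pderiv_pCons)
  have a: "poly p x = a"
    using q[of 0] by simp
  have "integrable (l x) (\<lambda>z. \<Sum>i\<le>degree r. coeff r i * z ^ (i + 2))"
    by (intro Bochner_Integration.integrable_sum integrable_mult_right integrable_power_kernel) simp
  moreover have "(\<lambda>z. poly p (x + z) - poly p x - poly (pderiv p) x * z)
      = (\<lambda>z. \<Sum>i\<le>degree r. coeff r i * z ^ (i + 2))"
    unfolding a c by (intro ext, subst q)
      (simp add: poly_altdef power_add power2_eq_square algebra_simps sum_distrib_left)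
  ultimately show ?thesis
    by (simp only:)
qed

lemma generator_poly:
  "generator b \<sigma> l (poly p) x = b x * poly (pderiv p) x + (1/2) * (\<sigma> x)\<^sup>2 * poly (pderiv (pderiv p)) x
    + (\<integral>z. (poly p (x + z) - poly p x - poly (pderiv p) x * z) \<partial>(l x))"
  by (simp add: generator_def deriv_poly)

lemma generator_poly_add:
  "generator b \<sigma> l (poly (p + q)) x = generator b \<sigma> l (poly p) x + generator b \<sigma> l (poly q) x"
proof -
  have "(\<integral>z. (poly (p + q) (x + z) - poly (p + q) x - poly (pderiv (p + q)) x * z) \<partial>(l x))
      = (\<integral>z. (poly p (x + z) - poly p x - poly (pderiv p) x * z) \<partial>(l x))
        + (\<integral>z. (poly q (x + z) - poly q x - poly (pderiv q) x * z) \<partial>(l x))"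
    by (subst Bochner_Integration.integral_add[OF integrable_poly_increment integrable_poly_increment, symmetric])
       (simp add: pderiv_add algebra_simps)
  then show ?thesis
    by (simp add: generator_poly pderiv_add algebra_simps)
qed

lemma generator_poly_smult:
  "generator b \<sigma> l (poly (Polynomial.smult c p)) x = c * generator b \<sigma> l (poly p) x"
proof -
  have "(\<integral>z. (poly (Polynomial.smult c p) (x + z) - poly (Polynomial.smult c p) x - poly (pderiv (Polynomial.smult c p)) x * z) \<partial>(l x))
      = c * (\<integral>z. (poly p (x + z) - poly p x - poly (pderiv p) x * z) \<partial>(l x))"
    by (subst integral_mult_right_zero[symmetric]) (simp add: pderiv_smult algebra_simps)
  then show ?thesis
    by (simp add: generator_poly pderiv_smult algebra_simps)
qed

lemma generator_poly_const: "generator b \<sigma> l (poly [:c:]) x = 0"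
  by (simp add: generator_poly)

text \<open>Passing from functions to polynomials makes degrees available. The choice is
  unambiguous, as a real polynomial is determined by its values.\<close>

definition gen_poly :: "real poly \<Rightarrow> real poly" where
  "gen_poly p = (SOME q. degree q \<le> degree p \<and> generator b \<sigma> l (poly p) = poly q)"

lemma gen_poly: "degree (gen_poly p) \<le> degree p" "generator b \<sigma> l (poly p) = poly (gen_poly p)"
proof -
  have "\<exists>q. degree q \<le> degree p \<and> generator b \<sigma> l (poly p) = poly q"
    using polynomial by (auto simp: polynomial_generator_def)
  from someI_ex[OF this] show "degree (gen_poly p) \<le> degree p"
    "generator b \<sigma> l (poly p) = poly (gen_poly p)"
    by (auto simp: gen_poly_def)
qed

lemma gen_poly_add: "gen_poly (p + q) = gen_poly p + gen_poly q"
  by (rule poly_eq_poly_eq_iff[THEN iffD1], rule ext)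
     (simp only: gen_poly(2)[symmetric] generator_poly_add poly_add)

lemma gen_poly_smult: "gen_poly (Polynomial.smult c p) = Polynomial.smult c (gen_poly p)"
  by (rule poly_eq_poly_eq_iff[THEN iffD1], rule ext)
     (simp only: gen_poly(2)[symmetric] generator_poly_smult poly_smult)

lemma gen_poly_const: "gen_poly [:c:] = 0"
  by (rule poly_eq_poly_eq_iff[THEN iffD1], rule ext)
     (simp only: gen_poly(2)[symmetric] generator_poly_const poly_0)

text \<open>The generator is evaluated at \<open>x\<close> and at \<open>x^2\<close>: the jump
  increment vanishes for the former and is \<open>z^2\<close> for the latter. The drift and the
  total second-order characteristic are therefore polynomials, hence bounded along paths on bounded
  time intervals.\<close>

lemma characteristics_poly:
  "b x = poly (gen_poly [:0, 1:]) x"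
  "(\<sigma> x)\<^sup>2 + (\<integral>z. z\<^sup>2 \<partial>l x) = poly (gen_poly [:0, 0, 1:]) x - 2 * x * b x"
proof -
  show "b x = poly (gen_poly [:0, 1:]) x"
    unfolding gen_poly(2)[symmetric] by (simp add: generator_poly pderiv_pCons)
  show "(\<sigma> x)\<^sup>2 + (\<integral>z. z\<^sup>2 \<partial>l x) = poly (gen_poly [:0, 0, 1:]) x - 2 * x * b x"
    unfolding gen_poly(2)[symmetric]
    by (simp add: generator_poly pderiv_pCons power2_eq_square algebra_simps)
qed

section \<open>Functions with bounded derivatives\<close>

lemma integrable_increment:
  assumes "\<And>x. (f has_real_derivative f' x) (at x)"
    and "\<And>x. (f' has_real_derivative f'' x) (at x)"
    and "\<And>x. \<bar>f'' x\<bar> \<le> C"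
  shows "integrable (l x) (\<lambda>z. f (x + z) - f x - f' x * z)"
proof (rule Bochner_Integration.integrable_bound)
  have "f \<in> borel_measurable borel"
    using assms(1) by (intro borel_measurable_continuous_onI) (auto intro: DERIV_continuous_on)
  then show "(\<lambda>z. f (x + z) - f x - f' x * z) \<in> borel_measurable (l x)"
    by measurable
  show "integrable (l x) (\<lambda>z. C * z ^ 2)"
    by (intro integrable_mult_right integrable_power_kernel) simp
  have "\<bar>f (x + z) - f x - f' x * z\<bar> \<le> \<bar>C * z\<^sup>2\<bar>" for z
    using taylor_quadratic_bound[OF assms, where x=x and z=z] by linarith
  then show "AE z in l x. norm (f (x + z) - f x - f' x * z) \<le> norm (C * z\<^sup>2)"
    by auto
qed

text \<open>Needed so that the time integral of \<open>generator b \<sigma> l f\<close> along a path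
  is a genuine integral and not the default value 0.\<close>

lemma generator_measurable:
  assumes f: "\<And>x. (f has_real_derivative f' x) (at x)"
    and f': "\<And>x. (f' has_real_derivative f'' x) (at x)"
    and bd: "\<And>x. \<bar>f'' x\<bar> \<le> C"
    and f''[measurable]: "f'' \<in> borel_measurable borel"
  shows "generator b \<sigma> l f \<in> borel_measurable borel"
proof -
  have [measurable]: "f \<in> borel_measurable borel" "f' \<in> borel_measurable borel"
    using f f' by (auto intro!: borel_measurable_continuous_onI intro: DERIV_continuous_on)
  have [measurable]: "b \<in> borel_measurable borel" "\<sigma> \<in> borel_measurable borel"
    using characteristics by (auto simp: generator_characteristics_def)
  have d: "deriv f = f'" "deriv f' = f''"
    using f f' by (auto intro!: DERIV_imp_deriv)
  have [measurable]: "(\<lambda>x. \<integral>z. f (x + z) - f x - f' x * z \<partial>l x) \<in> borel_measurable borel"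
    by (rule integral_transition_kernel_measurable_pair[OF kernel(1) kernel(2) integrable_power_kernel
        _ integrable_increment[OF f f' bd]]) (simp, measurable)
  show ?thesis
    unfolding generator_def[abs_def] d by measurable
qed

text \<open>The derivatives are bounded but the characteristics may grow, so the bound depends on
  \<open>x\<close>. By \<open>characteristics_poly\<close> its right-hand side is a continuous
  function, which suffices along a path.\<close>

lemma generator_bound:
  assumes f: "\<And>x. (f has_real_derivative f' x) (at x)"
    and f': "\<And>x. (f' has_real_derivative f'' x) (at x)"
    and bd: "\<And>x. \<bar>f' x\<bar> \<le> C" "\<And>x. \<bar>f'' x\<bar> \<le> C"
  shows "\<bar>generator b \<sigma> l f x\<bar> \<le> C * (\<bar>b x\<bar> + ((\<sigma> x)\<^sup>2 + (\<integral>z. z\<^sup>2 \<partial>l x)))"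
proof -
  have d: "deriv f = f'" "deriv f' = f''"
    using f f' by (auto intro!: DERIV_imp_deriv)
  have "\<bar>\<integral>z. f (x + z) - f x - f' x * z \<partial>l x\<bar> \<le> (\<integral>z. C * z\<^sup>2 \<partial>l x)"
    by (rule order.trans[OF integral_abs_bound], rule integral_mono)
       (auto intro!: integrable_abs integrable_increment[OF f f' bd(2)]
         integrable_mult_right integrable_power_kernel taylor_quadratic_bound[OF f f' bd(2)])
  moreover have "\<bar>b x * f' x\<bar> \<le> C * \<bar>b x\<bar>"
    using mult_left_mono[OF bd(1)[of x], of "\<bar>b x\<bar>"] by (simp add: abs_mult mult.commute)
  moreover have "\<bar>(1/2) * (\<sigma> x)\<^sup>2 * f'' x\<bar> \<le> C * (\<sigma> x)\<^sup>2"
  proof -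
    have "0 \<le> C * (\<sigma> x)\<^sup>2"
      using order.trans[OF abs_ge_zero bd(2)[of x]] by (intro mult_nonneg_nonneg) auto
    moreover have "(\<sigma> x)\<^sup>2 * \<bar>f'' x\<bar> \<le> (\<sigma> x)\<^sup>2 * C"
      by (intro mult_left_mono bd) auto
    moreover have "\<bar>(1/2) * (\<sigma> x)\<^sup>2 * f'' x\<bar> = (1/2) * ((\<sigma> x)\<^sup>2 * \<bar>f'' x\<bar>)"
      by (simp add: abs_mult)
    ultimately show ?thesis
      by (simp only: mult.commute[of _ C])
  qed
  ultimately show ?thesis
    unfolding generator_def d by (simp add: distrib_left)
qed

text \<open>The inequality is Jensen's for the concave function \<open>u \<mapsto> - 1 / u\<close>: it lies below its
  tangents and has negative second derivative.\<close>

lemma test_function: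
  assumes U: "dominating K U"
  defines "f \<equiv> \<lambda>x. - 1 / poly U x"
  shows "bounded_C2 f"
    and "generator b \<sigma> l f \<in> borel_measurable borel"
    and "\<exists>C. \<forall>x. \<bar>generator b \<sigma> l f x\<bar> \<le> C * (\<bar>b x\<bar> + ((\<sigma> x)\<^sup>2 + (\<integral>z. z\<^sup>2 \<partial>l x)))"
    and "generator b \<sigma> l f x \<le> poly (gen_poly U) x / (poly U x)\<^sup>2"
proof -
  obtain c where c: "0 < c" "\<And>x. c \<le> poly U x"
    using dominating_lower[OF U] by blast
  have pos: "0 < poly U x" for x
    using c(1) c(2)[of x] by linarith
  have nz: "poly U x \<noteq> 0" for x
    using pos[of x] by simp
  have deg: "degree U \<le> 2 * K"
    using U by (simp add: dominating_def)
  obtain C1 where C1: "0 < C1" "\<And>x. \<bar>poly (pderiv U) x\<bar> \<le> C1 * poly U x"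
    by (rule dominating_upper[OF U, of "pderiv U"]) (use deg in \<open>auto simp: degree_pderiv\<close>)
  obtain C2 where C2: "0 < C2" "\<And>x. \<bar>poly (pderiv (pderiv U)) x\<bar> \<le> C2 * poly U x"
    by (rule dominating_upper[OF U, of "pderiv (pderiv U)"]) (use deg in \<open>auto simp: degree_pderiv\<close>)
  define f' where "f' x = poly (pderiv U) x / (poly U x)\<^sup>2" for x
  define f'' where "f'' x = poly (pderiv (pderiv U)) x / (poly U x)\<^sup>2
      - 2 * (poly (pderiv U) x)\<^sup>2 / (poly U x) ^ 3" for x
  have f: "(f has_real_derivative f' x) (at x)" for x
  proof -
    have "((\<lambda>x. - 1 / poly U x) has_real_derivative
        (0 * poly U x - (- 1) * poly (pderiv U) x) / (poly U x * poly U x)) (at x)"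
      by (rule DERIV_divide[OF DERIV_const poly_DERIV nz])
    also have "(0 * poly U x - (- 1) * poly (pderiv U) x) / (poly U x * poly U x) = f' x"
      unfolding f'_def power2_eq_square by simp
    finally show ?thesis
      unfolding f_def .
  qed
  have f': "(f' has_real_derivative f'' x) (at x)" for x
  proof -
    have "((\<lambda>x. (poly U x)\<^sup>2) has_real_derivative 2 * (poly (pderiv U) x * poly U x)) (at x)"
      using DERIV_mult[OF poly_DERIV[of U x] poly_DERIV[of U x]] by (simp add: power2_eq_square mult.commute)
    from DERIV_divide[OF poly_DERIV this, of "pderiv U"]
    have "((\<lambda>x. poly (pderiv U) x / (poly U x)\<^sup>2) has_real_derivative
        (poly (pderiv (pderiv U)) x * (poly U x)\<^sup>2
          - poly (pderiv U) x * (2 * (poly (pderiv U) x * poly U x))) / ((poly U x)\<^sup>2 * (poly U x)\<^sup>2)) (at x)"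
      using nz by simp
    also have "(poly (pderiv (pderiv U)) x * (poly U x)\<^sup>2
          - poly (pderiv U) x * (2 * (poly (pderiv U) x * poly U x))) / ((poly U x)\<^sup>2 * (poly U x)\<^sup>2) = f'' x"
      unfolding f''_def using nz[of x]
      by (simp add: diff_divide_distrib power2_eq_square power3_eq_cube mult_ac)
    finally show ?thesis
      unfolding f'_def[abs_def] .
  qed
  have d: "deriv f = f'" "deriv f' = f''"
    using f f' by (auto intro!: DERIV_imp_deriv)
  have bd1: "\<bar>f' x\<bar> \<le> C1 / c" for x
  proof -
    have "\<bar>f' x\<bar> = \<bar>poly (pderiv U) x\<bar> / (poly U x)\<^sup>2"
      by (simp add: f'_def)
    also have "\<dots> \<le> (C1 * poly U x) / (poly U x)\<^sup>2"
      by (intro divide_right_mono C1) auto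
    also have "\<dots> = C1 / poly U x"
      using nz by (simp add: power2_eq_square)
    also have "\<dots> \<le> C1 / c"
      using c C1 by (intro divide_left_mono mult_pos_pos pos) auto
    finally show ?thesis .
  qed
  have bd2: "\<bar>f'' x\<bar> \<le> (C2 + 2 * C1\<^sup>2) / c" for x
  proof -
    have "\<bar>f'' x\<bar> \<le> \<bar>poly (pderiv (pderiv U)) x\<bar> / (poly U x)\<^sup>2
        + 2 * \<bar>poly (pderiv U) x\<bar>\<^sup>2 / (poly U x) ^ 3"
      unfolding f''_def using pos[of x]
      by (intro order.trans[OF abs_triangle_ineq4]) simp
    also have "\<dots> \<le> (C2 * poly U x) / (poly U x)\<^sup>2 + 2 * (C1 * poly U x)\<^sup>2 / (poly U x) ^ 3"
      using pos[of x] by (intro add_mono divide_right_mono mult_left_mono power_mono C1 C2) auto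
    also have "\<dots> = (C2 + 2 * C1\<^sup>2) / poly U x"
      using nz[of x] by (simp add: power2_eq_square power3_eq_cube field_simps)
    also have "\<dots> \<le> (C2 + 2 * C1\<^sup>2) / c"
      using c C1 C2 by (intro divide_left_mono mult_pos_pos pos add_nonneg_nonneg) auto
    finally show ?thesis .
  qed
  have cont'': "continuous_on UNIV f''"
    unfolding f''_def[abs_def] using nz by (intro continuous_intros) auto
  show "bounded_C2 f"
    unfolding bounded_C2_def d
  proof (intro conjI allI cont'')
    show "bounded (range f)"
    proof (rule boundedI[where B="1 / c"])
      fix v assume "v \<in> range f"
      then obtain x where "v = f x"
        by auto
      then show "norm v \<le> 1 / c"
        using c(1) c(2)[of x] pos[of x] by (simp add: f_def frac_le)
    qed
    show "f differentiable at x" for x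
      using f real_differentiable_def by blast
    show "f' differentiable at x" for x
      using f' real_differentiable_def by blast
  qed
  show "generator b \<sigma> l f \<in> borel_measurable borel"
    by (rule generator_measurable[OF f f' bd2]) (intro borel_measurable_continuous_onI cont'')
  define C where "C = max (C1 / c) ((C2 + 2 * C1\<^sup>2) / c)"
  show "\<exists>C. \<forall>x. \<bar>generator b \<sigma> l f x\<bar> \<le> C * (\<bar>b x\<bar> + ((\<sigma> x)\<^sup>2 + (\<integral>z. z\<^sup>2 \<partial>l x)))"
  proof (intro exI allI)
    show "\<bar>generator b \<sigma> l f x\<bar> \<le> C * (\<bar>b x\<bar> + ((\<sigma> x)\<^sup>2 + (\<integral>z. z\<^sup>2 \<partial>l x)))" for x
      using bd1 bd2 by (intro generator_bound[OF f f']) (auto simp: C_def intro: max.coboundedI1 max.coboundedI2)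
  qed
  show "generator b \<sigma> l f x \<le> poly (gen_poly U) x / (poly U x)\<^sup>2"
  proof -
    let ?u = "poly U x"
    have jump: "f (x + z) - f x - f' x * z \<le> (poly U (x + z) - ?u - poly (pderiv U) x * z) / ?u\<^sup>2" for z
    proof -
      let ?v = "poly U (x + z)"
      \<comment> \<open>The gap between the tangent of \<open>u \<mapsto> - 1 / u\<close> at
        \<open>?u\<close> and its value at \<open>?v\<close> is exactly a square over a positive
        quantity. The terms linear in \<open>z\<close> agree on both sides, since
        \<open>f' x\<close> is the derivative of \<open>U\<close> divided by
        \<open>?u^2\<close>.\<close>
      have "(?v - ?u) / ?u\<^sup>2 - (f (x + z) - f x) = (?v - ?u)\<^sup>2 / (?u\<^sup>2 * ?v)"
        using nz[of x] nz[of "x + z"]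
        by (simp add: f_def field_simps power2_eq_square)
      also have "\<dots> \<ge> 0"
        using pos by (intro divide_nonneg_nonneg mult_nonneg_nonneg) (auto intro: less_imp_le)
      finally show ?thesis
        by (simp add: f'_def diff_divide_distrib)
    qed
    have "(\<integral>z. f (x + z) - f x - f' x * z \<partial>l x)
        \<le> (\<integral>z. (poly U (x + z) - ?u - poly (pderiv U) x * z) / ?u\<^sup>2 \<partial>l x)"
      by (intro integral_mono integrable_increment[OF f f' bd2] jump integrable_divide
          integrable_poly_increment)
    also have "\<dots> = (\<integral>z. (poly U (x + z) - ?u - poly (pderiv U) x * z) \<partial>l x) / ?u\<^sup>2"
      by simp
    finally have "(\<integral>z. f (x + z) - f x - f' x * z \<partial>l x)
        \<le> (\<integral>z. (poly U (x + z) - ?u - poly (pderiv U) x * z) \<partial>l x) / ?u\<^sup>2" .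
    \<comment> \<open>The diffusion part of the concavity: the second summand of
      \<open>f'' x\<close> is nonpositive and is dropped.\<close>
    moreover have "(1/2) * (\<sigma> x)\<^sup>2 * f'' x \<le> (1/2) * (\<sigma> x)\<^sup>2 * (poly (pderiv (pderiv U)) x / ?u\<^sup>2)"
      using pos[of x] by (intro mult_left_mono) (auto simp: f''_def)
    ultimately show ?thesis
      unfolding gen_poly(2)[symmetric] generator_poly add_divide_distrib
      by (simp add: generator_def d f'_def)
  qed
qed

end

subsection \<open>Paths and expectations\<close>

lemma set_lborel_integral_split:
  fixes g :: "real \<Rightarrow> real"
  assumes "set_integrable lborel {a..c} g" "a \<le> b" "b \<le> c"
  shows "(LBINT u:{a..c}. g u) = (LBINT u:{a..b}. g u) + (LBINT u:{b..c}. g u)"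
proof -
  have "{a..c} = {a..b} \<union> {b..c}"
    using assms by auto
  moreover have "AE u in lborel. \<not> (u \<in> {a..b} \<and> u \<in> {b..c})"
    using AE_lborel_singleton[of b] by eventually_elim auto
  ultimately show ?thesis
    using assms by (auto intro!: set_integral_Un_AE intro: set_integrable_subset)
qed

text \<open>The constant 2 is not optimal: it comes from comparing with the supremum of
  \<open>m u exp (- 2 C (u - s))\<close> instead of iterating the inequality.\<close>

lemma gronwall:
  fixes m :: "real \<Rightarrow> real"
  assumes bd: "\<And>u. s \<le> u \<Longrightarrow> u \<le> T \<Longrightarrow> \<bar>m u\<bar> \<le> B"
    and int: "set_integrable lborel {s..T} m"
    and le: "\<And>u. s \<le> u \<Longrightarrow> u \<le> T \<Longrightarrow> m u \<le> a + C * (LBINT r:{s..u}. m r)"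
    and C: "0 < C" and a: "0 \<le> a" and sT: "s \<le> T"
  shows "m T \<le> 2 * a * exp (2 * C * (T - s))"
proof -
  define e where "e u = exp (2 * C * (u - s))" for u
  have e: "0 < e u" "u \<ge> s \<Longrightarrow> 1 \<le> e u" for u
    using C by (auto simp: e_def)
  \<comment> \<open>The supremum is finite because \<open>m\<close> is bounded and
    \<open>e \<ge> 1\<close> on the interval; no continuity of \<open>m\<close> enters.\<close>
  define S where "S = Sup ((\<lambda>u. m u / e u) ` {s..T})"
  have bdd: "bdd_above ((\<lambda>u. m u / e u) ` {s..T})"
  proof (rule bdd_aboveI2)
    fix u assume u: "u \<in> {s..T}"
    have "m u / e u \<le> B / 1"
      using bd[of u] u e(2)[of u] by (intro frac_le) auto
    then show "m u / e u \<le> B"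
      by simp
  qed
  have S: "m u \<le> S * e u" if "s \<le> u" "u \<le> T" for u
  proof -
    have "m u / e u \<le> S"
      unfolding S_def using that by (intro cSup_upper bdd) auto
    then show ?thesis
      using e(1)[of u] by (simp add: pos_divide_le_eq)
  qed
  \<comment> \<open>The exponent \<open>2 * C\<close> makes \<open>C\<close> times the integral of
    \<open>e\<close> at most half of \<open>e u\<close>, so half of the supremum can be absorbed.
    The sign of \<open>S\<close> is unknown; with \<open>max 0 S\<close> the contribution of the
    lower limit can be discarded.\<close>
  have "S \<le> a + max 0 S / 2"
  proof -
    have "m u / e u \<le> a + max 0 S / 2" if u: "s \<le> u" "u \<le> T" for u
    proof -
      have e_deriv: "(e has_real_derivative 2 * C * e r) (at r)" for r
        unfolding e_def by (auto intro!: derivative_eq_intros)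
      have e': "((\<lambda>r. e r / (2 * C)) has_real_derivative e r) (at r)" for r
        using C unfolding e_def by (auto intro!: derivative_eq_intros)
      have cont: "continuous_on X e" for X
        unfolding e_def by (intro continuous_intros)
      have I: "(LBINT r:{s..u}. e r) = e u / (2 * C) - e s / (2 * C)"
        unfolding set_lebesgue_integral_def real_scaleR_def
        by (subst mult.commute, rule integral_FTC_Icc_real)
           (use u in \<open>auto intro!: e' DERIV_isCont[OF e_deriv]\<close>)
      have ie: "set_integrable lborel {s..u} (\<lambda>r. max 0 S * e r)"
        by (intro borel_integrable_atLeastAtMost' continuous_intros cont)
      have "(LBINT r:{s..u}. m r) \<le> (LBINT r:{s..u}. max 0 S * e r)"
      proof (rule set_integral_mono[OF _ ie])
        show "set_integrable lborel {s..u} m"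
          by (rule set_integrable_subset[OF int]) (use u in auto)
        show "m r \<le> max 0 S * e r" if "r \<in> {s..u}" for r
        proof -
          have "m r \<le> S * e r"
            using S[of r] that u by simp
          also have "\<dots> \<le> max 0 S * e r"
            using e(1)[of r] by (intro mult_right_mono) auto
          finally show ?thesis .
        qed
      qed
      also have "\<dots> = max 0 S * (e u / (2 * C) - e s / (2 * C))"
        by (simp add: I)
      also have "\<dots> \<le> max 0 S * (e u / (2 * C))"
        using C e(1)[of s] by (intro mult_left_mono) auto
      finally have "C * (LBINT r:{s..u}. m r) \<le> C * (max 0 S * (e u / (2 * C)))"
        using C by (intro mult_left_mono) auto
      also have "\<dots> = max 0 S / 2 * e u"
        using C by simp
      finally have "m u \<le> a + max 0 S / 2 * e u"
        using le[OF u] by linarith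
      also have "\<dots> \<le> (a + max 0 S / 2) * e u"
        using a u mult_left_mono[of 1 "e u" a] e(2)[of u] by (simp add: distrib_right)
      finally show ?thesis
        using e(1)[of u] by (simp add: pos_divide_le_eq)
    qed
    then show ?thesis
      unfolding S_def using sT by (intro cSup_least) (auto simp flip: S_def)
  qed
  then have "S \<le> 2 * a"
    using a by (cases "0 \<le> S") auto
  then have "S * e T \<le> 2 * a * e T"
    using e(1)[of T] by (intro mult_right_mono) auto
  from order.trans[OF S[OF sT order.refl] this] show ?thesis
    unfolding e_def .
qed

context polynomial_jump_diffusion
begin

section \<open>Measurability and boundedness of paths\<close>

lemma space_P: "space (P y) = space M"
  by (rule sets_eq_imp_space_eq[OF sets_P])

lemma subalgebra_P: "subalgebra (P y) (F t)"
  using subalgebra_F[of t] by (simp add: subalgebra_def sets_P space_P)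

lemma sets_F_P: "A \<in> sets (F t) \<Longrightarrow> A \<in> sets M"
  using subalgebra_F[of t] by (auto simp: subalgebra_def)

lemma Y_measurable_F: "0 \<le> t \<Longrightarrow> Y t \<in> borel_measurable (F t)"
  using adapted_Y by (simp add: adapted_process_def)

lemma Y_measurable: "0 \<le> t \<Longrightarrow> Y t \<in> borel_measurable M"
  using measurable_from_subalg[OF subalgebra_F Y_measurable_F] .

lemma Y_measurable_P: "0 \<le> t \<Longrightarrow> Y t \<in> borel_measurable (P y)"
  using Y_measurable measurable_cong_sets[OF sets_P refl] by blast

lemma sigma_finite_subalgebra_P: "sigma_finite_subalgebra (P y) (F t)"
proof -
  interpret prob_space "P y" by (rule prob_space_P)
  show ?thesis
    by (rule finite_measure_subalgebra_is_sigma_finite)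
       (simp add: finite_measure_subalgebra_def finite_measure_subalgebra_axioms_def subalgebra_P
         finite_measure_axioms)
qed

text \<open>By right-continuity the process is a limit of processes that are piecewise constant in time.\<close>

lemma Y_measurable_pair:
  "(\<lambda>(u, \<omega>). Y (max 0 u) \<omega>) \<in> borel_measurable (borel \<Otimes>\<^sub>M M)"
proof -
  \<comment> \<open>The next grid point strictly to the right of \<open>max 0 u\<close>, at distance
    at most \<open>1 / (k + 1)\<close>. Strictness is needed because right-continuity is a limit
    along \<open>at_right\<close>, which excludes the point itself.\<close>
  define g where "g k u = (real_of_int \<lfloor>real (Suc k) * max 0 u\<rfloor> + 1) / real (Suc k)" for k u
  have meas: "(\<lambda>(u, \<omega>). Y (g k u) \<omega>) \<in> borel_measurable (borel \<Otimes>\<^sub>M M)" for k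
  proof -
    have "(\<lambda>x. Y ((real_of_int (max 0 i) + 1) / real (Suc k)) (snd x)) \<in> borel_measurable (borel \<Otimes>\<^sub>M M)" for i
      by (rule measurable_compose[OF measurable_snd Y_measurable]) simp
    then have "(\<lambda>x. Y ((real_of_int (max 0 \<lfloor>real (Suc k) * max 0 (fst x)\<rfloor>) + 1) / real (Suc k)) (snd x))
        \<in> borel_measurable ((borel :: real measure) \<Otimes>\<^sub>M M)"
      by (rule measurable_compose_countable) measurable
    then show ?thesis
      by (simp add: g_def case_prod_beta' max_def)
  qed
  have lim: "(\<lambda>k. Y (g k u) \<omega>) \<longlonglongrightarrow> Y (max 0 u) \<omega>" if "\<omega> \<in> space M" for u \<omega>
  proof -
    have "(Y' \<longlongrightarrow> Y' (max 0 u)) (at_right (max 0 u))" if "Y' = (\<lambda>t. Y t \<omega>)" for Y'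
      using cadlag_Y[OF \<open>\<omega> \<in> space M\<close>] that by (auto simp: cadlag_on_nonneg_def continuous_within)
    moreover have "filterlim (\<lambda>k. g k u) (at_right (max 0 u)) sequentially"
    proof -
      have gt: "max 0 u < g k u" "g k u \<le> max 0 u + 1 / real (Suc k)" for k
      proof -
        have "max 0 u * real (Suc k) < real_of_int \<lfloor>real (Suc k) * max 0 u\<rfloor> + 1"
          by (subst mult.commute) linarith
        then show "max 0 u < g k u"
          unfolding g_def by (subst pos_less_divide_eq) auto
        have "g k u \<le> (real (Suc k) * max 0 u + 1) / real (Suc k)"
          unfolding g_def by (intro divide_right_mono) auto
        also have "\<dots> = max 0 u + 1 / real (Suc k)"
          by (simp add: add_divide_distrib del: of_nat_Suc)
        finally show "g k u \<le> max 0 u + 1 / real (Suc k)" .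
      qed
      have "(\<lambda>k. max 0 u + 1 / real (Suc k)) \<longlonglongrightarrow> max 0 u + 0"
        by (intro tendsto_add tendsto_const LIMSEQ_Suc[OF lim_1_over_n])
      then have lim: "(\<lambda>k. max 0 u + 1 / real (Suc k)) \<longlonglongrightarrow> max 0 u"
        by simp
      have "(\<lambda>k. g k u) \<longlonglongrightarrow> max 0 u"
        by (rule tendsto_sandwich[OF _ _ tendsto_const lim])
           (intro always_eventually allI less_imp_le[OF gt(1)] gt(2))+
      moreover have "g k u \<in> {max 0 u<..}" "g k u \<noteq> max 0 u" for k
        using gt(1)[of k] by auto
      ultimately show ?thesis
        by (intro filterlim_at_withinI) auto
    qed
    ultimately show ?thesis
      using filterlim_compose by blast
  qed
  show ?thesis
    by (rule borel_measurable_LIMSEQ_real[where u="\<lambda>k (u, \<omega>). Y (g k u) \<omega>", OF _ meas])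
       (use lim in \<open>simp only: space_pair_measure mem_Times_iff case_prod_beta'\<close>)
qed

lemma path_measurable: "\<omega> \<in> space M \<Longrightarrow> (\<lambda>u. Y (max 0 u) \<omega>) \<in> borel_measurable borel"
  using measurable_compose[OF measurable_Pair2' Y_measurable_pair, of \<omega>] by simp

lemma path_bounded:
  assumes "\<omega> \<in> space M" "continuous_on UNIV R"
  shows "\<exists>B::real. \<forall>u\<in>{0..t}. \<bar>R (Y u \<omega>)\<bar> \<le> B"
proof (cases "0 \<le> t")
  case True
  have "bounded ((\<lambda>u. Y u \<omega>) ` {0..t})"
    by (rule cadlag_bounded[OF cadlag_Y[OF assms(1)] True])
  then have "compact (closure ((\<lambda>u. Y u \<omega>) ` {0..t}))"
    by simp
  then have "bounded (R ` closure ((\<lambda>u. Y u \<omega>) ` {0..t}))"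
    by (intro compact_imp_bounded compact_continuous_image continuous_on_subset[OF assms(2)]) auto
  then obtain B where B: "\<And>v. v \<in> R ` closure ((\<lambda>u. Y u \<omega>) ` {0..t}) \<Longrightarrow> norm v \<le> B"
    unfolding bounded_iff by blast
  have "R (Y u \<omega>) \<in> R ` closure ((\<lambda>u. Y u \<omega>) ` {0..t})" if "u \<in> {0..t}" for u
    by (intro imageI subsetD[OF closure_subset] that)
  then show ?thesis
    using B unfolding real_norm_def by (intro exI[of _ B] ballI) simp
qed auto

text \<open>Only a continuous majorant \<open>R\<close> is required, not continuity of
  \<open>g\<close>: the generator of a test function is merely known to be measurable, but it has
  such a majorant.\<close>

lemma path_integrable:
  fixes g :: "real \<Rightarrow> real"
  assumes \<omega>: "\<omega> \<in> space M" and g[measurable]: "g \<in> borel_measurable borel"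
    and R: "continuous_on UNIV R" "\<And>x. \<bar>g x\<bar> \<le> R x" and s: "0 \<le> s"
  shows "set_integrable lborel {s..t} (\<lambda>u. g (Y u \<omega>))"
proof -
  obtain B where B: "\<And>u. u \<in> {0..t} \<Longrightarrow> \<bar>R (Y u \<omega>)\<bar> \<le> B"
    using path_bounded[OF \<omega> R(1)] by blast
  note [measurable] = path_measurable[OF \<omega>]
  have "set_integrable lborel {s..t} (\<lambda>u. g (Y (max 0 u) \<omega>))"
  proof (rule set_integrable_bound[where f="\<lambda>_. B"])
    show "set_integrable lborel {s..t} (\<lambda>_. B)"
      by (intro borel_integrable_atLeastAtMost' continuous_intros)
    show "set_borel_measurable lborel {s..t} (\<lambda>u. g (Y (max 0 u) \<omega>))"
      unfolding set_borel_measurable_def by measurable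
    have "\<bar>g (Y (max 0 u) \<omega>)\<bar> \<le> \<bar>B\<bar>" if "u \<in> {s..t}" for u
      using R(2)[of "Y (max 0 u) \<omega>"] B[of "max 0 u"] that s by auto
    then show "AE u in lborel. u \<in> {s..t} \<longrightarrow> norm (g (Y (max 0 u) \<omega>)) \<le> norm B"
      by auto
  qed
  then show ?thesis
    using s by (subst (asm) set_integrable_cong[OF refl, where f'="\<lambda>u. g (Y u \<omega>)"]) auto
qed

text \<open>Set integrals over a fixed event, as a function of time. Identities for all
  \<open>A\<close> in \<open>F s\<close> encode the conditional expectation given \<open>F s\<close>
  without exceptional null sets that depend on the time.\<close>

definition mean :: "real \<Rightarrow> 'a set \<Rightarrow> (real \<Rightarrow> real) \<Rightarrow> real \<Rightarrow> real" where
  "mean y A h u = (\<integral>\<omega>. indicator A \<omega> * h (Y u \<omega>) \<partial>P y)"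

lemma mean_measurable:
  assumes [measurable]: "A \<in> sets M" "h \<in> borel_measurable borel"
  shows "(\<lambda>u. mean y A h (max 0 u)) \<in> borel_measurable borel"
proof -
  interpret prob_space "P y" by (rule prob_space_P)
  note [measurable_cong] = sets_P
  note [measurable] = Y_measurable_pair
  have "(\<lambda>(u, \<omega>). indicator A \<omega> * h (Y (max 0 u) \<omega>)) \<in> borel_measurable (borel \<Otimes>\<^sub>M P y)"
    by (simp add: case_prod_beta') measurable
  then show ?thesis
    unfolding mean_def by (rule borel_measurable_lebesgue_integral)
qed

lemma mean_bound:
  assumes "\<And>x. \<bar>h x\<bar> \<le> B" "A \<in> sets M"
  shows "\<bar>mean y A h u\<bar> \<le> B"
proof -
  interpret prob_space "P y" by (rule prob_space_P)
  have "0 \<le> B"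
    using assms(1)[of 0] by linarith
  then have "(\<integral>\<omega>. \<bar>indicator A \<omega> * h (Y u \<omega>)\<bar> \<partial>P y) \<le> (\<integral>\<omega>. B \<partial>P y)"
    using assms by (intro integral_mono') (auto simp: indicator_def)
  then have "\<bar>mean y A h u\<bar> \<le> (\<integral>\<omega>. B \<partial>P y)"
    unfolding mean_def by (rule order.trans[OF integral_abs_bound])
  then show ?thesis
    by (simp add: prob_space)
qed

lemma set_integrable_mean:
  assumes "A \<in> sets M" "h \<in> borel_measurable borel" "0 \<le> s"
    and B: "\<And>u. s \<le> u \<Longrightarrow> u \<le> t \<Longrightarrow> \<bar>mean y A h u\<bar> \<le> B"
  shows "set_integrable lborel {s..t} (mean y A h)"
proof -
  note [measurable] = mean_measurable[OF assms(1,2)]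
  have "set_integrable lborel {s..t} (\<lambda>u. mean y A h (max 0 u))"
  proof (rule set_integrable_bound[where f="\<lambda>_. B"])
    show "set_integrable lborel {s..t} (\<lambda>_. B)"
      by (intro borel_integrable_atLeastAtMost' continuous_intros)
    show "set_borel_measurable lborel {s..t} (\<lambda>u. mean y A h (max 0 u))"
      unfolding set_borel_measurable_def by measurable
    show "AE u in lborel. u \<in> {s..t} \<longrightarrow> norm (mean y A h (max 0 u)) \<le> norm B"
      using B assms(3) by (intro AE_I2) force
  qed
  then show ?thesis
    using assms(3) by (subst (asm) set_integrable_cong[OF refl, where f'="mean y A h"]) auto
qed

lemma integral_path_integral:
  assumes A: "A \<in> sets M" and h: "h \<in> borel_measurable borel" and B: "\<And>x. \<bar>h x\<bar> \<le> B"
    and s: "0 \<le> s"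
  shows "integrable (P y) (\<lambda>\<omega>. indicator A \<omega> * (LBINT u:{s..t}. h (Y u \<omega>)))"
    and "(\<integral>\<omega>. indicator A \<omega> * (LBINT u:{s..t}. h (Y u \<omega>)) \<partial>P y) = (LBINT u:{s..t}. mean y A h u)"
proof -
  interpret prob_space "P y" by (rule prob_space_P)
  have sf: "sigma_finite_measure (P y)" ..
  interpret pair_sigma_finite lborel "P y" ..
  note [measurable_cong] = sets_P
  note [measurable] = Y_measurable_pair A h
  let ?k = "\<lambda>u \<omega>. indicator {s..t} u * (indicator A \<omega> * h (Y (max 0 u) \<omega>)) :: real"
  have int: "integrable (lborel \<Otimes>\<^sub>M P y) (\<lambda>(u, \<omega>). ?k u \<omega>)"
  proof (rule Bochner_Integration.integrable_bound)
    have "emeasure (lborel \<Otimes>\<^sub>M P y) ({s..t} \<times> space (P y)) < \<infinity>"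
      by (subst sigma_finite_measure.emeasure_pair_measure_Times[OF sf])
         (auto simp: emeasure_space_1 ennreal_mult_less_top emeasure_lborel_Icc_eq)
    then show "integrable (lborel \<Otimes>\<^sub>M P y) (\<lambda>x. B * indicator ({s..t} \<times> space (P y)) x)"
      by (intro integrable_mult_right integrable_real_indicator) auto
    show "(\<lambda>(u, \<omega>). ?k u \<omega>) \<in> borel_measurable (lborel \<Otimes>\<^sub>M P y)"
      by (simp add: case_prod_beta') measurable
    have "0 \<le> B"
      using B[of 0] by linarith
    then show "AE x in lborel \<Otimes>\<^sub>M P y. norm (case x of (u, \<omega>) \<Rightarrow> ?k u \<omega>)
        \<le> norm (B * indicator ({s..t} \<times> space (P y)) x)"
      using B by (intro AE_I2) (auto simp: space_pair_measure indicator_def)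
  qed
  have eq: "(\<integral>u. ?k u \<omega> \<partial>lborel) = indicator A \<omega> * (LBINT u:{s..t}. h (Y u \<omega>))" for \<omega>
  proof -
    have "(\<integral>u. ?k u \<omega> \<partial>lborel) = (\<integral>u. indicator A \<omega> * (indicator {s..t} u * h (Y u \<omega>)) \<partial>lborel)"
      using s by (intro Bochner_Integration.integral_cong) (auto simp: indicator_def max_def)
    then show ?thesis
      by (simp add: set_lebesgue_integral_def)
  qed
  show "integrable (P y) (\<lambda>\<omega>. indicator A \<omega> * (LBINT u:{s..t}. h (Y u \<omega>)))"
    using integrable_snd[OF int] by (simp add: eq)
  have "(\<integral>\<omega>. (\<integral>u. ?k u \<omega> \<partial>lborel) \<partial>P y) = (\<integral>u. (\<integral>\<omega>. ?k u \<omega> \<partial>P y) \<partial>lborel)"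
    by (rule Fubini_integral[OF int])
  also have "\<dots> = (\<integral>u. indicator {s..t} u * mean y A h u \<partial>lborel)"
    using s by (intro Bochner_Integration.integral_cong) (auto simp: mean_def indicator_def max_def)
  finally show "(\<integral>\<omega>. indicator A \<omega> * (LBINT u:{s..t}. h (Y u \<omega>)) \<partial>P y) = (LBINT u:{s..t}. mean y A h u)"
    by (simp add: eq set_lebesgue_integral_def)
qed

text \<open>The localizing times are removed by Fatou's lemma: the stopped increments are bounded below,
  although the generator of the test function is only controlled from above.\<close>

lemma mean_test_function_le:
  assumes U: "dominating K U" and s: "0 \<le> s" "s \<le> t" and A: "A \<in> sets (F s)"
  shows "mean y A (\<lambda>x. - 1 / poly U x) t \<le> mean y A (\<lambda>x. - 1 / poly U x) s
    + (LBINT u:{s..t}. mean y A (\<lambda>x. poly (gen_poly U) x / (poly U x)\<^sup>2) u)"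
proof -
  interpret prob_space "P y" by (rule prob_space_P)
  interpret sigma_finite_subalgebra "P y" "F s" by (rule sigma_finite_subalgebra_P)
  define f where "f = (\<lambda>x. - 1 / poly U x)"
  define h where "h = (\<lambda>x. poly (gen_poly U) x / (poly U x)\<^sup>2)"
  define N where "N t \<omega> = f (Y t \<omega>) - f y - (LBINT s:{0..t}. generator b \<sigma> l f (Y s \<omega>))" for t \<omega>
  have t: "0 \<le> t"
    using s by simp
  note tf = test_function[OF U, folded f_def h_def]
  have intA: "integrable (P y) (\<lambda>\<omega>. r * indicator A \<omega>)" for r :: real
    using sets_F_P[OF A]
    by (intro integrable_mult_right integrable_real_indicator) (simp_all add: sets_P less_top[symmetric])
  obtain c where c: "0 < c" "\<And>x. c \<le> poly U x"
    using dominating_lower[OF U] by blast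
  have pos: "0 < poly U x" for x
    using c(1) c(2)[of x] by linarith
  have nz: "poly U x \<noteq> 0" for x
    using pos[of x] by simp
  have "degree (gen_poly U) \<le> 2 * K"
    using U gen_poly(1)[of U] by (simp add: dominating_def)
  then obtain C0 where C0: "0 < C0" "\<And>x. \<bar>poly (gen_poly U) x\<bar> \<le> C0 * poly U x"
    using dominating_upper[OF U] by blast
  define H where "H = C0 / c"
  have H: "\<bar>h x\<bar> \<le> H" for x
  proof -
    have "\<bar>h x\<bar> = \<bar>poly (gen_poly U) x\<bar> / (poly U x)\<^sup>2"
      by (simp add: h_def)
    also have "\<dots> \<le> (C0 * poly U x) / (poly U x)\<^sup>2"
      by (intro divide_right_mono C0) auto
    also have "\<dots> = C0 / poly U x"
      using nz by (simp add: power2_eq_square)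
    also have "\<dots> \<le> H"
      unfolding H_def using c C0 by (intro divide_left_mono mult_pos_pos pos) auto
    finally show ?thesis .
  qed
  have fb: "\<bar>f x\<bar> \<le> 1 / c" for x
    using c(1) c(2)[of x] pos[of x] by (simp add: f_def frac_le)
  have contf: "continuous_on UNIV f" and conth: "continuous_on UNIV h"
    unfolding f_def h_def using nz by (intro continuous_intros; simp)+
  have fm[measurable]: "f \<in> borel_measurable borel" and hm[measurable]: "h \<in> borel_measurable borel"
    using contf conth by (simp_all add: borel_measurable_continuous_onI)
  have H0: "0 \<le> H"
    using H[of 0] by linarith
  have Am[measurable]: "A \<in> sets M" "A \<in> sets (P y)"
    using sets_F_P[OF A] by (simp_all add: sets_P)
  note [measurable] = Y_measurable_P[OF s(1)] Y_measurable_P[OF t]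

  \<comment> \<open>The characteristics in the bound are replaced by polynomials through
    \<open>characteristics_poly\<close>; this gives the continuous majorant that integrability along
    the path requires.\<close>
  from tf(3) obtain C where C: "\<forall>x. \<bar>generator b \<sigma> l f x\<bar> \<le> C * (\<bar>b x\<bar> + ((\<sigma> x)\<^sup>2 + (\<integral>z. z\<^sup>2 \<partial>l x)))"
    ..
  have int_gen: "set_integrable lborel {a..e} (\<lambda>u. generator b \<sigma> l f (Y u \<omega>))"
    if "\<omega> \<in> space M" "0 \<le> a" for a e \<omega>
  proof (rule path_integrable[OF that(1) tf(2) _ _ that(2)])
    show "continuous_on UNIV (\<lambda>x. C * (\<bar>poly (gen_poly [:0, 1:]) x\<bar>
        + (poly (gen_poly [:0, 0, 1:]) x - 2 * x * poly (gen_poly [:0, 1:]) x)))"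
      by (intro continuous_intros)
    show "\<bar>generator b \<sigma> l f x\<bar> \<le> C * (\<bar>poly (gen_poly [:0, 1:]) x\<bar>
        + (poly (gen_poly [:0, 0, 1:]) x - 2 * x * poly (gen_poly [:0, 1:]) x))" for x
    proof -
      have "\<bar>b x\<bar> = \<bar>poly (gen_poly [:0, 1:]) x\<bar>" "2 * x * b x = 2 * x * poly (gen_poly [:0, 1:]) x"
        by (intro arg_cong[OF characteristics_poly(1)])+
      then have "\<bar>b x\<bar> + ((\<sigma> x)\<^sup>2 + (\<integral>z. z\<^sup>2 \<partial>l x)) = \<bar>poly (gen_poly [:0, 1:]) x\<bar>
          + (poly (gen_poly [:0, 0, 1:]) x - 2 * x * poly (gen_poly [:0, 1:]) x)"
        using characteristics_poly(2)[of x] by linarith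
      from ord_le_eq_trans[OF C[rule_format, of x] arg_cong[OF this, of "\<lambda>v. C * v"]] show ?thesis .
    qed
  qed
  have int_h: "set_integrable lborel {a..e} (\<lambda>u. h (Y u \<omega>))"
    if "\<omega> \<in> space M" "0 \<le> a" for a e \<omega>
    by (rule path_integrable[OF that(1) hm _ H that(2)]) (rule continuous_on_const)
  \<comment> \<open>Replacing the generator of \<open>f\<close> by its upper bound \<open>h\<close>
    decreases the increment. The resulting minorant of the local martingale contains only the
    bounded functions \<open>f\<close> and \<open>h\<close>.\<close>
  have incr: "f (Y e \<omega>) - f (Y a \<omega>) - (LBINT u:{a..e}. h (Y u \<omega>)) \<le> N e \<omega> - N a \<omega>"
    if "\<omega> \<in> space M" "0 \<le> a" "a \<le> e" for a e \<omega>
  proof -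
    have "(LBINT u:{a..e}. generator b \<sigma> l f (Y u \<omega>)) \<le> (LBINT u:{a..e}. h (Y u \<omega>))"
      by (rule set_integral_mono[OF int_gen[OF that(1,2)] int_h[OF that(1,2)]]) (use tf(4) in \<open>simp add: h_def\<close>)
    moreover have "(LBINT u:{0..e}. generator b \<sigma> l f (Y u \<omega>))
        = (LBINT u:{0..a}. generator b \<sigma> l f (Y u \<omega>)) + (LBINT u:{a..e}. generator b \<sigma> l f (Y u \<omega>))"
      by (rule set_lborel_integral_split[OF int_gen[OF that(1) order.refl] that(2,3)])
    ultimately show ?thesis
      by (simp add: N_def)
  qed
  \<comment> \<open>Two values of \<open>f\<close> contribute \<open>1 / c\<close> each, the time
    integral of \<open>h\<close> at most \<open>H * (t - s)\<close>. The bound covers all windows of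
    length at most \<open>t - s\<close>, hence also those cut short by a localizing time.\<close>
  define B where "B = 2 / c + H * (t - s)"
  have lower: "- B \<le> f (Y e \<omega>) - f (Y a \<omega>) - (LBINT u:{a..e}. h (Y u \<omega>))"
    if "\<omega> \<in> space M" "0 \<le> a" "a \<le> e" "e - a \<le> t - s" for a e \<omega>
  proof -
    have "(LBINT u:{a..e}. h (Y u \<omega>)) \<le> (LBINT u:{a..e}. H)"
      using H by (intro set_integral_mono int_h that borel_integrable_atLeastAtMost' continuous_intros)
        (simp add: abs_le_iff)
    also have "\<dots> = H * (e - a)"
      using that(3) by (simp add: set_lebesgue_integral_def)
    also have "\<dots> \<le> H * (t - s)"
      using H0 that(4) by (rule mult_left_mono[rotated])
    finally have "(LBINT u:{a..e}. h (Y u \<omega>)) \<le> H * (t - s)" .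
    moreover have "2 / c = 1 / c + 1 / c"
      by simp
    ultimately show ?thesis
      using fb[of "Y e \<omega>"] fb[of "Y a \<omega>"] unfolding B_def abs_le_iff by linarith
  qed

  have "local_martingale_process (P y) F N"
    using extended_generator[OF tf(1), of y] by (simp add: N_def[abs_def])
  then obtain \<tau> where \<tau>0: "\<And>k \<omega>. \<omega> \<in> space (P y) \<Longrightarrow> 0 \<le> \<tau> k \<omega>"
    and lim: "AE \<omega> in P y. filterlim (\<lambda>k. \<tau> k \<omega>) at_top sequentially"
    and mart: "\<And>k. martingale_process (P y) F (\<lambda>t \<omega>. N (min t (\<tau> k \<omega>)) \<omega>)"
    unfolding local_martingale_process_def by (auto elim!: AE_mp)
  define Z where "Z k \<omega> = N (min t (\<tau> k \<omega>)) \<omega> - N (min s (\<tau> k \<omega>)) \<omega>" for k \<omega>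
  define D where "D \<omega> = f (Y t \<omega>) - f (Y s \<omega>) - (LBINT u:{s..t}. h (Y u \<omega>))" for \<omega>
  have intN: "integrable (P y) (\<lambda>\<omega>. N (min r (\<tau> k \<omega>)) \<omega>)" if "0 \<le> r" for r k
    using mart[of k] that by (simp add: martingale_process_def)
  have intZ: "integrable (P y) (\<lambda>\<omega>. indicator A \<omega> * Z k \<omega>)" for k
    unfolding Z_def using intN[OF t] intN[OF s(1)]
    by (intro integrable_mult_indicator[where 'b=real, unfolded real_scaleR_def]
        Bochner_Integration.integrable_diff) auto
  have Z0: "(\<integral>\<omega>. indicator A \<omega> * Z k \<omega> \<partial>P y) = 0" for k
  proof -
    let ?Xt = "\<lambda>\<omega>. N (min t (\<tau> k \<omega>)) \<omega>" and ?Xs = "\<lambda>\<omega>. N (min s (\<tau> k \<omega>)) \<omega>"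
    have ce: "AE \<omega> in P y. real_cond_exp (P y) (F s) ?Xt \<omega> = ?Xs \<omega>"
      using mart[of k] s by (simp add: martingale_process_def)
    have "(\<integral>\<omega>\<in>A. ?Xt \<omega> \<partial>P y) = (\<integral>\<omega>\<in>A. real_cond_exp (P y) (F s) ?Xt \<omega> \<partial>P y)"
      by (rule real_cond_exp_intA[OF intN[OF t] A])
    also have "\<dots> = (\<integral>\<omega>\<in>A. ?Xs \<omega> \<partial>P y)"
      unfolding set_lebesgue_integral_def
    proof (rule integral_cong_AE)
      show "AE \<omega> in P y. indicator A \<omega> *\<^sub>R real_cond_exp (P y) (F s) ?Xt \<omega> = indicator A \<omega> *\<^sub>R ?Xs \<omega>"
        using ce by eventually_elim simp
      note [measurable] = borel_measurable_integrable[OF intN[OF s(1)]]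
      show "(\<lambda>\<omega>. indicator A \<omega> *\<^sub>R ?Xs \<omega>) \<in> borel_measurable (P y)"
        by measurable
      show "(\<lambda>\<omega>. indicator A \<omega> *\<^sub>R real_cond_exp (P y) (F s) ?Xt \<omega>) \<in> borel_measurable (P y)"
        by measurable
    qed
    finally have "(\<integral>\<omega>. indicator A \<omega> * ?Xt \<omega> \<partial>P y) = (\<integral>\<omega>. indicator A \<omega> * ?Xs \<omega> \<partial>P y)"
      by (simp add: set_lebesgue_integral_def)
    moreover have "integrable (P y) (\<lambda>\<omega>. indicator A \<omega> * N (min r (\<tau> k \<omega>)) \<omega>)" if "0 \<le> r" for r
      using integrable_mult_indicator[OF Am(2) intN[OF that]] by simp
    ultimately show ?thesis
      using s t by (simp add: Z_def right_diff_distrib)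
  qed
  have Zlower: "- B \<le> Z k \<omega>" if "\<omega> \<in> space M" for k \<omega>
  proof -
    have \<tau>k: "0 \<le> \<tau> k \<omega>"
      using \<tau>0 that by (simp add: space_P)
    have 1: "0 \<le> min s (\<tau> k \<omega>)" "min s (\<tau> k \<omega>) \<le> min t (\<tau> k \<omega>)"
      "min t (\<tau> k \<omega>) - min s (\<tau> k \<omega>) \<le> t - s"
      using \<tau>k s by auto
    show ?thesis
      unfolding Z_def by (rule order.trans[OF lower[OF that 1] incr[OF that 1(1,2)]])
  qed
  \<comment> \<open>With \<open>B\<close> added, the stopped increments are nonnegative on
    \<open>A\<close> and have the same integral for every \<open>k\<close>: the two inputs of
    Fatou's lemma.\<close>
  have nnZ: "(\<integral>\<^sup>+\<omega>. ennreal (indicator A \<omega> * (B + Z k \<omega>)) \<partial>P y) = ennreal (B * prob A)" for k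
  proof -
    have "integrable (P y) (\<lambda>\<omega>. B * indicator A \<omega> + indicator A \<omega> * Z k \<omega>)"
      using intZ by (intro Bochner_Integration.integrable_add intA)
    then have "integrable (P y) (\<lambda>\<omega>. indicator A \<omega> * (B + Z k \<omega>))"
      by (simp add: distrib_left mult.commute)
    then have "(\<integral>\<^sup>+\<omega>. ennreal (indicator A \<omega> * (B + Z k \<omega>)) \<partial>P y)
        = ennreal (\<integral>\<omega>. indicator A \<omega> * (B + Z k \<omega>) \<partial>P y)"
    proof (rule nn_integral_eq_integral)
      show "AE \<omega> in P y. 0 \<le> indicator A \<omega> * (B + Z k \<omega>)"
      proof (rule AE_I2)
        fix \<omega> assume "\<omega> \<in> space (P y)"
        then have "0 \<le> B + Z k \<omega>"
          using Zlower[of \<omega> k] by (simp add: space_P)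
        then show "0 \<le> indicator A \<omega> * (B + Z k \<omega>)"
          by simp
      qed
    qed
    also have "(\<integral>\<omega>. indicator A \<omega> * (B + Z k \<omega>) \<partial>P y)
        = (\<integral>\<omega>. B * indicator A \<omega> + indicator A \<omega> * Z k \<omega> \<partial>P y)"
      by (simp add: distrib_left mult.commute)
    also have "\<dots> = B * prob A"
      using intZ Z0 Am(2) by (subst Bochner_Integration.integral_add[OF intA]) simp_all
    finally show ?thesis .
  qed
  have intD: "integrable (P y) (\<lambda>\<omega>. indicator A \<omega> * f (Y t \<omega>))"
    "integrable (P y) (\<lambda>\<omega>. indicator A \<omega> * f (Y s \<omega>))"
    by (rule integrable_const_bound[where B="1 / c"];
        use fb c(1) in \<open>auto simp: indicator_def\<close>)+
  note path = integral_path_integral[OF Am(1) hm H s(1), of y t]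
  have ptD: "indicator A \<omega> * D \<omega> = indicator A \<omega> * f (Y t \<omega>) - indicator A \<omega> * f (Y s \<omega>)
      - indicator A \<omega> * (LBINT u:{s..t}. h (Y u \<omega>))" for \<omega>
    by (simp add: D_def right_diff_distrib)
  have intAD: "integrable (P y) (\<lambda>\<omega>. indicator A \<omega> * D \<omega>)"
    unfolding ptD by (intro Bochner_Integration.integrable_diff intD path(1))
  have "(\<integral>\<^sup>+\<omega>. ennreal (indicator A \<omega> * (B + D \<omega>)) \<partial>P y)
      \<le> (\<integral>\<^sup>+\<omega>. liminf (\<lambda>k. ennreal (indicator A \<omega> * (B + Z k \<omega>))) \<partial>P y)"
  proof (rule nn_integral_mono_AE)
    show "AE \<omega> in P y. ennreal (indicator A \<omega> * (B + D \<omega>)) \<le> liminf (\<lambda>k. ennreal (indicator A \<omega> * (B + Z k \<omega>)))"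
      using lim AE_space
    proof eventually_elim
      fix \<omega> assume l: "filterlim (\<lambda>k. \<tau> k \<omega>) at_top sequentially" and "\<omega> \<in> space (P y)"
      then have \<omega>: "\<omega> \<in> space M"
        by (simp add: space_P)
      \<comment> \<open>Once the localizing time has passed \<open>t\<close>, the stopped increment
        is the full one and dominates \<open>D\<close>. The comparison with \<open>D\<close> avoids
        integrating the generator of the test function over the sample space.\<close>
      have "eventually (\<lambda>k. t \<le> \<tau> k \<omega>) sequentially"
        using l by (auto simp: filterlim_at_top)
      then show "ennreal (indicator A \<omega> * (B + D \<omega>)) \<le> liminf (\<lambda>k. ennreal (indicator A \<omega> * (B + Z k \<omega>)))"
      proof (intro Liminf_bounded, eventually_elim)
        fix k assume "t \<le> \<tau> k \<omega>"
        then have "Z k \<omega> = N t \<omega> - N s \<omega>"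
          using s by (simp add: Z_def min_def)
        then have "D \<omega> \<le> Z k \<omega>"
          using incr[OF \<omega> s] by (simp add: D_def)
        then show "ennreal (indicator A \<omega> * (B + D \<omega>)) \<le> ennreal (indicator A \<omega> * (B + Z k \<omega>))"
          by (intro ennreal_leI mult_left_mono) auto
      qed
    qed
  qed
  also have "\<dots> \<le> liminf (\<lambda>k. \<integral>\<^sup>+\<omega>. ennreal (indicator A \<omega> * (B + Z k \<omega>)) \<partial>P y)"
  proof (rule nn_integral_liminf)
    fix k
    note [measurable] = borel_measurable_integrable[OF intN[OF t]] borel_measurable_integrable[OF intN[OF s(1)]]
    show "(\<lambda>\<omega>. ennreal (indicator A \<omega> * (B + Z k \<omega>))) \<in> borel_measurable (P y)"
      unfolding Z_def by measurable
  qed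
  also have "\<dots> = ennreal (B * prob A)"
    by (simp add: nnZ Liminf_const)
  finally have le: "(\<integral>\<^sup>+\<omega>. ennreal (indicator A \<omega> * (B + D \<omega>)) \<partial>P y) \<le> ennreal (B * prob A)" .
  have B0: "0 \<le> B"
    unfolding B_def using c(1) H0 s by simp
  have iBD: "integrable (P y) (\<lambda>\<omega>. B * indicator A \<omega> + indicator A \<omega> * D \<omega>)"
    using intAD by (intro Bochner_Integration.integrable_add intA)
  have "(\<integral>\<^sup>+\<omega>. ennreal (indicator A \<omega> * (B + D \<omega>)) \<partial>P y)
      = ennreal (\<integral>\<omega>. B * indicator A \<omega> + indicator A \<omega> * D \<omega> \<partial>P y)"
  proof (subst nn_integral_eq_integral[OF iBD, symmetric])
    show "AE \<omega> in P y. 0 \<le> B * indicator A \<omega> + indicator A \<omega> * D \<omega>"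
    proof (rule AE_I2)
      fix \<omega> assume "\<omega> \<in> space (P y)"
      then have "- B \<le> D \<omega>"
        unfolding D_def using s by (intro lower) (auto simp: space_P)
      then show "0 \<le> B * indicator A \<omega> + indicator A \<omega> * D \<omega>"
        by (simp add: indicator_def)
    qed
  qed (simp add: distrib_left mult.commute)
  with le have "(\<integral>\<omega>. B * indicator A \<omega> + indicator A \<omega> * D \<omega> \<partial>P y) \<le> B * prob A"
    using B0 by (simp add: ennreal_le_iff)
  also have "(\<integral>\<omega>. B * indicator A \<omega> + indicator A \<omega> * D \<omega> \<partial>P y) = B * prob A + (\<integral>\<omega>. indicator A \<omega> * D \<omega> \<partial>P y)"
    using intAD Am(2) by (subst Bochner_Integration.integral_add[OF intA]) simp_all
  finally have "(\<integral>\<omega>. indicator A \<omega> * D \<omega> \<partial>P y) \<le> 0"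
    by simp
  moreover have "(\<integral>\<omega>. indicator A \<omega> * D \<omega> \<partial>P y) = mean y A f t - mean y A f s - (LBINT u:{s..t}. mean y A h u)"
    unfolding ptD using intD path
    by (simp add: mean_def Bochner_Integration.integrable_diff)
  ultimately show ?thesis
    unfolding f_def h_def by linarith
qed

end

subsection \<open>Moments\<close>

lemma weight_poly:
  "poly ([:1, 0, 1:] ^ K) x = (1 + x\<^sup>2) ^ K" "degree ([:1, 0, 1:] ^ K :: real poly) \<le> 2 * K"
  for x :: real
proof -
  show "poly ([:1, 0, 1:] ^ K) x = (1 + x\<^sup>2) ^ K"
    by (simp add: poly_power power2_eq_square)
  show "degree ([:1, 0, 1:] ^ K :: real poly) \<le> 2 * K"
    using degree_power_le[of "[:1, 0, 1 :: real:]" K] by simp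
qed

lemma dominating_weight: "dominating K ([:1, 0, 1:] ^ K)"
  unfolding dominating_def weight_poly(1) by (intro conjI weight_poly exI[of _ 1]) auto

lemma dominating_regularized:
  assumes V: "dominating K V" and e: "0 < e"
  shows "dominating K ([:1:] + Polynomial.smult e V)"
proof -
  obtain c where c: "0 < c" "\<And>x. c * (1 + x\<^sup>2) ^ K \<le> poly V x"
    using V by (auto simp: dominating_def)
  have "degree ([:1:] + Polynomial.smult e V) \<le> 2 * K"
    using V by (intro degree_add_le) (auto simp: dominating_def)
  moreover have "e * c * (1 + x\<^sup>2) ^ K \<le> poly ([:1:] + Polynomial.smult e V) x" for x
  proof -
    have "e * c * (1 + x\<^sup>2) ^ K \<le> e * poly V x"
      unfolding mult.assoc by (intro mult_left_mono c) (use e in simp)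
    moreover have "poly ([:1:] + Polynomial.smult e V) x = 1 + e * poly V x"
      by simp
    ultimately show ?thesis
      by linarith
  qed
  moreover have "0 < e * c"
    using c(1) e by simp
  ultimately show ?thesis
    unfolding dominating_def by blast
qed

lemma tendsto_regularized:
  fixes a v :: real
  shows "(\<lambda>k. a / (1 + 1 / real (Suc k) * v) ^ j) \<longlonglongrightarrow> a"
proof -
  have "(\<lambda>k. a / (1 + 1 / real (Suc k) * v) ^ j) \<longlonglongrightarrow> a / (1 + 0 * v) ^ j"
    by (intro tendsto_intros LIMSEQ_Suc[OF lim_1_over_n]) simp
  then show ?thesis
    by simp
qed

context polynomial_jump_diffusion
begin

section \<open>Regularized polynomials and moment bounds\<close>

lemma integrable_bounded:
  fixes h :: "real \<Rightarrow> real"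
  assumes h: "h \<in> borel_measurable borel" and B: "\<And>x. \<bar>h x\<bar> \<le> B" and A: "A \<in> sets M" and t: "0 \<le> t"
  shows "integrable (P y) (\<lambda>\<omega>. indicator A \<omega> * h (Y t \<omega>))"
proof -
  interpret prob_space "P y" by (rule prob_space_P)
  note [measurable] = h Y_measurable_P[OF t]
  have [measurable]: "A \<in> sets (P y)"
    using A by (simp add: sets_P)
  have "0 \<le> B"
    using B[of 0] by linarith
  then show ?thesis
    using B by (intro integrable_const_bound[where B=B]) (auto simp: indicator_def)
qed

text \<open>With \<open>U = 1 + e V\<close> one has \<open>V / U = (1 - 1 / U) / e\<close>, and the
  generator maps \<open>U\<close> to \<open>e\<close> times the image of \<open>V\<close>, being
  linear and zero on constants. The claim is thus the inequality for \<open>- 1 / U\<close>, divided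
  by \<open>e\<close>.\<close>

lemma mean_regularized_le:
  assumes V: "dominating K V" and e: "0 < e" and s: "0 \<le> s" "s \<le> t" and A: "A \<in> sets (F s)"
  shows "mean y A (\<lambda>x. poly V x / (1 + e * poly V x)) t \<le> mean y A (\<lambda>x. poly V x / (1 + e * poly V x)) s
    + (LBINT u:{s..t}. mean y A (\<lambda>x. poly (gen_poly V) x / (1 + e * poly V x)\<^sup>2) u)"
proof -
  interpret prob_space "P y" by (rule prob_space_P)
  define U where "U = [:1:] + Polynomial.smult e V"
  have U: "dominating K U"
    unfolding U_def by (rule dominating_regularized[OF V e])
  have pU: "poly U x = 1 + e * poly V x" for x
    by (simp add: U_def)
  have gU: "poly (gen_poly U) x = e * poly (gen_poly V) x" for x
    by (simp only: U_def gen_poly_add gen_poly_const gen_poly_smult) simp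
  obtain c where c: "0 < c" "\<And>x. c \<le> poly U x"
    using dominating_lower[OF U] by blast
  have pos: "0 < poly U x" for x
    using c(1) c(2)[of x] by linarith
  have fb: "\<bar>- 1 / poly U x\<bar> \<le> 1 / c" for x
    using c(1) c(2)[of x] pos[of x] by (simp add: frac_le)
  have fm: "(\<lambda>x. - 1 / poly U x) \<in> borel_measurable borel"
    using less_imp_neq[OF pos] by (intro borel_measurable_continuous_onI continuous_intros) auto
  have Am: "A \<in> sets M"
    by (rule sets_F_P[OF A])
  have m1: "mean y A (\<lambda>x. poly V x / (1 + e * poly V x)) r = (prob A + mean y A (\<lambda>x. - 1 / poly U x) r) / e"
    if "0 \<le> r" for r
  proof -
    have eq: "poly V x / (1 + e * poly V x) = (1 + (- 1 / poly U x)) / e" for x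
    proof -
      have "(u - 1) / e / u = (1 + (- 1 / u)) / e" if "u \<noteq> 0" for u
        using that e by (simp add: field_simps)
      from this[of "poly U x"] show ?thesis
        using pos[of x] e by (simp add: pU)
    qed
    have "mean y A (\<lambda>x. poly V x / (1 + e * poly V x)) r
        = (\<integral>\<omega>. (indicator A \<omega> + indicator A \<omega> * (- 1 / poly U (Y r \<omega>))) / e \<partial>P y)"
      unfolding mean_def eq by (simp only: distrib_left mult_1_right times_divide_eq_right)
    also have "\<dots> = (prob A + mean y A (\<lambda>x. - 1 / poly U x) r) / e"
    proof -
      have "integrable (P y) (indicator A :: 'a \<Rightarrow> real)"
        using Am by (intro integrable_real_indicator) (simp_all add: sets_P less_top[symmetric])
      then show ?thesis
        unfolding mean_def integral_divide_zero using Am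
        by (subst Bochner_Integration.integral_add[OF _ integrable_bounded[OF fm fb Am that, of y]])
           (simp_all add: sets_P)
    qed
    finally show ?thesis .
  qed
  have m2: "mean y A (\<lambda>x. poly (gen_poly V) x / (1 + e * poly V x)\<^sup>2) r
      = mean y A (\<lambda>x. poly (gen_poly U) x / (poly U x)\<^sup>2) r / e" for r
  proof -
    have eq: "poly (gen_poly V) x / (1 + e * poly V x)\<^sup>2 = poly (gen_poly U) x / (poly U x)\<^sup>2 / e" for x
      using e by (simp add: gU pU)
    show ?thesis
      unfolding mean_def eq by (simp only: times_divide_eq_right integral_divide_zero)
  qed
  have "(prob A + mean y A (\<lambda>x. - 1 / poly U x) t) / e
      \<le> (prob A + (mean y A (\<lambda>x. - 1 / poly U x) s
          + (LBINT u:{s..t}. mean y A (\<lambda>x. poly (gen_poly U) x / (poly U x)\<^sup>2) u))) / e"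
    using mean_test_function_le[OF U s A, of y] e by (intro divide_right_mono add_left_mono) auto
  then show ?thesis
    using m1[of t] m1[of s] s by (simp add: m2 add_divide_distrib)
qed

text \<open>For the weight \<open>V\<close> the image \<open>gen_poly V\<close> is at most
  \<open>C * V\<close>, so the regularized means satisfy a Gronwall inequality whose constants do
  not depend on \<open>e\<close>. They are bounded for each fixed \<open>e\<close>, which is what
  makes Gronwall applicable, and Fatou's lemma removes \<open>e\<close>. The factor 2 is inherited
  from \<open>gronwall\<close>.\<close>

lemma moment_bound:
  obtains C where "0 < C" "\<And>t. 0 \<le> t \<Longrightarrow> integrable (P y) (\<lambda>\<omega>. (1 + (Y t \<omega>)\<^sup>2) ^ K)"
    "\<And>t. 0 \<le> t \<Longrightarrow> (\<integral>\<omega>. (1 + (Y t \<omega>)\<^sup>2) ^ K \<partial>P y) \<le> 2 * (1 + y\<^sup>2) ^ K * exp (2 * C * t)"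
proof -
  interpret prob_space "P y" by (rule prob_space_P)
  define V :: "real poly" where "V = [:1, 0, 1:] ^ K"
  have V: "dominating K V" and pV: "poly V x = (1 + x\<^sup>2) ^ K" for x
    by (simp_all only: V_def dominating_weight weight_poly)
  have V1: "1 \<le> poly V x" for x
    unfolding pV by (intro one_le_power) simp
  have "degree (gen_poly V) \<le> 2 * K"
    using V gen_poly(1)[of V] by (simp add: dominating_def)
  then obtain C where C: "0 < C" "\<And>x. \<bar>poly (gen_poly V) x\<bar> \<le> C * poly V x"
    using dominating_upper[OF V] by blast
  have \<Omega>: "space M \<in> sets (F 0)" "space M \<in> sets M"
    using sets.top[of "F 0"] by (simp_all add: space_F)
  have main: "mean y (space M) (\<lambda>x. poly V x / (1 + e * poly V x)) t \<le> 2 * poly V y * exp (2 * C * t)"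
    if e: "0 < e" and t: "0 \<le> t" for e t
  proof -
    let ?g = "\<lambda>x. poly V x / (1 + e * poly V x)"
    let ?h = "\<lambda>x. poly (gen_poly V) x / (1 + e * poly V x)\<^sup>2"
    have d1: "1 \<le> 1 + e * poly V x" "0 < 1 + e * poly V x" "0 < poly V x" for x
      using V1[of x] mult_pos_pos[OF e, of "poly V x"] by auto
    have gb: "\<bar>?g x\<bar> \<le> 1 / e" for x
      using d1[of x] e by (simp add: field_simps)
    have gh: "\<bar>?h x\<bar> \<le> C * ?g x" for x
    proof -
      have "\<bar>?h x\<bar> = \<bar>poly (gen_poly V) x\<bar> / (1 + e * poly V x)\<^sup>2"
        by simp
      \<comment> \<open>One of the two factors of the denominator is at least 1 and is dropped, so
        that the regularized \<open>V\<close> itself reappears on the right.\<close>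
      also have "\<dots> \<le> (C * poly V x) / (1 + e * poly V x)"
        using C d1[of x] self_le_power[OF d1(1)[of x], of 2] by (intro frac_le) auto
      finally show ?thesis
        by simp
    qed
    have hb: "\<bar>?h x\<bar> \<le> C * (1 / e)" for x
      using gh[of x] gb[of x] C(1) by (smt (verit) mult_left_mono)
    have gm: "?g \<in> borel_measurable borel" and hm: "?h \<in> borel_measurable borel"
      using less_imp_neq[OF d1(2)] by (intro borel_measurable_continuous_onI continuous_intros; force)+
    have i1: "set_integrable lborel {0..t} (mean y (space M) ?g)" for t
      using gb by (intro set_integrable_mean[OF \<Omega>(2) gm order.refl] mean_bound[OF _ \<Omega>(2)])
    have i2: "set_integrable lborel {0..t} (mean y (space M) ?h)" for t
      using hb by (intro set_integrable_mean[OF \<Omega>(2) hm order.refl] mean_bound[OF _ \<Omega>(2)])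
    have m0: "mean y (space M) ?g 0 \<le> poly V y"
    proof -
      have "mean y (space M) ?g 0 = (\<integral>\<omega>. ?g y \<partial>P y)"
        unfolding mean_def
      proof (rule integral_cong_AE)
        show "AE \<omega> in P y. indicator (space M) \<omega> * ?g (Y 0 \<omega>) = ?g y"
          using initial_value[of y] AE_space by eventually_elim (simp add: space_P)
        show "(\<lambda>\<omega>. indicator (space M) \<omega> * ?g (Y 0 \<omega>)) \<in> borel_measurable (P y)"
          using integrable_bounded[OF gm gb \<Omega>(2) order.refl] by (rule borel_measurable_integrable)
      qed simp
      also have "\<dots> = ?g y"
        by (simp add: prob_space)
      also have "\<dots> \<le> poly V y"
        using divide_left_mono[OF d1(1)[of y], of "poly V y"] d1[of y] by simp
      finally show ?thesis .
    qed
    have "mean y (space M) ?g u \<le> poly V y + C * (LBINT r:{0..u}. mean y (space M) ?g r)" if u: "0 \<le> u" for u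
    proof -
      have "mean y (space M) ?g u \<le> mean y (space M) ?g 0 + (LBINT r:{0..u}. mean y (space M) ?h r)"
        by (rule mean_regularized_le[OF V e order.refl u \<Omega>(1)])
      also have "(LBINT r:{0..u}. mean y (space M) ?h r) \<le> (LBINT r:{0..u}. C * mean y (space M) ?g r)"
      proof (rule set_integral_mono[OF i2])
        show "set_integrable lborel {0..u} (\<lambda>r. C * mean y (space M) ?g r)"
          using i1 by simp
        show "mean y (space M) ?h r \<le> C * mean y (space M) ?g r" if r: "r \<in> {0..u}" for r
        proof -
          have "mean y (space M) ?h r \<le> (\<integral>\<omega>. C * (indicator (space M) \<omega> * ?g (Y r \<omega>)) \<partial>P y)"
            unfolding mean_def
          proof (rule integral_mono)
            show "integrable (P y) (\<lambda>\<omega>. indicator (space M) \<omega> * ?h (Y r \<omega>))"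
              using r by (intro integrable_bounded[OF hm hb \<Omega>(2)]) simp
            show "integrable (P y) (\<lambda>\<omega>. C * (indicator (space M) \<omega> * ?g (Y r \<omega>)))"
              using r by (intro integrable_mult_right integrable_bounded[OF gm gb \<Omega>(2)]) simp
            show "indicator (space M) \<omega> * ?h (Y r \<omega>) \<le> C * (indicator (space M) \<omega> * ?g (Y r \<omega>))" for \<omega>
              using order.trans[OF abs_ge_self gh[of "Y r \<omega>"]] by (simp add: indicator_def)
          qed
          then show ?thesis
            by (simp only: mean_def integral_mult_right_zero)
        qed
      qed
      also have "\<dots> = C * (LBINT r:{0..u}. mean y (space M) ?g r)"
        by simp
      finally show ?thesis
        using m0 by linarith
    qed
    then have "mean y (space M) ?g t \<le> 2 * poly V y * exp (2 * C * (t - 0))"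
      using C(1) V1[of y] t mean_bound[of ?g "1 / e", OF gb \<Omega>(2)] i1
      by (intro gronwall[where B="1 / e"]) auto
    then show ?thesis
      by simp
  qed
  have nn: "(\<integral>\<^sup>+\<omega>. ennreal (poly V (Y t \<omega>)) \<partial>P y) \<le> ennreal (2 * poly V y * exp (2 * C * t))"
    if t: "0 \<le> t" for t
  proof -
    note [measurable] = Y_measurable_P[OF t]
    have Vm[measurable]: "poly V \<in> borel_measurable borel"
      by (intro borel_measurable_continuous_onI continuous_on_poly continuous_on_id)
    let ?g = "\<lambda>k x. poly V x / (1 + 1 / real (Suc k) * poly V x)"
    have g0: "0 \<le> ?g k x" for k x
      using V1[of x] by (intro divide_nonneg_nonneg add_nonneg_nonneg mult_nonneg_nonneg) auto
    have gb: "\<bar>?g k x\<bar> \<le> real (Suc k)" for k x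
    proof -
      have d: "0 < 1 + 1 / real (Suc k) * poly V x"
        using V1[of x] by (intro add_pos_nonneg mult_nonneg_nonneg) auto
      have "poly V x \<le> real (Suc k) * (1 + 1 / real (Suc k) * poly V x)"
        by (simp add: distrib_left del: of_nat_Suc)
      then have "?g k x \<le> real (Suc k)"
        using d by (simp only: pos_divide_le_eq)
      then show ?thesis
        by (simp only: abs_of_nonneg[OF g0])
    qed
    have gm[measurable]: "?g k \<in> borel_measurable borel" for k
      by measurable
    have "(\<integral>\<^sup>+\<omega>. ennreal (poly V (Y t \<omega>)) \<partial>P y) = (\<integral>\<^sup>+\<omega>. liminf (\<lambda>k. ennreal (?g k (Y t \<omega>))) \<partial>P y)"
    proof (rule nn_integral_cong)
      fix \<omega>
      have "(\<lambda>k. ennreal (?g k (Y t \<omega>))) \<longlonglongrightarrow> ennreal (poly V (Y t \<omega>))"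
        using tendsto_regularized[where a="poly V (Y t \<omega>)" and v="poly V (Y t \<omega>)" and j=1]
        by (intro tendsto_ennrealI) (simp only: power_one_right)
      then show "ennreal (poly V (Y t \<omega>)) = liminf (\<lambda>k. ennreal (?g k (Y t \<omega>)))"
        by (simp only: lim_imp_Liminf[OF sequentially_bot])
    qed
    also have "\<dots> \<le> liminf (\<lambda>k. \<integral>\<^sup>+\<omega>. ennreal (?g k (Y t \<omega>)) \<partial>P y)"
      by (rule nn_integral_liminf) measurable
    also have "\<dots> \<le> ennreal (2 * poly V y * exp (2 * C * t))"
    proof -
      have "(\<integral>\<^sup>+\<omega>. ennreal (?g k (Y t \<omega>)) \<partial>P y) \<le> ennreal (2 * poly V y * exp (2 * C * t))" for k
      proof -
        have "integrable (P y) (\<lambda>\<omega>. indicator (space M) \<omega> * ?g k (Y t \<omega>))"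
          by (rule integrable_bounded[OF gm gb \<Omega>(2) t])
        then have "(\<integral>\<^sup>+\<omega>. ennreal (indicator (space M) \<omega> * ?g k (Y t \<omega>)) \<partial>P y)
            = ennreal (mean y (space M) (?g k) t)"
          unfolding mean_def by (rule nn_integral_eq_integral) (intro AE_I2 mult_nonneg_nonneg g0, simp)
        also have "\<dots> \<le> ennreal (2 * poly V y * exp (2 * C * t))"
          by (intro ennreal_leI main t) simp
        also have "(\<integral>\<^sup>+\<omega>. ennreal (indicator (space M) \<omega> * ?g k (Y t \<omega>)) \<partial>P y)
            = (\<integral>\<^sup>+\<omega>. ennreal (?g k (Y t \<omega>)) \<partial>P y)"
          by (intro nn_integral_cong) (simp add: space_P)
        finally show ?thesis .
      qed
      then show ?thesis
        by (intro Liminf_le always_eventually) auto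
    qed
    finally show ?thesis .
  qed
  show ?thesis
  proof (rule that[OF C(1)])
    fix t :: real assume t: "0 \<le> t"
    note [measurable] = Y_measurable_P[OF t]
    show int: "integrable (P y) (\<lambda>\<omega>. (1 + (Y t \<omega>)\<^sup>2) ^ K)"
    proof (rule integrableI_nonneg)
      show "(\<integral>\<^sup>+\<omega>. ennreal ((1 + (Y t \<omega>)\<^sup>2) ^ K) \<partial>P y) < \<infinity>"
        using order.strict_trans1[OF nn[OF t] ennreal_less_top] by (simp add: pV)
    qed auto
    have "ennreal (\<integral>\<omega>. (1 + (Y t \<omega>)\<^sup>2) ^ K \<partial>P y) \<le> ennreal (2 * (1 + y\<^sup>2) ^ K * exp (2 * C * t))"
      using nn[OF t] by (subst nn_integral_eq_integral[OF int, symmetric]) (auto simp: pV)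
    then show "(\<integral>\<omega>. (1 + (Y t \<omega>)\<^sup>2) ^ K \<partial>P y) \<le> 2 * (1 + y\<^sup>2) ^ K * exp (2 * C * t)"
      by (subst (asm) ennreal_le_iff) auto
  qed
qed

section \<open>Polynomials of the process\<close>

lemma poly_measurable: "poly q \<in> borel_measurable borel" for q :: "real poly"
  by (intro borel_measurable_continuous_onI continuous_on_poly continuous_on_id)

lemma integrable_poly:
  assumes t: "0 \<le> t"
  shows "integrable (P y) (\<lambda>\<omega>. poly q (Y t \<omega>))"
proof -
  obtain B where B: "0 < B" "\<And>x. \<bar>poly q x\<bar> \<le> B * (1 + x\<^sup>2) ^ degree q"
    using poly_le_weight[of q "degree q"] by auto
  have "integrable (P y) (\<lambda>\<omega>. (1 + (Y t \<omega>)\<^sup>2) ^ degree q)"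
    by (rule moment_bound[of y "degree q"]) (use t in blast)
  then have "integrable (P y) (\<lambda>\<omega>. B * (1 + (Y t \<omega>)\<^sup>2) ^ degree q)"
    by simp
  then show ?thesis
  proof (rule Bochner_Integration.integrable_bound)
    show "(\<lambda>\<omega>. poly q (Y t \<omega>)) \<in> borel_measurable (P y)"
      by (rule measurable_compose[OF Y_measurable_P[OF t] poly_measurable])
    show "AE \<omega> in P y. norm (poly q (Y t \<omega>)) \<le> norm (B * (1 + (Y t \<omega>)\<^sup>2) ^ degree q)"
      unfolding real_norm_def by (intro AE_I2 order.trans[OF B(2) abs_ge_self])
  qed
qed

lemma integrable_indicator_poly:
  assumes "0 \<le> t" "A \<in> sets M"
  shows "integrable (P y) (\<lambda>\<omega>. indicator A \<omega> * poly q (Y t \<omega>))"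
  using integrable_mult_indicator[OF _ integrable_poly[OF assms(1)], of A y q] assms(2)
  by (simp add: sets_P)

text \<open>The exponential in the moment bound increases with time, so its value at
  \<open>T\<close> serves for the whole interval. Uniformity in time is what dominated convergence
  under the time integral and the later Gronwall argument consume.\<close>

lemma mean_poly_bound:
  assumes A: "A \<in> sets M"
  obtains B where "\<And>u. 0 \<le> u \<Longrightarrow> u \<le> T \<Longrightarrow> \<bar>mean y A (poly q) u\<bar> \<le> B"
proof -
  obtain B where B: "0 < B" "\<And>x. \<bar>poly q x\<bar> \<le> B * (1 + x\<^sup>2) ^ degree q"
    using poly_le_weight[of q "degree q"] by auto
  obtain C where C: "0 < C" "\<And>t. 0 \<le> t \<Longrightarrow> integrable (P y) (\<lambda>\<omega>. (1 + (Y t \<omega>)\<^sup>2) ^ degree q)"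
    "\<And>t. 0 \<le> t \<Longrightarrow> (\<integral>\<omega>. (1 + (Y t \<omega>)\<^sup>2) ^ degree q \<partial>P y) \<le> 2 * (1 + y\<^sup>2) ^ degree q * exp (2 * C * t)"
    by (rule moment_bound[of y "degree q"]) blast
  have "\<bar>mean y A (poly q) u\<bar> \<le> B * (2 * (1 + y\<^sup>2) ^ degree q * exp (2 * C * T))"
    if u: "0 \<le> u" "u \<le> T" for u
  proof -
    have "\<bar>mean y A (poly q) u\<bar> \<le> (\<integral>\<omega>. \<bar>indicator A \<omega> * poly q (Y u \<omega>)\<bar> \<partial>P y)"
      unfolding mean_def by (rule integral_abs_bound)
    also have "\<dots> \<le> (\<integral>\<omega>. B * (1 + (Y u \<omega>)\<^sup>2) ^ degree q \<partial>P y)"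
    proof (rule integral_mono')
      show "integrable (P y) (\<lambda>\<omega>. B * (1 + (Y u \<omega>)\<^sup>2) ^ degree q)"
        using C(2)[OF u(1)] by simp
      show "\<bar>indicator A \<omega> * poly q (Y u \<omega>)\<bar> \<le> B * (1 + (Y u \<omega>)\<^sup>2) ^ degree q" for \<omega>
        using B(1) B(2)[of "Y u \<omega>"] by (auto simp: indicator_def)
    qed (use B(1) in auto)
    also have "\<dots> = B * (\<integral>\<omega>. (1 + (Y u \<omega>)\<^sup>2) ^ degree q \<partial>P y)"
      by simp
    also have "\<dots> \<le> B * (2 * (1 + y\<^sup>2) ^ degree q * exp (2 * C * u))"
      using B(1) C(3)[OF u(1)] by (intro mult_left_mono) auto
    also have "\<dots> \<le> B * (2 * (1 + y\<^sup>2) ^ degree q * exp (2 * C * T))"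
      using B(1) C(1) u by (intro mult_left_mono) auto
    finally show ?thesis .
  qed
  then show ?thesis
    by (rule that)
qed

lemma set_integrable_mean_poly:
  assumes "A \<in> sets M" "0 \<le> s"
  shows "set_integrable lborel {s..t} (mean y A (poly q))"
proof -
  obtain B where "\<And>u. 0 \<le> u \<Longrightarrow> u \<le> t \<Longrightarrow> \<bar>mean y A (poly q) u\<bar> \<le> B"
    by (rule mean_poly_bound[OF assms(1), where T=t and y=y and q=q]) blast
  then show ?thesis
    using assms by (intro set_integrable_mean[OF assms(1) poly_measurable, where B=B]) auto
qed

text \<open>Moments of every order are now available, so \<open>e = 1 / (k + 1)\<close> may tend to
  0 in the regularized inequality by dominated convergence, under the expectation and then under the
  time integral.\<close>

lemma mean_poly_le:
  assumes V: "dominating K V" and s: "0 \<le> s" "s \<le> t" and A: "A \<in> sets (F s)"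
  shows "mean y A (poly V) t \<le> mean y A (poly V) s + (LBINT u:{s..t}. mean y A (poly (gen_poly V)) u)"
proof -
  have Am[measurable]: "A \<in> sets M"
    by (rule sets_F_P[OF A])
  obtain c where c: "0 < c" "\<And>x. c \<le> poly V x"
    using dominating_lower[OF V] by blast
  have pos: "0 < poly V x" for x
    using c(1) c(2)[of x] by linarith
  let ?d = "\<lambda>k x. 1 + 1 / real (Suc k) * poly V x"
  have d1: "1 \<le> ?d k x" for k x
    using less_imp_le[OF pos[of x]] by simp
  have bound: "\<bar>poly q x / ?d k x ^ j\<bar> \<le> \<bar>poly q x\<bar>" for q k x j
  proof -
    have "1 \<le> ?d k x ^ j"
      by (rule one_le_power[OF d1])
    then have "\<bar>poly q x\<bar> / ?d k x ^ j \<le> \<bar>poly q x\<bar> / 1"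
      by (intro divide_left_mono) auto
    moreover have "\<bar>poly q x / ?d k x ^ j\<bar> = \<bar>poly q x\<bar> / ?d k x ^ j"
      using \<open>1 \<le> ?d k x ^ j\<close> by (simp only: abs_divide abs_of_nonneg[of "?d k x ^ j"])
    ultimately show ?thesis
      by (simp only: div_by_1)
  qed
  have qm: "(\<lambda>x. poly q x / ?d k x ^ j) \<in> borel_measurable borel" for q k j
    using poly_measurable[measurable] by measurable
  have lim: "(\<lambda>k. mean y A (\<lambda>x. poly q x / ?d k x ^ j) u) \<longlonglongrightarrow> mean y A (poly q) u"
    if u: "0 \<le> u" for q j u
    unfolding mean_def
  proof (rule integral_dominated_convergence[where w="\<lambda>\<omega>. \<bar>poly q (Y u \<omega>)\<bar>"])
    note [measurable] = Y_measurable_P[OF u] qm poly_measurable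
    have [measurable]: "A \<in> sets (P y)"
      using Am by (simp add: sets_P)
    show "(\<lambda>\<omega>. indicator A \<omega> * poly q (Y u \<omega>)) \<in> borel_measurable (P y)"
      by measurable
    show "(\<lambda>\<omega>. indicator A \<omega> * (poly q (Y u \<omega>) / ?d k (Y u \<omega>) ^ j)) \<in> borel_measurable (P y)" for k
      by measurable
    show "integrable (P y) (\<lambda>\<omega>. \<bar>poly q (Y u \<omega>)\<bar>)"
      using integrable_poly[OF u] by simp
    show "AE \<omega> in P y. (\<lambda>k. indicator A \<omega> * (poly q (Y u \<omega>) / ?d k (Y u \<omega>) ^ j))
        \<longlonglongrightarrow> indicator A \<omega> * poly q (Y u \<omega>)"
      by (intro AE_I2 tendsto_mult tendsto_const tendsto_regularized)
    show "AE \<omega> in P y. norm (indicator A \<omega> * (poly q (Y u \<omega>) / ?d k (Y u \<omega>) ^ j)) \<le> \<bar>poly q (Y u \<omega>)\<bar>" for k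
    proof (rule AE_I2)
      fix \<omega>
      show "norm (indicator A \<omega> * (poly q (Y u \<omega>) / ?d k (Y u \<omega>) ^ j)) \<le> \<bar>poly q (Y u \<omega>)\<bar>"
        using bound[of q "Y u \<omega>" k j] by (cases "\<omega> \<in> A") simp_all
    qed
  qed
  have lim_int: "(\<lambda>k. LBINT u:{s..t}. mean y A (\<lambda>x. poly q x / ?d k x ^ j) u)
      \<longlonglongrightarrow> (LBINT u:{s..t}. mean y A (poly q) u)" for q j
  proof -
    \<comment> \<open>The absolute value of \<open>q\<close> is not a polynomial;
      \<open>1 + q^2\<close> is a polynomial majorant, whose mean is bounded uniformly in
      time.\<close>
    define Q :: "real poly" where "Q = [:1:] + q * q"
    have Q: "\<bar>poly q x\<bar> \<le> poly Q x" for x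
    proof -
      have "\<bar>v\<bar> \<le> 1 + v * v" for v :: real
        using zero_le_square[of "v - 1"] zero_le_square[of "v + 1"]
        by (simp add: algebra_simps abs_le_iff) 
      then show ?thesis
        by (simp add: Q_def)
    qed
    obtain B where B: "\<And>u. 0 \<le> u \<Longrightarrow> u \<le> t \<Longrightarrow> \<bar>mean y A (poly Q) u\<bar> \<le> B"
      by (rule mean_poly_bound[OF Am, where T=t and y=y and q=Q]) blast
    have mb: "\<bar>mean y A (\<lambda>x. poly q x / ?d k x ^ j) u\<bar> \<le> B" if u: "0 \<le> u" "u \<le> t" for u k
    proof -
      have "\<bar>mean y A (\<lambda>x. poly q x / ?d k x ^ j) u\<bar>
          \<le> (\<integral>\<omega>. \<bar>indicator A \<omega> * (poly q (Y u \<omega>) / ?d k (Y u \<omega>) ^ j)\<bar> \<partial>P y)"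
        unfolding mean_def by (rule integral_abs_bound)
      also have "\<dots> \<le> mean y A (poly Q) u"
        unfolding mean_def
      proof (rule integral_mono')
        show "integrable (P y) (\<lambda>\<omega>. indicator A \<omega> * poly Q (Y u \<omega>))"
          by (rule integrable_indicator_poly[OF u(1) Am])
        fix \<omega>
        show "\<bar>indicator A \<omega> * (poly q (Y u \<omega>) / ?d k (Y u \<omega>) ^ j)\<bar> \<le> indicator A \<omega> * poly Q (Y u \<omega>)"
          using order.trans[OF bound[of q "Y u \<omega>" k j] Q[of "Y u \<omega>"]] by (cases "\<omega> \<in> A") simp_all
        show "0 \<le> indicator A \<omega> * poly Q (Y u \<omega>)"
          using order.trans[OF abs_ge_zero Q[of "Y u \<omega>"]] by simp
      qed
      also have "\<dots> \<le> B"
        using B[OF u] by linarith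
      finally show ?thesis .
    qed
    have mm: "(\<lambda>u. indicator {s..t} u *\<^sub>R mean y A h u) \<in> borel_measurable lborel"
      if h: "h \<in> borel_measurable borel" for h
    proof -
      note [measurable] = mean_measurable[OF Am h]
      have "(\<lambda>u. indicator {s..t} u *\<^sub>R mean y A h (max 0 u)) \<in> borel_measurable lborel"
        by measurable
      moreover have "(\<lambda>u. indicator {s..t} u *\<^sub>R mean y A h (max 0 u)) = (\<lambda>u. indicator {s..t} u *\<^sub>R mean y A h u)"
        using s by (auto simp: indicator_def max_def fun_eq_iff)
      ultimately show ?thesis
        by (simp only:)
    qed
    show ?thesis
      unfolding set_lebesgue_integral_def
    proof (rule integral_dominated_convergence[where w="\<lambda>u. B * indicator {s..t} u"])
      show "integrable lborel (\<lambda>u. B * indicator {s..t} u)"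
        by (intro integrable_mult_right integrable_real_indicator) (auto simp: emeasure_lborel_Icc_eq)
      show "AE u in lborel. (\<lambda>k. indicator {s..t} u *\<^sub>R mean y A (\<lambda>x. poly q x / ?d k x ^ j) u)
          \<longlonglongrightarrow> indicator {s..t} u *\<^sub>R mean y A (poly q) u"
      proof (rule AE_I2)
        fix u :: real
        show "(\<lambda>k. indicator {s..t} u *\<^sub>R mean y A (\<lambda>x. poly q x / ?d k x ^ j) u)
            \<longlonglongrightarrow> indicator {s..t} u *\<^sub>R mean y A (poly q) u"
        proof (cases "u \<in> {s..t}")
          case True
          then have "0 \<le> u"
            using s by simp
          then show ?thesis
            by (intro tendsto_scaleR tendsto_const lim)
        qed simp
      qed
      show "AE u in lborel. norm (indicator {s..t} u *\<^sub>R mean y A (\<lambda>x. poly q x / ?d k x ^ j) u)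
          \<le> B * indicator {s..t} u" for k
      proof (rule AE_I2)
        fix u :: real
        show "norm (indicator {s..t} u *\<^sub>R mean y A (\<lambda>x. poly q x / ?d k x ^ j) u) \<le> B * indicator {s..t} u"
          using mb[of u k] s by (cases "u \<in> {s..t}") simp_all
      qed
    qed (intro mm qm poly_measurable)+
  qed
  have t: "0 \<le> t"
    using s by simp
  show ?thesis
  proof (rule LIMSEQ_le[OF lim[OF t, of V 1] tendsto_add[OF lim[OF s(1), of V 1] lim_int[of "gen_poly V" 2]]],
      intro exI allI impI)
    show "mean y A (\<lambda>x. poly V x / ?d k x ^ 1) t \<le> mean y A (\<lambda>x. poly V x / ?d k x ^ 1) s
        + (LBINT u:{s..t}. mean y A (\<lambda>x. poly (gen_poly V) x / (?d k x)\<^sup>2) u)" for k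
      using mean_regularized_le[OF V _ s A, of "1 / real (Suc k)" y] by (simp only: power_one_right) simp
  qed
qed

section \<open>The martingale identity for polynomials\<close>

lemma mean_poly_add:
  assumes "0 \<le> u" "A \<in> sets M"
  shows "mean y A (poly (p + q)) u = mean y A (poly p) u + mean y A (poly q) u"
  unfolding mean_def
  by (subst Bochner_Integration.integral_add[symmetric])
     (auto intro!: integrable_indicator_poly assms simp: distrib_left)

lemma mean_poly_smult: "mean y A (poly (Polynomial.smult c p)) u = c * mean y A (poly p) u"
  unfolding mean_def by (subst integral_mult_right_zero[symmetric]) (simp add: mult_ac)

text \<open>The failure of the martingale identity between \<open>s\<close> and \<open>t\<close>,
  tested against \<open>A\<close>. It is linear in \<open>p\<close> and zero on constants, which
  reduces the perturbation of \<open>p\<close> to a computation with numbers.\<close>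

definition defect :: "real \<Rightarrow> 'a set \<Rightarrow> real \<Rightarrow> real \<Rightarrow> real poly \<Rightarrow> real" where
  "defect y A s t p = mean y A (poly p) t - mean y A (poly p) s - (LBINT u:{s..t}. mean y A (poly (gen_poly p)) u)"

lemma defect_add:
  assumes s: "0 \<le> s" "s \<le> t" and A: "A \<in> sets M"
  shows "defect y A s t (p + q) = defect y A s t p + defect y A s t q"
proof -
  have "(LBINT u:{s..t}. mean y A (poly (gen_poly (p + q))) u)
      = (LBINT u:{s..t}. mean y A (poly (gen_poly p)) u + mean y A (poly (gen_poly q)) u)"
    using s by (intro set_lebesgue_integral_cong) (auto simp: gen_poly_add mean_poly_add[OF _ A] simp del: poly_add)
  also have "\<dots> = (LBINT u:{s..t}. mean y A (poly (gen_poly p)) u) + (LBINT u:{s..t}. mean y A (poly (gen_poly q)) u)"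
    by (intro set_integral_add set_integrable_mean_poly A s)
  finally show ?thesis
    using s mean_poly_add[OF _ A, of s] mean_poly_add[OF _ A, of t]
    by (simp add: defect_def del: poly_add)
qed

lemma defect_smult: "defect y A s t (Polynomial.smult c p) = c * defect y A s t p"
  by (simp add: defect_def gen_poly_smult mean_poly_smult right_diff_distrib del: poly_smult)

lemma defect_const: "defect y A s t [:c:] = 0"
proof -
  have "mean y A (poly 0) = (\<lambda>_. 0)"
    by (simp add: mean_def fun_eq_iff)
  then show ?thesis
    unfolding defect_def gen_poly_const by (simp add: mean_def)
qed

text \<open>The inequality for dominating polynomials becomes an equality for every \<open>p\<close>: the polynomial
  \<open>d (1 + x\<^sup>2) ^ (2 K) - p\<close> plus a constant is dominating for every \<open>d > 0\<close>.\<close>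

lemma defect_nonneg:
  assumes s: "0 \<le> s" "s \<le> t" and A: "A \<in> sets (F s)"
  shows "0 \<le> defect y A s t p"
proof -
  define K where "K = degree p"
  define V :: "real poly" where "V = [:1, 0, 1:] ^ (2 * K)"
  have Am: "A \<in> sets M"
    by (rule sets_F_P[OF A])
  obtain C where C: "0 < C" "\<And>x. \<bar>poly p x\<bar> \<le> C * (1 + x\<^sup>2) ^ K"
    using poly_le_weight[of p K] by (auto simp: K_def)
  have *: "d * defect y A s t V \<le> defect y A s t p" if d: "0 < d" for d
  proof -
    \<comment> \<open>Completing the square: with \<open>w = (1 + x^2)^K\<close> this
      \<open>c\<close> turns \<open>d / 2 * w^2 - C * w + c\<close> into
      \<open>d / 2 * (w - C / d)^2\<close>. One half of the leading term absorbs \<open>p\<close>,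
      the other half remains as the lower bound.\<close>
    define c where "c = C\<^sup>2 / (2 * d)"
    define U where "U = Polynomial.smult d V + (Polynomial.smult (- 1) p + [:c:])"
    have "dominating (2 * K) U"
      unfolding dominating_def
    proof (intro conjI exI[of _ "d / 2"] allI)
      show "degree U \<le> 2 * (2 * K)"
        unfolding U_def V_def
        by (intro degree_add_le order.trans[OF degree_smult_le] weight_poly) (auto simp: K_def)
      show "0 < d / 2"
        using d by simp
      fix x :: real
      let ?w = "(1 + x\<^sup>2) ^ K"
      have "0 \<le> d / 2 * (?w - C / d)\<^sup>2"
        using d by simp
      also have "d / 2 * (?w - C / d)\<^sup>2 = d / 2 * ?w\<^sup>2 - C * ?w + c"
        using d by (simp add: c_def power2_diff power_divide) (simp add: field_simps power2_eq_square)
      also have "\<dots> \<le> d / 2 * ?w\<^sup>2 - poly p x + c"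
        using C(2)[of x] by (simp add: abs_le_iff)
      finally have "d / 2 * ?w\<^sup>2 \<le> d * ?w\<^sup>2 - poly p x + c"
        by simp
      moreover have "poly U x = d * ?w\<^sup>2 - poly p x + c"
        unfolding U_def V_def poly_add poly_smult weight_poly(1)
        by (simp add: power_mult mult.commute[of 2])
      ultimately show "d / 2 * (1 + x\<^sup>2) ^ (2 * K) \<le> poly U x"
        by (simp only: power_mult mult.commute[of 2])
    qed
    then have "defect y A s t U \<le> 0"
      using mean_poly_le[OF _ s A, of "2 * K" U y] by (simp add: defect_def)
    moreover have "defect y A s t U = d * defect y A s t V - defect y A s t p"
      unfolding U_def defect_add[OF s Am] defect_smult defect_const by simp
    ultimately show ?thesis
      by simp
  qed
  show ?thesis
  proof (rule LIMSEQ_le_const2)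
    show "(\<lambda>k. 1 / real (Suc k) * defect y A s t V) \<longlonglongrightarrow> 0"
      using tendsto_mult[OF LIMSEQ_Suc[OF lim_1_over_n] tendsto_const, of "defect y A s t V"] by simp
    show "\<exists>N. \<forall>k\<ge>N. 1 / real (Suc k) * defect y A s t V \<le> defect y A s t p"
      by (intro exI[of _ 0] allI impI *) simp
  qed
qed

text \<open>The defects of \<open>p\<close> and of \<open>- p\<close> are both nonnegative, and they
  are opposite numbers.\<close>

lemma mean_poly_eq:
  assumes s: "0 \<le> s" "s \<le> t" and A: "A \<in> sets (F s)"
  shows "mean y A (poly p) t = mean y A (poly p) s + (LBINT u:{s..t}. mean y A (poly (gen_poly p)) u)"
  using defect_nonneg[OF s A, of y p] defect_nonneg[OF s A, of y "Polynomial.smult (- 1) p"]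
  unfolding defect_smult by (simp add: defect_def)

end

subsection \<open>Kronecker products\<close>

lemma sum_div_mod:
  fixes f :: "nat \<Rightarrow> nat \<Rightarrow> real"
  shows "(\<Sum>q<R * N. f (q div N) (q mod N)) = (\<Sum>j<R. \<Sum>i<N. f j i)"
proof -
  have "(\<Sum>q<R * N. f (q div N) (q mod N))
      = (\<Sum>j<R. sum (\<lambda>q. f (q div N) (q mod N)) {j * N..<j * N + N})"
    by (rule sum.nat_group[symmetric])
  also have "\<dots> = (\<Sum>j<R. \<Sum>i<N. f j i)"
  proof (rule sum.cong[OF refl])
    fix j
    have "sum (\<lambda>q. f (q div N) (q mod N)) {j * N..<j * N + N}
        = sum (\<lambda>q. f (q div N) (q mod N)) {0 + j * N..<N + j * N}"
      by (simp add: add.commute)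
    also have "\<dots> = (\<Sum>i = 0..<N. f ((i + j * N) div N) ((i + j * N) mod N))"
      by (rule sum.shift_bounds_nat_ivl)
    also have "\<dots> = (\<Sum>i<N. f j i)"
      by (intro sum.cong) auto
    finally show "sum (\<lambda>q. f (q div N) (q mod N)) {j * N..<j * N + N} = (\<Sum>i<N. f j i)" .
  qed
  finally show ?thesis .
qed

lemma index_mult_mat_sum:
  assumes "A \<in> carrier_mat nr n" "B \<in> carrier_mat n nc" "i < nr" "j < nc"
  shows "(A * B) $$ (i, j) = (\<Sum>k<n. A $$ (i, k) * B $$ (k, j))"
  using assms by (auto simp: scalar_prod_def lessThan_atLeast0 intro!: sum.cong)

lemma kron_carrier:
  assumes "A \<in> carrier_mat a b" "B \<in> carrier_mat c d"
  shows "A \<otimes>\<^sub>K B \<in> carrier_mat (a * c) (b * d)"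
  using assms by (auto simp: kron_def)

lemma dim_kron [simp]:
  "dim_row (A \<otimes>\<^sub>K B) = dim_row A * dim_row B" "dim_col (A \<otimes>\<^sub>K B) = dim_col A * dim_col B"
  by (simp_all add: kron_def)

lemma kron_index:
  "i < dim_row A * dim_row B \<Longrightarrow> j < dim_col A * dim_col B \<Longrightarrow>
    (A \<otimes>\<^sub>K B) $$ (i, j) = A $$ (i div dim_row B, j div dim_col B) * B $$ (i mod dim_row B, j mod dim_col B)"
  by (simp add: kron_def)

lemma div_mod_less:
  fixes i a c :: nat
  assumes "i < a * c"
  shows "i div c < a" "i mod c < c"
  using assms by (auto simp: less_mult_imp_div_less intro!: mod_less_divisor Nat.gr0I)

lemma kron_mult:
  assumes A: "A \<in> carrier_mat a b" and B: "B \<in> carrier_mat c d"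
    and C: "C \<in> carrier_mat b e" and D: "D \<in> carrier_mat d f"
  shows "(A \<otimes>\<^sub>K B) * (C \<otimes>\<^sub>K D) = (A * C) \<otimes>\<^sub>K (B * D)"
proof (rule eq_matI)
  fix i j assume "i < dim_row ((A * C) \<otimes>\<^sub>K (B * D))" "j < dim_col ((A * C) \<otimes>\<^sub>K (B * D))"
  then have ij: "i < a * c" "j < e * f"
    using A B C D by auto
  note i = div_mod_less[OF ij(1)] and j = div_mod_less[OF ij(2)]
  have "((A \<otimes>\<^sub>K B) * (C \<otimes>\<^sub>K D)) $$ (i, j) = (\<Sum>q<b * d. (A \<otimes>\<^sub>K B) $$ (i, q) * (C \<otimes>\<^sub>K D) $$ (q, j))"
    by (rule index_mult_mat_sum[OF kron_carrier[OF A B] kron_carrier[OF C D] ij])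
  also have "\<dots> = (\<Sum>q<b * d. (A $$ (i div c, q div d) * C $$ (q div d, j div f))
      * (B $$ (i mod c, q mod d) * D $$ (q mod d, j mod f)))"
    using A B C D ij by (intro sum.cong) (auto simp: kron_index)
  also have "\<dots> = (\<Sum>k<b. \<Sum>r<d. (A $$ (i div c, k) * C $$ (k, j div f))
      * (B $$ (i mod c, r) * D $$ (r, j mod f)))"
    by (rule sum_div_mod)
  also have "\<dots> = (A * C) $$ (i div c, j div f) * (B * D) $$ (i mod c, j mod f)"
    unfolding index_mult_mat_sum[OF A C i(1) j(1)] index_mult_mat_sum[OF B D i(2) j(2)] sum_product ..
  also have "\<dots> = ((A * C) \<otimes>\<^sub>K (B * D)) $$ (i, j)"
    using A B C D ij by (auto simp: kron_index)
  finally show "((A \<otimes>\<^sub>K B) * (C \<otimes>\<^sub>K D)) $$ (i, j) = ((A * C) \<otimes>\<^sub>K (B * D)) $$ (i, j)" .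
qed (use A B C D in auto)

lemma kron_one: "1\<^sub>m a \<otimes>\<^sub>K 1\<^sub>m b = 1\<^sub>m (a * b)"
proof (rule eq_matI)
  fix i j assume "i < dim_row (1\<^sub>m (a * b) :: real mat)" "j < dim_col (1\<^sub>m (a * b) :: real mat)"
  then have ij: "i < a * b" "j < a * b"
    by auto
  have "i div b = j div b \<Longrightarrow> i mod b = j mod b \<Longrightarrow> i = j"
    by (metis div_mult_mod_eq)
  then show "(1\<^sub>m a \<otimes>\<^sub>K 1\<^sub>m b) $$ (i, j) = 1\<^sub>m (a * b) $$ (i, j)"
    using ij div_mod_less[OF ij(1)] div_mod_less[OF ij(2)] by (auto simp: kron_index)
qed auto

lemma kron_one_left: "1\<^sub>m 1 \<otimes>\<^sub>K B = B"
  by (rule eq_matI) (auto simp: kron_index)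

lemma kron_one_right: "B \<otimes>\<^sub>K 1\<^sub>m 1 = B"
  by (rule eq_matI) (auto simp: kron_index)

lemma kron_assoc: "(A \<otimes>\<^sub>K B) \<otimes>\<^sub>K C = A \<otimes>\<^sub>K (B \<otimes>\<^sub>K C)"
proof (rule eq_matI)
  fix i j assume "i < dim_row (A \<otimes>\<^sub>K (B \<otimes>\<^sub>K C))" "j < dim_col (A \<otimes>\<^sub>K (B \<otimes>\<^sub>K C))"
  then have i: "i < dim_row A * dim_row B * dim_row C" and j: "j < dim_col A * dim_col B * dim_col C"
    by (auto simp: mult.assoc)
  have *: "k mod (b * c) div c = k div c mod b" "k mod (b * c) mod c = k mod c" "k div (b * c) = k div c div b"
    for k b c :: nat
    by (cases "c = 0"; simp add: mult.commute[of b c] div_mult2_eq mod_mult2_eq)+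
  have b: "k mod (b * c) < b * c" if "k < a * b * c" for k a b c :: nat
    using that by (intro mod_less_divisor Nat.gr0I) auto
  note b[OF i] b[OF j]
  then show "((A \<otimes>\<^sub>K B) \<otimes>\<^sub>K C) $$ (i, j) = (A \<otimes>\<^sub>K (B \<otimes>\<^sub>K C)) $$ (i, j)"
    using i j div_mod_less[OF i] div_mod_less[OF j]
    by (simp add: kron_index mult.assoc[symmetric] * )
qed (auto simp: mult.assoc)

lemma kron_transpose: "(A \<otimes>\<^sub>K B)\<^sup>T = A\<^sup>T \<otimes>\<^sub>K B\<^sup>T"
  by (rule eq_matI) (auto simp: kron_index div_mod_less)

lemma kron_power_carrier:
  assumes "A \<in> carrier_mat a b"
  shows "kron_power A r \<in> carrier_mat (a ^ r) (b ^ r)"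
  using assms by (induction r) (auto intro: kron_carrier)

text \<open>The recursion of \<open>kron_power\<close> adds its factor on the left, whereas
  \<open>X_mat\<close> and the coefficient vectors require the last factor to be split off.\<close>

lemma kron_power_right: "A \<otimes>\<^sub>K kron_power A r = kron_power A r \<otimes>\<^sub>K A"
proof (induction r)
  case 0
  show ?case
    by (simp add: kron_one_left[simplified] kron_one_right[simplified])
next
  case (Suc r)
  have "A \<otimes>\<^sub>K kron_power A (Suc r) = A \<otimes>\<^sub>K (kron_power A r \<otimes>\<^sub>K A)"
    unfolding kron_power.simps Suc ..
  then show ?case
    by (simp only: kron_power.simps kron_assoc)
qed

lemma kron_power_transpose: "kron_power A\<^sup>T r = (kron_power A r)\<^sup>T"
  by (induction r) (simp_all add: kron_transpose)

lemma kron_power_one: "kron_power (1\<^sub>m a) r = 1\<^sub>m (a ^ r)"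
  by (induction r) (simp_all add: kron_one)

lemma kron_prefix_eq: "kron_prefix d A B = kron_power A d \<otimes>\<^sub>K B"
  by (simp add: kron_prefix_def kron_one_left[simplified])

section \<open>Vectorization\<close>

lemma monomials_carrier: "monomials n x \<in> carrier_mat (n + 1) 1"
  by (simp add: monomials_def)

text \<open>Column \<open>j\<close> of the row-by-column product is the \<open>j\<close>-th entry of
  \<open>K\<close> times \<open>H\<close>; stacked, these columns are the blocks of the Kronecker
  product of the two columns.\<close>

lemma vectorize_kron:
  assumes K: "K \<in> carrier_mat R 1" and H: "H \<in> carrier_mat N 1"
  shows "vectorize (K\<^sup>T \<otimes>\<^sub>K H) = K \<otimes>\<^sub>K H"
proof (rule eq_matI)
  fix i j assume "i < dim_row (K \<otimes>\<^sub>K H)" "j < dim_col (K \<otimes>\<^sub>K H)"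
  then have ij: "i < R * N" "j = 0"
    using K H by auto
  note i = div_mod_less[OF ij(1)]
  have "vectorize (K\<^sup>T \<otimes>\<^sub>K H) $$ (i, j) = (K\<^sup>T \<otimes>\<^sub>K H) $$ (i mod N, i div N)"
    using K H ij by (simp add: vectorize_def mult.commute)
  also have "\<dots> = K $$ (i div N, 0) * H $$ (i mod N, 0)"
    using K H i by (subst kron_index) auto
  also have "\<dots> = (K \<otimes>\<^sub>K H) $$ (i, j)"
    using K H ij by (subst kron_index) auto
  finally show "vectorize (K\<^sup>T \<otimes>\<^sub>K H) $$ (i, j) = (K \<otimes>\<^sub>K H) $$ (i, j)" .
qed (use K H in \<open>auto simp: vectorize_def mult.commute\<close>)

lemma vectorize_X_mat: "vectorize (X_mat n r x) = kron_power (monomials n x) (Suc r)"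
proof -
  have "kron_power (monomials n x) r \<in> carrier_mat ((n + 1) ^ r) 1"
    using kron_power_carrier[OF monomials_carrier, of n x r] by simp
  from vectorize_kron[OF this monomials_carrier] show ?thesis
    unfolding X_mat_def kron_prefix_eq kron_power_transpose kron_power.simps kron_power_right .
qed

text \<open>The familiar identity between a bilinear form of a matrix and a linear form of its
  vectorization. It rewrites the two-sided product of the correlator formula as a single linear
  functional.\<close>

lemma unvectorize_form:
  assumes p: "p \<in> carrier_mat N 1" and w: "w \<in> carrier_mat R 1" and v: "v \<in> carrier_mat (R * N) 1"
  shows "(p\<^sup>T * unvectorize N R v * w) $$ (0, 0) = ((w \<otimes>\<^sub>K p)\<^sup>T * v) $$ (0, 0)"
proof -
  have u: "unvectorize N R v \<in> carrier_mat N R"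
    by (simp add: unvectorize_def)
  have pT: "p\<^sup>T \<in> carrier_mat 1 N"
    using p by simp
  have "(p\<^sup>T * unvectorize N R v * w) $$ (0, 0)
      = (\<Sum>j<R. (\<Sum>i<N. p\<^sup>T $$ (0, i) * unvectorize N R v $$ (i, j)) * w $$ (j, 0))"
    using index_mult_mat_sum[OF mult_carrier_mat[OF pT u] w, of 0 0] index_mult_mat_sum[OF pT u, of 0] by simp
  also have "\<dots> = (\<Sum>j<R. \<Sum>i<N. w $$ (j, 0) * p $$ (i, 0) * v $$ (j * N + i, 0))"
    using p by (auto simp: sum_distrib_right unvectorize_def intro!: sum.cong)
  also have "\<dots> = (\<Sum>q<R * N. w $$ (q div N, 0) * p $$ (q mod N, 0) * v $$ (q div N * N + q mod N, 0))"
    by (rule sum_div_mod[symmetric])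
  also have "\<dots> = (\<Sum>q<R * N. (w \<otimes>\<^sub>K p)\<^sup>T $$ (0, q) * v $$ (q, 0))"
    using p w by (intro sum.cong) (auto simp: kron_index)
  also have "\<dots> = ((w \<otimes>\<^sub>K p)\<^sup>T * v) $$ (0, 0)"
    using kron_carrier[OF w p] v by (subst index_mult_mat_sum[of _ 1 "R * N" _ 1]) auto
  finally show ?thesis .
qed

subsection \<open>The matrix exponential\<close>

lemma pow_smult_mat:
  fixes A :: "real mat"
  assumes "A \<in> carrier_mat N N"
  shows "(c \<cdot>\<^sub>m A) ^\<^sub>m k = c ^ k \<cdot>\<^sub>m (A ^\<^sub>m k)"
proof (induction k)
  case 0
  show ?case
    using assms by auto
next
  case (Suc k)
  have Ak: "A ^\<^sub>m k \<in> carrier_mat N N"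
    using assms by simp
  have "(c \<cdot>\<^sub>m A) ^\<^sub>m Suc k = (c ^ k \<cdot>\<^sub>m (A ^\<^sub>m k)) * (c \<cdot>\<^sub>m A)"
    by (simp add: Suc)
  also have "\<dots> = c ^ k \<cdot>\<^sub>m (A ^\<^sub>m k * (c \<cdot>\<^sub>m A))"
    by (rule mult_smult_assoc_mat[OF Ak smult_carrier_mat[OF assms]])
  also have "A ^\<^sub>m k * (c \<cdot>\<^sub>m A) = c \<cdot>\<^sub>m (A ^\<^sub>m k * A)"
    by (rule mult_smult_distrib[OF Ak assms])
  finally show ?case
    by (intro eq_matI) (auto simp: mult_ac)
qed

lemma pow_mat_Suc_left:
  fixes A :: "real mat"
  assumes "A \<in> carrier_mat N N"
  shows "A ^\<^sub>m Suc k = A * A ^\<^sub>m k"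
proof (induction k)
  case 0
  show ?case
    using assms by simp
next
  case (Suc k)
  have "A ^\<^sub>m Suc (Suc k) = (A * A ^\<^sub>m k) * A"
    using Suc by simp
  also have "\<dots> = A * (A ^\<^sub>m k * A)"
    using assms by (intro assoc_mult_mat[of _ N N _ N _ N]) auto
  finally show ?case
    by simp
qed

lemma pow_mat_bound:
  fixes A :: "real mat"
  assumes A: "A \<in> carrier_mat N N"
  obtains L where "0 \<le> L" "\<And>i j k. i < N \<Longrightarrow> j < N \<Longrightarrow> \<bar>(A ^\<^sub>m k) $$ (i, j)\<bar> \<le> L ^ k"
proof -
  define a where "a = (\<Sum>i<N. \<Sum>j<N. \<bar>A $$ (i, j)\<bar>)"
  have a0: "0 \<le> a"
    unfolding a_def by (intro sum_nonneg) auto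
  have a: "\<bar>A $$ (i, j)\<bar> \<le> a" if "i < N" "j < N" for i j
  proof -
    have "\<bar>A $$ (i, j)\<bar> \<le> (\<Sum>j<N. \<bar>A $$ (i, j)\<bar>)"
      using that by (intro member_le_sum) auto
    also have "\<dots> \<le> a"
      unfolding a_def using that by (intro member_le_sum[of i _ "\<lambda>i. \<Sum>j<N. \<bar>A $$ (i, j)\<bar>"]) (auto intro: sum_nonneg)
    finally show ?thesis .
  qed
  have "\<bar>(A ^\<^sub>m k) $$ (i, j)\<bar> \<le> (real N * a) ^ k" if "i < N" "j < N" for i j k
    using that
  proof (induction k arbitrary: i j)
    case 0
    then show ?case
      using A by simp
  next
    case (Suc k)
    have "(A ^\<^sub>m Suc k) $$ (i, j) = (\<Sum>r<N. (A ^\<^sub>m k) $$ (i, r) * A $$ (r, j))"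
      using A Suc.prems by (simp only: pow_mat.simps) (intro index_mult_mat_sum[of _ N N _ N], auto)
    also have "\<bar>\<dots>\<bar> \<le> (\<Sum>r<N. (real N * a) ^ k * a)"
      using Suc a a0 by (intro order.trans[OF sum_abs] sum_mono) (auto simp: abs_mult intro!: mult_mono)
    finally show ?case
      by (simp add: mult_ac)
  qed
  then show ?thesis
    using a0 by (intro that[of "real N * a"]) auto
qed

definition exp_coeff :: "real mat \<Rightarrow> nat \<Rightarrow> nat \<Rightarrow> nat \<Rightarrow> real" where
  "exp_coeff A i j k = (A ^\<^sub>m k) $$ (i, j) / fact k"

lemma summable_exp_coeff:
  assumes A: "A \<in> carrier_mat N N" and ij: "i < N" "j < N"
  shows "summable (\<lambda>k. exp_coeff A i j k * x ^ k)"
proof -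
  obtain L where L: "0 \<le> L" "\<And>i j k. i < N \<Longrightarrow> j < N \<Longrightarrow> \<bar>(A ^\<^sub>m k) $$ (i, j)\<bar> \<le> L ^ k"
    using pow_mat_bound[OF A] by blast
  show ?thesis
  proof (rule summable_comparison_test)
    have "norm (exp_coeff A i j k * x ^ k) \<le> (L * \<bar>x\<bar>) ^ k /\<^sub>R fact k" for k
    proof -
      have "\<bar>(A ^\<^sub>m k) $$ (i, j)\<bar> * \<bar>x\<bar> ^ k / fact k \<le> L ^ k * \<bar>x\<bar> ^ k / fact k"
        using L(2)[OF ij] by (intro divide_right_mono mult_right_mono) auto
      then show ?thesis
        by (simp add: exp_coeff_def abs_mult power_abs power_mult_distrib divide_inverse mult_ac)
    qed
    then show "\<exists>N. \<forall>k\<ge>N. norm (exp_coeff A i j k * x ^ k) \<le> (L * \<bar>x\<bar>) ^ k /\<^sub>R fact k"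
      by blast
    show "summable (\<lambda>k. (L * \<bar>x\<bar>) ^ k /\<^sub>R fact k)"
      by (rule summable_exp_generic)
  qed
qed

lemma mat_exp_carrier: "A \<in> carrier_mat N N \<Longrightarrow> mat_exp A \<in> carrier_mat N N"
  by (simp add: mat_exp_def)

lemma mat_exp_index:
  assumes A: "A \<in> carrier_mat N N" and ij: "i < N" "j < N"
  shows "mat_exp (x \<cdot>\<^sub>m A) $$ (i, j) = (\<Sum>k. exp_coeff A i j k * x ^ k)"
proof -
  have "((x \<cdot>\<^sub>m A) ^\<^sub>m k) $$ (i, j) = x ^ k * (A ^\<^sub>m k) $$ (i, j)" for k
    unfolding pow_smult_mat[OF A] using A ij by simp
  then show ?thesis
    using A ij by (simp add: mat_exp_def exp_coeff_def mult_ac)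
qed

lemma mat_exp_zero:
  assumes A: "A \<in> carrier_mat N N"
  shows "mat_exp (0 \<cdot>\<^sub>m A) = 1\<^sub>m N"
proof (rule eq_matI)
  fix i j assume "i < dim_row (1\<^sub>m N :: real mat)" "j < dim_col (1\<^sub>m N :: real mat)"
  then have ij: "i < N" "j < N"
    by auto
  show "mat_exp (0 \<cdot>\<^sub>m A) $$ (i, j) = 1\<^sub>m N $$ (i, j)"
    unfolding mat_exp_index[OF A ij] powser_zero using A ij by (simp add: exp_coeff_def)
qed (use A in \<open>auto simp: mat_exp_def\<close>)

text \<open>Each entry is an everywhere convergent power series in \<open>x\<close> and is
  differentiated termwise. The factor \<open>A\<close> is split off on the left, the side on which
  the moment equation has it.\<close>

lemma mat_exp_has_derivative:
  assumes A: "A \<in> carrier_mat N N" and ij: "i < N" "j < N"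
  shows "((\<lambda>x. mat_exp (x \<cdot>\<^sub>m A) $$ (i, j)) has_real_derivative
    (\<Sum>r<N. A $$ (i, r) * mat_exp (x \<cdot>\<^sub>m A) $$ (r, j))) (at x)"
proof -
  have "diffs (exp_coeff A i j) k = (\<Sum>r<N. A $$ (i, r) * exp_coeff A r j k)" for k
  proof -
    have "(A ^\<^sub>m Suc k) $$ (i, j) = (\<Sum>r<N. A $$ (i, r) * (A ^\<^sub>m k) $$ (r, j))"
      unfolding pow_mat_Suc_left[OF A] using A ij by (intro index_mult_mat_sum[of _ N N _ N]) auto
    moreover have "diffs (exp_coeff A i j) k = (A ^\<^sub>m Suc k) $$ (i, j) / fact k"
      by (simp add: diffs_def exp_coeff_def divide_simps del: pow_mat.simps)
    ultimately show ?thesis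
      by (simp add: sum_divide_distrib exp_coeff_def del: pow_mat.simps)
  qed
  then have "(\<Sum>k. diffs (exp_coeff A i j) k * x ^ k) = (\<Sum>k. \<Sum>r<N. A $$ (i, r) * (exp_coeff A r j k * x ^ k))"
    by (simp add: sum_distrib_right mult.assoc)
  also have "\<dots> = (\<Sum>r<N. \<Sum>k. A $$ (i, r) * (exp_coeff A r j k * x ^ k))"
    using ij by (intro suminf_sum summable_mult summable_exp_coeff[OF A]) auto
  also have "\<dots> = (\<Sum>r<N. A $$ (i, r) * mat_exp (x \<cdot>\<^sub>m A) $$ (r, j))"
    using ij summable_exp_coeff[OF A] by (intro sum.cong refl) (simp add: suminf_mult mat_exp_index[OF A])
  finally have "(\<Sum>k. diffs (exp_coeff A i j) k * x ^ k) = (\<Sum>r<N. A $$ (i, r) * mat_exp (x \<cdot>\<^sub>m A) $$ (r, j))" .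
  moreover have "((\<lambda>x. \<Sum>k. exp_coeff A i j k * x ^ k) has_real_derivative
      (\<Sum>k. diffs (exp_coeff A i j) k * x ^ k)) (at x)"
    by (rule termdiffs_strong_converges_everywhere) (rule summable_exp_coeff[OF A ij])
  ultimately show ?thesis
    by (simp add: mat_exp_index[OF A ij])
qed

lemma mat_exp_transpose:
  assumes A: "A \<in> carrier_mat N N"
  shows "mat_exp (x \<cdot>\<^sub>m A\<^sup>T) = (mat_exp (x \<cdot>\<^sub>m A))\<^sup>T"
proof (rule eq_matI)
  have pow: "(A\<^sup>T) ^\<^sub>m k = (A ^\<^sub>m k)\<^sup>T" for k
  proof (induction k)
    case 0
    show ?case
      using A by simp
  next
    case (Suc k)
    have "(A\<^sup>T) ^\<^sub>m Suc k = (A ^\<^sub>m k)\<^sup>T * A\<^sup>T"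
      by (simp add: Suc)
    also have "\<dots> = (A * A ^\<^sub>m k)\<^sup>T"
      using A by (intro transpose_mult[symmetric]) auto
    finally show ?case
      by (simp only: pow_mat_Suc_left[OF A])
  qed
  fix i j assume "i < dim_row (mat_exp (x \<cdot>\<^sub>m A))\<^sup>T" "j < dim_col (mat_exp (x \<cdot>\<^sub>m A))\<^sup>T"
  then have ij: "i < N" "j < N"
    using A by (auto simp: mat_exp_def)
  have AT: "A\<^sup>T \<in> carrier_mat N N"
    using A by simp
  have "exp_coeff A\<^sup>T i j k = exp_coeff A j i k" for k
    unfolding exp_coeff_def pow using A ij by simp
  then have "mat_exp (x \<cdot>\<^sub>m A\<^sup>T) $$ (i, j) = mat_exp (x \<cdot>\<^sub>m A) $$ (j, i)"
    using mat_exp_index[OF AT ij] mat_exp_index[OF A ij(2,1)] by simp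
  then show "mat_exp (x \<cdot>\<^sub>m A\<^sup>T) $$ (i, j) = (mat_exp (x \<cdot>\<^sub>m A))\<^sup>T $$ (i, j)"
    using A ij by (simp add: mat_exp_def)
qed (use A in \<open>auto simp: mat_exp_def\<close>)

lemma index_mult3:
  fixes D B E :: "real mat"
  assumes "D \<in> carrier_mat R N" "B \<in> carrier_mat N N" "E \<in> carrier_mat N R" "i < R" "j < R"
  shows "(D * B * E) $$ (i, j) = (\<Sum>c<N. \<Sum>a<N. D $$ (i, a) * B $$ (a, c) * E $$ (c, j))"
proof -
  have "(D * B * E) $$ (i, j) = (\<Sum>c<N. (D * B) $$ (i, c) * E $$ (c, j))"
    using assms by (intro index_mult_mat_sum[of _ R N _ R]) auto
  also have "\<dots> = (\<Sum>c<N. \<Sum>a<N. D $$ (i, a) * B $$ (a, c) * E $$ (c, j))"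
    unfolding sum_distrib_right[symmetric]
    using assms by (intro sum.cong refl arg_cong2[where f="(*)"] index_mult_mat_sum[of _ R N _ N]) auto
  finally show ?thesis .
qed

text \<open>Because of \<open>E * D = 1\<^sub>m N\<close>, adjacent factors cancel and the
  \<open>k\<close>-th power of \<open>D * G * E\<close> is \<open>D * G ^\<^sub>m k * E\<close> for
  \<open>k \<ge> 1\<close>. At \<open>k = 0\<close> the identity faces the projection
  \<open>D * E\<close>; this single term of the series is the whole discrepancy.\<close>

lemma mat_exp_conjugate:
  assumes D: "D \<in> carrier_mat R N" and G: "G \<in> carrier_mat N N" and E: "E \<in> carrier_mat N R"
    and ED: "E * D = 1\<^sub>m N"
  shows "mat_exp (x \<cdot>\<^sub>m (D * G * E)) = D * mat_exp (x \<cdot>\<^sub>m G) * E + (1\<^sub>m R - D * E)"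
proof (rule eq_matI)
  let ?C = "D * G * E"
  have C: "?C \<in> carrier_mat R R"
    using D G E by auto
  have pow: "?C ^\<^sub>m Suc k = D * G ^\<^sub>m Suc k * E" for k
  proof (induction k)
    case 0
    show ?case
      using D G E by simp
  next
    case (Suc k)
    let ?P = "G ^\<^sub>m Suc k"
    have P: "?P \<in> carrier_mat N N"
      by (rule pow_carrier_mat[OF G])
    have "?C ^\<^sub>m Suc (Suc k) = (D * ?P * E) * (D * G * E)"
      using Suc by (simp only: pow_mat.simps)
    also have "\<dots> = (D * ?P) * (E * (D * G * E))"
      using D P G E by (intro assoc_mult_mat[of _ R N _ R _ R]) auto
    also have "E * (D * G * E) = E * (D * (G * E))"
      using D G E by (simp add: assoc_mult_mat[of _ R N _ N _ R])
    also have "\<dots> = (E * D) * (G * E)"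
      using D G E by (intro assoc_mult_mat[symmetric, of _ N R _ N _ R]) auto
    also have "\<dots> = G * E"
      unfolding ED using G E by (intro left_mult_one_mat[of _ N R]) auto
    also have "(D * ?P) * (G * E) = (D * ?P * G) * E"
      using D P G E by (intro assoc_mult_mat[symmetric, of _ R N _ N _ R]) auto
    also have "D * ?P * G = D * (?P * G)"
      using D P G by (intro assoc_mult_mat[of _ R N _ N _ N]) auto
    finally show ?case
      by simp
  qed
  have DEc: "D * mat_exp (x \<cdot>\<^sub>m G) * E \<in> carrier_mat R R" "D * E \<in> carrier_mat R R"
    using D E G by (auto intro!: mult_carrier_mat mat_exp_carrier)
  fix i j assume "i < dim_row (D * mat_exp (x \<cdot>\<^sub>m G) * E + (1\<^sub>m R - D * E))"
    "j < dim_col (D * mat_exp (x \<cdot>\<^sub>m G) * E + (1\<^sub>m R - D * E))"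
  then have ij: "i < R" "j < R"
    using D E by auto
  let ?r = "1\<^sub>m R $$ (i, j) - (D * E) $$ (i, j)"
  let ?s = "\<lambda>k. \<Sum>c<N. \<Sum>a<N. D $$ (i, a) * exp_coeff G a c k * E $$ (c, j)"
  have coeff: "exp_coeff ?C i j k = ?s k + (if k = 0 then ?r else 0)" for k
  proof (cases k)
    case 0
    have "(D * 1\<^sub>m N * E) $$ (i, j) = (\<Sum>c<N. \<Sum>a<N. D $$ (i, a) * 1\<^sub>m N $$ (a, c) * E $$ (c, j))"
      by (rule index_mult3[OF D _ E ij]) simp
    then have "(D * E) $$ (i, j) = ?s 0"
      using D G by (simp add: exp_coeff_def)
    then show ?thesis
      using 0 C D by (simp add: exp_coeff_def)
  next
    case (Suc k')
    have "(?C ^\<^sub>m k) $$ (i, j) = (\<Sum>c<N. \<Sum>a<N. D $$ (i, a) * (G ^\<^sub>m k) $$ (a, c) * E $$ (c, j))"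
      unfolding Suc pow by (rule index_mult3[OF D pow_carrier_mat[OF G] E ij])
    then show ?thesis
      using Suc by (simp add: exp_coeff_def sum_divide_distrib del: pow_mat.simps)
  qed
  have s: "(\<lambda>k. ?s k * x ^ k) sums (D * mat_exp (x \<cdot>\<^sub>m G) * E) $$ (i, j)"
  proof -
    have "(\<lambda>k. \<Sum>c<N. \<Sum>a<N. D $$ (i, a) * (exp_coeff G a c k * x ^ k) * E $$ (c, j)) sums
        (\<Sum>c<N. \<Sum>a<N. D $$ (i, a) * mat_exp (x \<cdot>\<^sub>m G) $$ (a, c) * E $$ (c, j))"
    proof (intro sums_sum sums_mult sums_mult2)
      fix c a assume "c \<in> {..<N}" "a \<in> {..<N}"
      then show "(\<lambda>k. exp_coeff G a c k * x ^ k) sums mat_exp (x \<cdot>\<^sub>m G) $$ (a, c)"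
        using summable_sums[OF summable_exp_coeff[OF G]] mat_exp_index[OF G] by simp
    qed
    moreover have "?s k * x ^ k = (\<Sum>c<N. \<Sum>a<N. D $$ (i, a) * (exp_coeff G a c k * x ^ k) * E $$ (c, j))" for k
      unfolding sum_distrib_right by (intro sum.cong refl) (simp add: mult_ac)
    moreover have "(D * mat_exp (x \<cdot>\<^sub>m G) * E) $$ (i, j)
        = (\<Sum>c<N. \<Sum>a<N. D $$ (i, a) * mat_exp (x \<cdot>\<^sub>m G) $$ (a, c) * E $$ (c, j))"
      using G by (intro index_mult3[OF D _ E ij] mat_exp_carrier) simp
    ultimately show ?thesis
      by simp
  qed
  have "(\<lambda>k. (if k = 0 then ?r else 0) * x ^ k) sums ?r"
    using sums_single[of 0 "\<lambda>_. ?r"] by (rule sums_cong[THEN iffD1, rotated]) simp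
  from sums_add[OF s this]
  have "(\<lambda>k. exp_coeff ?C i j k * x ^ k) sums ((D * mat_exp (x \<cdot>\<^sub>m G) * E) $$ (i, j) + ?r)"
    by (simp add: coeff distrib_right)
  then show "mat_exp (x \<cdot>\<^sub>m ?C) $$ (i, j) = (D * mat_exp (x \<cdot>\<^sub>m G) * E + (1\<^sub>m R - D * E)) $$ (i, j)"
    unfolding mat_exp_index[OF C ij] using ij DEc D E by (simp add: sums_iff)
qed (use D G E in \<open>auto simp: mat_exp_def\<close>)

subsection \<open>L-eliminating and L-duplicating matrices\<close>

lemma dim_canon_col [simp]: "dim_row (canon_col k j) = k" "dim_col (canon_col k j) = 1"
  by (simp_all add: canon_col_def)

lemma canon_col_index: "i < k \<Longrightarrow> canon_col k j $$ (i, 0) = (if i + 1 = j then 1 else 0)"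
  by (simp add: canon_col_def)

lemma D_mat_carrier: "D_mat a c \<in> carrier_mat (a * c) (a + c - 1)"
  by (simp add: D_mat_def mat_sum_def)

lemma E_mat_carrier: "E_mat a c \<in> carrier_mat (a + c - 1) (a * c)"
  by (simp add: E_mat_def mat_sum_def)

text \<open>A position \<open>q\<close> encodes the pair of exponents \<open>q div a\<close> and
  \<open>q mod a\<close>, and its row marks their sum. The index \<open>i + j - 1\<close> of the
  definition is this sum after the shift from counting at 1 to counting at 0.\<close>

lemma D_mat_index:
  assumes q: "q < a * c" and e: "e < a + c - 1"
  shows "D_mat a c $$ (q, e) = (if q div a + q mod a = e then 1 else 0)"
proof -
  have q': "q < c * a"
    using q by (simp add: mult.commute)
  note qa = div_mod_less[OF q']
  have "D_mat a c $$ (q, e) = (\<Sum>(i, j)\<in>{1..a} \<times> {1..c}.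
      (if e + 1 = i + j - 1 then 1 else 0) * ((if q div a + 1 = j then 1 else 0) * (if q mod a + 1 = i then 1 else 0)))"
    unfolding D_mat_def mat_sum_def using q q' e qa
    by (auto simp: kron_index canon_col_index intro!: sum.cong)
  also have "\<dots> = (\<Sum>ij\<in>{1..a} \<times> {1..c}. if ij = (q mod a + 1, q div a + 1)
      then (if e + 1 = fst ij + snd ij - 1 then 1 else 0) else 0)"
    by (intro sum.cong) (auto split: if_splits)
  also have "\<dots> = (if q div a + q mod a = e then 1 else 0)"
    using qa by (subst sum.delta) auto
  finally show ?thesis .
qed

lemma div_mod_mult_add:
  fixes a b k :: nat
  assumes "b < a"
  shows "(k * a + b) div a = k" "(k * a + b) mod a = b"
  using assms by auto

text \<open>For each exponent \<open>e\<close> one representative pair is selected: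
  \<open>(0, e)\<close> as long as \<open>e < a\<close>, afterwards
  \<open>(e - (a - 1), a - 1)\<close>. The two descriptions coincide at \<open>e = a - 1\<close>,
  which is why the second sum of the definition starts at 2.\<close>

lemma E_mat_index:
  assumes q: "q < a * c" and e: "e < a + c - 1" and ac: "1 \<le> a" "1 \<le> c"
  shows "E_mat a c $$ (e, q) = (if q = (if e < a then e else (e - (a - 1)) * a + (a - 1)) then 1 else 0)"
proof -
  have q': "q < c * a"
    using q by (simp add: mult.commute)
  note qa = div_mod_less[OF q']
  have "E_mat a c $$ (e, q)
      = (\<Sum>i\<in>{1..a}. (if e + 1 = i then 1 else 0) * ((if q div a + 1 = 1 then 1 else 0) * (if q mod a + 1 = i then 1 else 0)))
      + (\<Sum>i\<in>{2..c}. (if e + 1 = a + i - 1 then 1 else 0) * ((if q div a + 1 = i then 1 else 0) * (if q mod a + 1 = a then 1 else 0)))"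
    unfolding E_mat_def mat_sum_def using q q' e qa
    by (auto simp: kron_index canon_col_index intro!: sum.cong arg_cong2[where f="(+)"])
  also have "(\<Sum>i\<in>{1..a}. (if e + 1 = i then 1 else 0) * ((if q div a + 1 = 1 then 1 else 0) * (if q mod a + 1 = i then 1 else 0)))
      = (\<Sum>i\<in>{1..a}. if i = e + 1 then (if q div a = 0 \<and> q mod a = e then 1 else 0) else 0 :: real)"
    by (intro sum.cong) auto
  also have "\<dots> = (if e < a \<and> q div a = 0 \<and> q mod a = e then 1 else 0)"
    by (subst sum.delta) auto
  also have "(\<Sum>i\<in>{2..c}. (if e + 1 = a + i - 1 then 1 else 0) * ((if q div a + 1 = i then 1 else 0) * (if q mod a + 1 = a then 1 else 0)))
      = (\<Sum>i\<in>{2..c}. if i = q div a + 1 then (if e = a - 1 + q div a \<and> q mod a = a - 1 then 1 else 0) else 0 :: real)"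
    using ac by (intro sum.cong) auto
  also have "\<dots> = (if 1 \<le> q div a \<and> e = a - 1 + q div a \<and> q mod a = a - 1 then 1 else 0)"
    using qa by (subst sum.delta) auto
  also have "(if e < a \<and> q div a = 0 \<and> q mod a = e then 1 else 0)
      + (if 1 \<le> q div a \<and> e = a - 1 + q div a \<and> q mod a = a - 1 then 1 else 0 :: real)
      = (if q = (if e < a then e else (e - (a - 1)) * a + (a - 1)) then 1 else 0)"
  proof (cases "e < a")
    case True
    have "q div a = 0 \<and> q mod a = e \<longleftrightarrow> q = e"
      using True by (metis div_less mod_less div_mult_mod_eq mult_0 add_0)
    moreover have "\<not> (1 \<le> q div a \<and> e = a - 1 + q div a \<and> q mod a = a - 1)"
      using True by linarith
    ultimately show ?thesis
      using True by auto
  next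
    case False
    have "(1 \<le> q div a \<and> e = a - 1 + q div a \<and> q mod a = a - 1) \<longleftrightarrow> q = (e - (a - 1)) * a + (a - 1)"
    proof
      assume *: "1 \<le> q div a \<and> e = a - 1 + q div a \<and> q mod a = a - 1"
      then have "e - (a - 1) = q div a"
        by linarith
      then show "q = (e - (a - 1)) * a + (a - 1)"
        using * div_mult_mod_eq[of q a] by simp
    next
      assume *: "q = (e - (a - 1)) * a + (a - 1)"
      have "q div a = e - (a - 1)" "q mod a = a - 1"
        unfolding * using ac by (intro div_mod_mult_add; simp)+
      then show "1 \<le> q div a \<and> e = a - 1 + q div a \<and> q mod a = a - 1"
        using False ac by auto
    qed
    then show ?thesis
      using False by auto
  qed
  finally show ?thesis .
qed

text \<open>The representative pair \<open>f\<close> selected for \<open>e\<close> has sum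
  \<open>e\<close>, so duplicating and then selecting returns every exponent to its place.\<close>

lemma E_mat_D_mat:
  assumes ac: "1 \<le> a" "1 \<le> c"
  shows "E_mat a c * D_mat a c = 1\<^sub>m (a + c - 1)"
proof (rule eq_matI)
  fix e e' assume "e < dim_row (1\<^sub>m (a + c - 1) :: real mat)" "e' < dim_col (1\<^sub>m (a + c - 1) :: real mat)"
  then have e: "e < a + c - 1" "e' < a + c - 1"
    by auto
  define f where "f = (if e < a then e else (e - (a - 1)) * a + (a - 1))"
  have f: "f < a * c" "f div a + f mod a = e"
  proof -
    show "f div a + f mod a = e"
    proof (cases "e < a")
      case False
      have "a - 1 < a"
        using ac by simp
      from div_mod_mult_add[OF this] show ?thesis
        using False by (simp only: f_def if_False)
    qed (simp add: f_def)
    show "f < a * c"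
    proof (cases "e < a")
      case True
      then show ?thesis
        using ac by (auto simp: f_def intro: less_le_trans)
    next
      case False
      then have "e - (a - 1) + 1 \<le> c"
        using e by linarith
      then have "(e - (a - 1) + 1) * a \<le> c * a"
        by (rule mult_le_mono1)
      then show ?thesis
        using False ac by (simp add: f_def algebra_simps)
    qed
  qed
  have "(E_mat a c * D_mat a c) $$ (e, e') = (\<Sum>q<a * c. E_mat a c $$ (e, q) * D_mat a c $$ (q, e'))"
    by (rule index_mult_mat_sum[OF E_mat_carrier D_mat_carrier e])
  also have "\<dots> = (\<Sum>q<a * c. if q = f then D_mat a c $$ (q, e') else 0)"
    using e(1) by (intro sum.cong) (auto simp: E_mat_index[OF _ _ ac] f_def)
  also have "\<dots> = (if e = e' then 1 else 0)"
    using f e by (simp add: D_mat_index)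
  finally show "(E_mat a c * D_mat a c) $$ (e, e') = 1\<^sub>m (a + c - 1) $$ (e, e')"
    using e by simp
qed (use E_mat_carrier[of a c] D_mat_carrier[of a c] in auto)

lemma D_mat_monomials: "D_mat (d + 1) (n + 1) * monomials (d + n) x = monomials n x \<otimes>\<^sub>K monomials d x"
proof (rule eq_matI)
  let ?H = "monomials (d + n) x"
  have H: "?H \<in> carrier_mat ((d + 1) + (n + 1) - 1) 1"
    by (simp add: monomials_def)
  fix q j assume "q < dim_row (monomials n x \<otimes>\<^sub>K monomials d x)" "j < dim_col (monomials n x \<otimes>\<^sub>K monomials d x)"
  then have q: "q < (n + 1) * (d + 1)" "q < (d + 1) * (n + 1)" "j = 0"
    by (auto simp: monomials_def mult.commute)
  note qa = div_mod_less[OF q(1)]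
  have sum_less: "q div (d + 1) + q mod (d + 1) < (d + 1) + (n + 1) - 1"
    using qa by linarith
  have "(D_mat (d + 1) (n + 1) * ?H) $$ (q, 0)
      = (\<Sum>e<(d + 1) + (n + 1) - 1. D_mat (d + 1) (n + 1) $$ (q, e) * ?H $$ (e, 0))"
    by (rule index_mult_mat_sum[OF D_mat_carrier H q(2)]) simp
  also have "\<dots> = (\<Sum>e<(d + 1) + (n + 1) - 1. if e = q div (d + 1) + q mod (d + 1) then x ^ e else 0)"
    using q by (intro sum.cong) (auto simp: D_mat_index monomials_def)
  also have "\<dots> = x ^ (q div (d + 1) + q mod (d + 1))"
    using sum_less by (subst sum.delta) auto
  also have "\<dots> = (monomials n x \<otimes>\<^sub>K monomials d x) $$ (q, 0)"
    using q qa by (subst kron_index) (auto simp: monomials_def power_add)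
  finally show "(D_mat (d + 1) (n + 1) * ?H) $$ (q, j) = (monomials n x \<otimes>\<^sub>K monomials d x) $$ (q, j)"
    using q(3) by simp
qed (use D_mat_carrier[of "d + 1" "n + 1"] in \<open>auto simp: monomials_def\<close>)

text \<open>With the identity as value at 0 the recursion already holds from there, so the
  inductions below need no separate case for the first matrix.\<close>

lemma L_dup_Suc:
  "L_dup n (Suc r) = (1\<^sub>m (n + 1) \<otimes>\<^sub>K L_dup n r) * D_mat (n * Suc r + 1) (n + 1)"
  "L_elim n (Suc r) = E_mat (n * Suc r + 1) (n + 1) * (1\<^sub>m (n + 1) \<otimes>\<^sub>K L_elim n r)"
  using D_mat_carrier[of "n + 1" "n + 1"] E_mat_carrier[of "n + 1" "n + 1"]
  by (cases r; simp add: kron_one)+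

lemma L_dup_carrier: "L_dup n r \<in> carrier_mat ((n + 1) ^ (r + 1)) (n * (r + 1) + 1)"
proof (induction r)
  case (Suc r)
  have "D_mat (n * Suc r + 1) (n + 1) \<in> carrier_mat ((n + 1) * (n * (r + 1) + 1)) (n * (Suc r + 1) + 1)"
    using D_mat_carrier[of "n * Suc r + 1" "n + 1"] by (simp add: mult.commute algebra_simps)
  from mult_carrier_mat[OF kron_carrier[OF one_carrier_mat Suc, of "n + 1"] this]
  show ?case
    unfolding L_dup_Suc by simp
qed simp

lemma L_elim_carrier: "L_elim n r \<in> carrier_mat (n * (r + 1) + 1) ((n + 1) ^ (r + 1))"
proof (induction r)
  case (Suc r)
  have "E_mat (n * Suc r + 1) (n + 1) \<in> carrier_mat (n * (Suc r + 1) + 1) ((n + 1) * (n * (r + 1) + 1))"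
    using E_mat_carrier[of "n * Suc r + 1" "n + 1"] by (simp add: mult.commute algebra_simps)
  from mult_carrier_mat[OF this kron_carrier[OF one_carrier_mat Suc, of "n + 1"]]
  show ?case
    unfolding L_dup_Suc by simp
qed simp

lemma L_elim_L_dup: "L_elim n r * L_dup n r = 1\<^sub>m (n * (r + 1) + 1)"
proof (induction r)
  case (Suc r)
  let ?N = "n + 1" and ?d = "n * (r + 1) + 1" and ?R = "(n + 1) ^ (r + 1)" and ?e = "n * (Suc r + 1) + 1"
  let ?E = "E_mat (n * Suc r + 1) (n + 1)" and ?D = "D_mat (n * Suc r + 1) (n + 1)"
  let ?KE = "1\<^sub>m ?N \<otimes>\<^sub>K L_elim n r" and ?KD = "1\<^sub>m ?N \<otimes>\<^sub>K L_dup n r"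
  have D: "?D \<in> carrier_mat (?N * ?d) ?e"
    using D_mat_carrier[of "n * Suc r + 1" "n + 1"] by (simp add: mult.commute algebra_simps)
  have E: "?E \<in> carrier_mat ?e (?N * ?d)"
    using E_mat_carrier[of "n * Suc r + 1" "n + 1"] by (simp add: mult.commute algebra_simps)
  have KE: "?KE \<in> carrier_mat (?N * ?d) (?N * ?R)" and KD: "?KD \<in> carrier_mat (?N * ?R) (?N * ?d)"
    by (intro kron_carrier one_carrier_mat L_elim_carrier L_dup_carrier)+
  have "L_elim n (Suc r) * L_dup n (Suc r) = ?E * (?KE * (?KD * ?D))"
    unfolding L_dup_Suc by (rule assoc_mult_mat[OF E KE mult_carrier_mat[OF KD D]])
  also have "?KE * (?KD * ?D) = (?KE * ?KD) * ?D"
    by (rule assoc_mult_mat[OF KE KD D, symmetric])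
  also have "?KE * ?KD = 1\<^sub>m (?N * ?d)"
    by (simp only: kron_mult[OF one_carrier_mat L_elim_carrier one_carrier_mat L_dup_carrier] Suc
        left_mult_one_mat[OF one_carrier_mat] kron_one)
  also have "1\<^sub>m (?N * ?d) * ?D = ?D"
    by (rule left_mult_one_mat[OF D])
  also have "?E * ?D = 1\<^sub>m ((n * Suc r + 1) + (n + 1) - 1)"
    by (rule E_mat_D_mat) auto
  finally show ?case
    by (simp add: algebra_simps)
qed simp

text \<open>\<open>D_mat\<close> splits the long vector of monomials into a Kronecker product of one
  short factor and the vector for the previous \<open>r\<close>, to which the induction hypothesis
  applies.\<close>

lemma L_dup_monomials: "L_dup n r * monomials (n * (r + 1)) x = kron_power (monomials n x) (Suc r)"
proof (induction r)
  case 0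
  show ?case
    using monomials_carrier[of n x] by (simp add: kron_one_right[simplified])
next
  case (Suc r)
  let ?N = "n + 1" and ?d = "n * (r + 1) + 1" and ?e = "n * (Suc r + 1) + 1"
  let ?KD = "1\<^sub>m ?N \<otimes>\<^sub>K L_dup n r" and ?D = "D_mat (n * Suc r + 1) (n + 1)"
  have D: "?D \<in> carrier_mat (?N * ?d) ?e"
    using D_mat_carrier[of "n * Suc r + 1" "n + 1"] by (simp add: mult.commute algebra_simps)
  have KD: "?KD \<in> carrier_mat (?N * (n + 1) ^ (r + 1)) (?N * ?d)"
    by (intro kron_carrier one_carrier_mat L_dup_carrier)
  have e: "n * (Suc r + 1) = n * Suc r + n"
    by simp
  have "L_dup n (Suc r) * monomials (n * (Suc r + 1)) x = ?KD * (?D * monomials (n * (Suc r + 1)) x)"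
    unfolding L_dup_Suc by (rule assoc_mult_mat[OF KD D monomials_carrier])
  also have "?D * monomials (n * (Suc r + 1)) x = monomials n x \<otimes>\<^sub>K monomials (n * (r + 1)) x"
    unfolding e using D_mat_monomials[of "n * Suc r" n x] by simp
  also have "?KD * \<dots> = (1\<^sub>m ?N * monomials n x) \<otimes>\<^sub>K (L_dup n r * monomials (n * (r + 1)) x)"
    by (rule kron_mult[OF one_carrier_mat L_dup_carrier monomials_carrier monomials_carrier])
  also have "\<dots> = kron_power (monomials n x) (Suc (Suc r))"
    unfolding Suc using left_mult_one_mat[OF monomials_carrier[of n x]] by simp
  finally show ?case .
qed

subsection \<open>Conditional expectations\<close>

lemma poly_eq_sum:
  fixes q :: "real poly"
  assumes "degree q \<le> n"
  shows "poly q x = (\<Sum>j<n + 1. coeff q j * x ^ j)"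
  unfolding poly_altdef using assms
  by (intro sum.mono_neutral_left) (auto simp: coeff_eq_0 not_le)

definition sum_poly :: "nat \<Rightarrow> (nat \<Rightarrow> real) \<Rightarrow> real poly" where
  "sum_poly n c = (\<Sum>j<n + 1. monom (c j) j)"

lemma coeff_sum_poly: "coeff (sum_poly n c) j = (if j < n + 1 then c j else 0)"
  by (simp add: sum_poly_def coeff_sum)

lemma degree_sum_poly: "degree (sum_poly n c) \<le> n"
  by (rule degree_le) (simp add: coeff_sum_poly)

lemma poly_sum_poly: "poly (sum_poly n c) x = (\<Sum>j<n + 1. c j * x ^ j)"
  by (simp add: poly_eq_sum[OF degree_sum_poly] coeff_sum_poly)

lemma set_integrable_setsum:
  fixes f :: "'i \<Rightarrow> 'a \<Rightarrow> real"
  assumes "\<And>i. i \<in> I \<Longrightarrow> set_integrable M A (f i)"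
  shows "set_integrable M A (\<lambda>x. \<Sum>i\<in>I. f i x)"
  using assms unfolding set_integrable_def scaleR_sum_right by (intro Bochner_Integration.integrable_sum)

text \<open>The product is at most a power of its largest factor. This replaces Hoelder's
  inequality: moments at single times suffice for products over several times.\<close>

lemma prod_abs_le_sum:
  fixes a :: "nat \<Rightarrow> real"
  shows "\<bar>\<Prod>k\<le>m. a k\<bar> \<le> (\<Sum>k\<le>m. \<bar>a k\<bar> ^ (m + 1))"
proof -
  have "Max ((\<lambda>k. \<bar>a k\<bar>) ` {..m}) \<in> (\<lambda>k. \<bar>a k\<bar>) ` {..m}"
    by (rule Max_in) auto
  then obtain k where "k \<in> {..m}" and k2: "Max ((\<lambda>k. \<bar>a k\<bar>) ` {..m}) = \<bar>a k\<bar>"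
    by (rule imageE)
  then have k: "k \<le> m"
    by simp
  have "\<bar>\<Prod>k\<le>m. a k\<bar> = (\<Prod>i\<le>m. \<bar>a i\<bar>)"
    by (rule abs_prod)
  also have "\<dots> \<le> (\<Prod>i\<le>m. \<bar>a k\<bar>)"
    unfolding k2[symmetric] by (intro prod_mono) auto
  also have "\<dots> = \<bar>a k\<bar> ^ (m + 1)"
    by simp
  also have "\<dots> \<le> (\<Sum>k\<le>m. \<bar>a k\<bar> ^ (m + 1))"
    using k by (intro member_le_sum[of k _ "\<lambda>k. \<bar>a k\<bar> ^ (m + 1)"]) auto
  finally show ?thesis .
qed

section \<open>Coefficient columns and ordered matrix products\<close>

lemma coeff_col_carrier: "coeff_col n q \<in> carrier_mat (n + 1) 1"
  by (simp add: coeff_col_def)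

lemma coeff_col_monomials:
  assumes "degree q \<le> n"
  shows "((coeff_col n q)\<^sup>T * monomials n x) $$ (0, 0) = poly q x"
proof -
  have "(coeff_col n q)\<^sup>T \<in> carrier_mat 1 (n + 1)"
    using coeff_col_carrier[of n q] by simp
  from index_mult_mat_sum[OF this monomials_carrier, of 0 0] show ?thesis
    unfolding poly_eq_sum[OF assms] by (simp add: coeff_col_def monomials_def del: sum.lessThan_Suc)
qed

lemma kron_index_scalar:
  "A \<in> carrier_mat 1 1 \<Longrightarrow> B \<in> carrier_mat 1 1 \<Longrightarrow> (A \<otimes>\<^sub>K B) $$ (0, 0) = A $$ (0, 0) * B $$ (0, 0)"
  by (subst kron_index) auto

lemma mat_prod_carrier:
  assumes "\<And>k. 1 \<le> k \<Longrightarrow> k \<le> m \<Longrightarrow> f k \<in> carrier_mat (d (k - 1)) (d k)"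
  shows "mat_prod (d 0) f m \<in> carrier_mat (d 0) (d m)"
  using assms
proof (induction m)
  case (Suc m)
  have "mat_prod (d 0) f m \<in> carrier_mat (d 0) (d m)"
    using Suc by simp
  from mult_carrier_mat[OF this] show ?case
    using Suc.prems[of "Suc m"] by simp
qed simp

lemma mat_prod_cong:
  assumes "\<And>k. 1 \<le> k \<Longrightarrow> k \<le> m \<Longrightarrow> f k = g k"
  shows "mat_prod d f m = mat_prod d g m"
  using assms by (induction m) auto

text \<open>\<open>mat_prod\<close> grows on the right, while the recursion for the correlator
  removes the first factor. The factors are rectangular, whence the sequence \<open>d\<close> of
  sizes.\<close>

lemma mat_prod_Suc_left:
  assumes "\<And>k. 1 \<le> k \<Longrightarrow> k \<le> Suc m \<Longrightarrow> f k \<in> carrier_mat (d (k - 1)) (d k)"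
  shows "mat_prod (d 0) f (Suc m) = f 1 * mat_prod (d 1) (\<lambda>k. f (Suc k)) m"
  using assms
proof (induction m)
  case 0
  have "f 1 \<in> carrier_mat (d 0) (d 1)"
    using 0[of 1] by simp
  then show ?case
    by simp
next
  case (Suc m)
  have 1: "f 1 \<in> carrier_mat (d 0) (d 1)"
    using Suc.prems[of 1] by simp
  have 2: "mat_prod (d 1) (\<lambda>k. f (Suc k)) m \<in> carrier_mat (d 1) (d (Suc m))"
  proof -
    have "f (Suc k) \<in> carrier_mat (d (Suc (k - 1))) (d (Suc k))" if "1 \<le> k" "k \<le> m" for k
      using Suc.prems[of "Suc k"] that by simp
    from mat_prod_carrier[where d="\<lambda>k. d (Suc k)", OF this] show ?thesis
      by simp
  qed
  have 3: "f (Suc (Suc m)) \<in> carrier_mat (d (Suc m)) (d (Suc (Suc m)))"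
    using Suc.prems[of "Suc (Suc m)"] by simp
  have "mat_prod (d 0) f (Suc (Suc m)) = (f 1 * mat_prod (d 1) (\<lambda>k. f (Suc k)) m) * f (Suc (Suc m))"
    using Suc by simp
  also have "\<dots> = f 1 * (mat_prod (d 1) (\<lambda>k. f (Suc k)) m * f (Suc (Suc m)))"
    by (rule assoc_mult_mat[OF 1 2 3])
  finally show ?case
    by simp
qed

text \<open>On the range of \<open>D\<close> the complementary projection vanishes:
  \<open>E * D = 1\<^sub>m N\<close> gives \<open>(1\<^sub>m R - D * E) * D = 0\<close>.\<close>

lemma mat_exp_conjugate_mult:
  assumes D: "D \<in> carrier_mat R N" and G: "G \<in> carrier_mat N N" and E: "E \<in> carrier_mat N R"
    and ED: "E * D = 1\<^sub>m N" and h: "h \<in> carrier_mat N c"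
  shows "mat_exp (x \<cdot>\<^sub>m (D * G * E)) * (D * h) = D * (mat_exp (x \<cdot>\<^sub>m G) * h)"
    and "D * mat_exp (x \<cdot>\<^sub>m G) * E * (D * h) = D * (mat_exp (x \<cdot>\<^sub>m G) * h)"
proof -
  have e: "mat_exp (x \<cdot>\<^sub>m G) \<in> carrier_mat N N"
    using G by (intro mat_exp_carrier) simp
  have De: "D * mat_exp (x \<cdot>\<^sub>m G) \<in> carrier_mat R N" and Dh: "D * h \<in> carrier_mat R c"
    using D e h by auto
  have EDh: "E * (D * h) = h"
    using assoc_mult_mat[OF E D h] ED left_mult_one_mat[OF h] by simp
  show 2: "D * mat_exp (x \<cdot>\<^sub>m G) * E * (D * h) = D * (mat_exp (x \<cdot>\<^sub>m G) * h)"
    unfolding assoc_mult_mat[OF De E Dh] EDh by (rule assoc_mult_mat[OF D e h])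
  have "(1\<^sub>m R - D * E) * (D * h) = 1\<^sub>m R * (D * h) - D * E * (D * h)"
    by (rule minus_mult_distrib_mat[OF one_carrier_mat mult_carrier_mat[OF D E] Dh])
  also have "\<dots> = D * h - D * h"
    unfolding assoc_mult_mat[OF D E Dh] EDh left_mult_one_mat[OF Dh] ..
  finally have 0: "(1\<^sub>m R - D * E) * (D * h) = 0\<^sub>m R c"
    using Dh by auto
  have "mat_exp (x \<cdot>\<^sub>m (D * G * E)) * (D * h)
      = D * mat_exp (x \<cdot>\<^sub>m G) * E * (D * h) + (1\<^sub>m R - D * E) * (D * h)"
    unfolding mat_exp_conjugate[OF D G E ED]
    by (rule add_mult_distrib_mat[OF mult_carrier_mat[OF De E] minus_carrier_mat[OF mult_carrier_mat[OF D E]] Dh])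
  also have "\<dots> = D * (mat_exp (x \<cdot>\<^sub>m G) * h)"
    unfolding 2 0 by (rule right_add_zero_mat[OF mult_carrier_mat[OF D mult_carrier_mat[OF e h]]])
  finally show "mat_exp (x \<cdot>\<^sub>m (D * G * E)) * (D * h) = D * (mat_exp (x \<cdot>\<^sub>m G) * h)" .
qed

context polynomial_jump_diffusion
begin

text \<open>The description by \<open>THE\<close> is legitimate: the coefficients of the images of
  the monomials provide a matrix, and a row is determined by the values of its polynomial at all
  reals.\<close>

lemma generator_matrix_eq:
  "generator_matrix b \<sigma> l n = mat (n + 1) (n + 1) (\<lambda>(i, j). coeff (gen_poly (monom 1 i)) j)"
  (is "_ = ?G")
proof -
  have G: "?G \<in> carrier_mat (n + 1) (n + 1)"
    by simp
  have gen: "generator b \<sigma> l (\<lambda>y. monomials n y $$ (i, 0)) x = (\<Sum>j<n + 1. ?G $$ (i, j) * x ^ j)"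
    if i: "i < n + 1" for i x
  proof -
    have "(\<lambda>y. monomials n y $$ (i, 0)) = poly (monom 1 i)"
      using i by (auto simp: monomials_def poly_monom)
    then have "generator b \<sigma> l (\<lambda>y. monomials n y $$ (i, 0)) x = poly (gen_poly (monom 1 i)) x"
      by (simp only: gen_poly(2))
    also have "\<dots> = (\<Sum>j<n + 1. coeff (gen_poly (monom 1 i)) j * x ^ j)"
      using i gen_poly(1)[of "monom 1 i"] by (intro poly_eq_sum) (simp add: degree_monom_eq)
    also have "\<dots> = (\<Sum>j<n + 1. ?G $$ (i, j) * x ^ j)"
      using i by (intro sum.cong) auto
    finally show ?thesis .
  qed
  have mult: "(A * monomials n x) $$ (i, 0) = (\<Sum>j<n + 1. A $$ (i, j) * x ^ j)"
    if "A \<in> carrier_mat (n + 1) (n + 1)" "i < n + 1" for A i x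
    using index_mult_mat_sum[OF that(1) monomials_carrier that(2), of 0 x]
    by (simp add: monomials_def del: sum.lessThan_Suc)
  show ?thesis
    unfolding generator_matrix_def
  proof (rule the_equality)
    show "?G \<in> carrier_mat (n + 1) (n + 1) \<and>
      (\<forall>x. mat (n + 1) 1 (\<lambda>ij. generator b \<sigma> l (\<lambda>y. monomials n y $$ ij) x) = ?G * monomials n x)"
    proof (intro conjI G allI eq_matI)
      fix x i j assume "i < dim_row (?G * monomials n x)" "j < dim_col (?G * monomials n x)"
      then have ij: "i < n + 1" "j = 0"
        by (auto simp: monomials_def)
      show "mat (n + 1) 1 (\<lambda>ij. generator b \<sigma> l (\<lambda>y. monomials n y $$ ij) x) $$ (i, j) = (?G * monomials n x) $$ (i, j)"
        unfolding ij(2) mult[OF G ij(1)] gen[OF ij(1), symmetric] using ij by (subst index_mat(1)) auto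
    qed (auto simp: monomials_def)
  next
    fix A assume A: "A \<in> carrier_mat (n + 1) (n + 1) \<and>
      (\<forall>x. mat (n + 1) 1 (\<lambda>ij. generator b \<sigma> l (\<lambda>y. monomials n y $$ ij) x) = A * monomials n x)"
    show "A = ?G"
    proof (rule eq_matI)
      fix i j assume "i < dim_row ?G" "j < dim_col ?G"
      then have ij: "i < n + 1" "j < n + 1"
        by auto
      have "(\<Sum>j<n + 1. A $$ (i, j) * x ^ j) = (\<Sum>j<n + 1. ?G $$ (i, j) * x ^ j)" for x
      proof -
        have "generator b \<sigma> l (\<lambda>y. monomials n y $$ (i, 0)) x
            = mat (n + 1) 1 (\<lambda>ij. generator b \<sigma> l (\<lambda>y. monomials n y $$ ij) x) $$ (i, 0)"
          using ij by (subst index_mat(1)) auto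
        also have "\<dots> = (A * monomials n x) $$ (i, 0)"
          using A by simp
        finally show ?thesis
          unfolding gen[OF ij(1)] mult[OF conjunct1[OF A] ij(1)] by (rule sym)
      qed
      then have "sum_poly n (\<lambda>j. A $$ (i, j)) = sum_poly n (\<lambda>j. ?G $$ (i, j))"
        unfolding poly_eq_poly_eq_iff[symmetric] fun_eq_iff poly_sum_poly by blast
      then have "coeff (sum_poly n (\<lambda>j. A $$ (i, j))) j = coeff (sum_poly n (\<lambda>j. ?G $$ (i, j))) j"
        by simp
      then show "A $$ (i, j) = ?G $$ (i, j)"
        unfolding coeff_sum_poly using ij by simp
    qed (use A in auto)
  qed
qed

lemma generator_matrix_carrier: "generator_matrix b \<sigma> l n \<in> carrier_mat (n + 1) (n + 1)"
  by (simp add: generator_matrix_eq)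

section \<open>Conditional moments by the matrix exponential\<close>

lemma mean_poly_sum:
  assumes q: "degree q \<le> n" and u: "0 \<le> u" and A: "A \<in> sets M"
  shows "mean y A (poly q) u = (\<Sum>j<n + 1. coeff q j * mean y A (poly (monom 1 j)) u)"
proof -
  have "mean y A (poly q) u = (\<integral>\<omega>. (\<Sum>j<n + 1. coeff q j * (indicator A \<omega> * poly (monom 1 j) (Y u \<omega>))) \<partial>P y)"
    unfolding mean_def poly_eq_sum[OF q] sum_distrib_left
    by (intro Bochner_Integration.integral_cong sum.cong refl) (simp add: poly_monom)
  also have "\<dots> = (\<Sum>j<n + 1. \<integral>\<omega>. coeff q j * (indicator A \<omega> * poly (monom 1 j) (Y u \<omega>)) \<partial>P y)"
    by (intro Bochner_Integration.integral_sum integrable_mult_right integrable_indicator_poly u A)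
  finally show ?thesis
    by (simp only: mean_def integral_mult_right_zero)
qed

text \<open>The moments \<open>\<mu>\<close> and the candidate \<open>v\<close> solve the same
  linear integral equation with the same value at \<open>s\<close>. Their difference
  \<open>d\<close> solves the homogeneous one, and Gronwall's inequality with \<open>a = 0\<close>
  forces the sum \<open>w\<close> of its absolute values to vanish at \<open>t\<close>.\<close>

lemma mean_monom_exp:
  assumes s: "0 \<le> s" "s \<le> t" and A: "A \<in> sets (F s)" and i: "i < n + 1"
  shows "mean y A (poly (monom 1 i)) t
    = (\<Sum>j<n + 1. mat_exp ((t - s) \<cdot>\<^sub>m generator_matrix b \<sigma> l n) $$ (i, j) * mean y A (poly (monom 1 j)) s)"
proof -
  let ?N = "n + 1" and ?G = "generator_matrix b \<sigma> l n"
  have Am: "A \<in> sets M"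
    by (rule sets_F_P[OF A])
  have G: "?G \<in> carrier_mat ?N ?N"
    by (rule generator_matrix_carrier)
  define \<mu> where "\<mu> i u = mean y A (poly (monom 1 i)) u" for i u
  define v where "v i u = (\<Sum>j<?N. mat_exp ((u - s) \<cdot>\<^sub>m ?G) $$ (i, j) * \<mu> j s)" for i u
  define d where "d i u = \<mu> i u - v i u" for i u
  have int_\<mu>: "set_integrable lborel {s..u} (\<mu> i)" for i u
    unfolding \<mu>_def[abs_def] using set_integrable_mean_poly[OF Am s(1)] by simp
  have \<mu>: "\<mu> i u = \<mu> i s + (LBINT r:{s..u}. \<Sum>j<?N. ?G $$ (i, j) * \<mu> j r)" if "i < ?N" "s \<le> u" for i u
  proof -
    have "mean y A (poly (gen_poly (monom 1 i))) r = (\<Sum>j<?N. ?G $$ (i, j) * \<mu> j r)" if "0 \<le> r" for r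
    proof -
      have "degree (gen_poly (monom 1 i)) \<le> n"
        using \<open>i < ?N\<close> gen_poly(1)[of "monom 1 i"] by (simp add: degree_monom_eq)
      from mean_poly_sum[OF this that Am] show ?thesis
        using \<open>i < ?N\<close> by (simp only: \<mu>_def generator_matrix_eq) (simp del: sum.lessThan_Suc)
    qed
    then have "(LBINT r:{s..u}. mean y A (poly (gen_poly (monom 1 i))) r)
        = (LBINT r:{s..u}. \<Sum>j<?N. ?G $$ (i, j) * \<mu> j r)"
      using s by (intro set_lebesgue_integral_cong) auto
    then show ?thesis
      using mean_poly_eq[OF s(1) that(2) A, of y "monom 1 i"] by (simp add: \<mu>_def)
  qed
  have dv: "(v i has_real_derivative (\<Sum>r<?N. ?G $$ (i, r) * v r u)) (at u)" if "i < ?N" for i u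
  proof -
    have "((\<lambda>u. mat_exp ((u - s) \<cdot>\<^sub>m ?G) $$ (i, j)) has_real_derivative
        (\<Sum>r<?N. ?G $$ (i, r) * mat_exp ((u - s) \<cdot>\<^sub>m ?G) $$ (r, j)) * 1) (at u)" if "j < ?N" for j
      by (rule DERIV_chain'[where g="\<lambda>u. mat_exp (u \<cdot>\<^sub>m ?G) $$ (i, j)",
            OF _ mat_exp_has_derivative[OF G \<open>i < ?N\<close> that]])
         (auto intro!: derivative_eq_intros)
    then have "((\<lambda>u. \<Sum>j<?N. mat_exp ((u - s) \<cdot>\<^sub>m ?G) $$ (i, j) * \<mu> j s) has_real_derivative
        (\<Sum>j<?N. (\<Sum>r<?N. ?G $$ (i, r) * mat_exp ((u - s) \<cdot>\<^sub>m ?G) $$ (r, j)) * 1 * \<mu> j s)) (at u)"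
      by (intro DERIV_sum DERIV_cmult_right) auto
    also have "(\<Sum>j<?N. (\<Sum>r<?N. ?G $$ (i, r) * mat_exp ((u - s) \<cdot>\<^sub>m ?G) $$ (r, j)) * 1 * \<mu> j s)
        = (\<Sum>j<?N. \<Sum>r<?N. ?G $$ (i, r) * (mat_exp ((u - s) \<cdot>\<^sub>m ?G) $$ (r, j) * \<mu> j s))"
      by (simp only: mult_1_right sum_distrib_right mult.assoc)
    also have "\<dots> = (\<Sum>r<?N. ?G $$ (i, r) * v r u)"
      unfolding v_def sum_distrib_left by (rule sum.swap)
    finally show ?thesis
      unfolding v_def[abs_def] .
  qed
  have cont_v: "continuous_on X (v i)" if "i < ?N" for i X
    by (rule DERIV_continuous_on) (rule has_field_derivative_at_within[OF dv[OF that]])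
  have int_v: "set_integrable lborel {s..u} (v i)" if "i < ?N" for i u
    by (rule borel_integrable_atLeastAtMost'[OF cont_v[OF that]])
  have v: "v i u = \<mu> i s + (LBINT r:{s..u}. \<Sum>j<?N. ?G $$ (i, j) * v j r)" if "i < ?N" "s \<le> u" for i u
  proof -
    have "isCont (\<lambda>r. \<Sum>j<?N. ?G $$ (i, j) * v j r) x" for x
      using cont_v[of _ UNIV] by (intro continuous_intros) (auto simp: continuous_on_eq_continuous_at)
    then have "(\<integral>r. (\<Sum>j<?N. ?G $$ (i, j) * v j r) * indicator {s..u} r \<partial>lborel) = v i u - v i s"
      using dv[OF that(1)] that(2) by (intro integral_FTC_Icc_real) auto
    then have "(LBINT r:{s..u}. \<Sum>j<?N. ?G $$ (i, j) * v j r) = v i u - v i s"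
      unfolding set_lebesgue_integral_def real_scaleR_def by (subst mult.commute)
    moreover have "v i s = \<mu> i s"
    proof -
      have "v i s = (\<Sum>j<?N. if j = i then \<mu> j s else 0)"
        unfolding v_def diff_self mat_exp_zero[OF G] using that by (intro sum.cong) auto
      then show ?thesis
        using that(1) by (simp add: sum.delta del: sum.lessThan_Suc)
    qed
    ultimately show ?thesis
      by simp
  qed
  have int_d: "set_integrable lborel {s..u} (d i)" if "i < ?N" for i u
    unfolding d_def[abs_def] by (intro set_integral_diff int_\<mu> int_v that)
  have d: "d i u = (LBINT r:{s..u}. \<Sum>j<?N. ?G $$ (i, j) * d j r)" if "i < ?N" "s \<le> u" for i u
  proof -
    have 1: "set_integrable lborel {s..u} (\<lambda>r. \<Sum>j<?N. ?G $$ (i, j) * \<mu> j r)"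
      "set_integrable lborel {s..u} (\<lambda>r. \<Sum>j<?N. ?G $$ (i, j) * v j r)"
      using int_\<mu> int_v by (intro set_integrable_setsum set_integrable_mult_right; simp)+
    have "(LBINT r:{s..u}. \<Sum>j<?N. ?G $$ (i, j) * d j r)
        = (LBINT r:{s..u}. (\<Sum>j<?N. ?G $$ (i, j) * \<mu> j r) - (\<Sum>j<?N. ?G $$ (i, j) * v j r))"
      by (simp only: d_def right_diff_distrib sum_subtractf)
    also have "\<dots> = (LBINT r:{s..u}. \<Sum>j<?N. ?G $$ (i, j) * \<mu> j r) - (LBINT r:{s..u}. \<Sum>j<?N. ?G $$ (i, j) * v j r)"
      by (rule set_integral_diff(2)[OF 1])
    finally show ?thesis
      using \<mu>[OF that] v[OF that] by (simp add: d_def)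
  qed
  define w where "w u = (\<Sum>i<?N. \<bar>d i u\<bar>)" for u
  \<comment> \<open>The 1 keeps \<open>C\<close> positive, as Gronwall's inequality asks, even if
    all entries vanish. The double sum exceeds every constant obtained by adding up the row
    estimates.\<close>
  define C where "C = 1 + (\<Sum>i<?N. \<Sum>r<?N. \<bar>?G $$ (i, r)\<bar>)"
  have C: "0 < C"
    unfolding C_def by (intro add_pos_nonneg sum_nonneg) auto
  have int_w: "set_integrable lborel {s..u} w" for u
    unfolding w_def[abs_def] using int_d by (intro set_integrable_setsum set_integrable_abs) auto
  have w_le: "\<bar>d i u\<bar> \<le> w u" if "i < ?N" for i u
    unfolding w_def using that by (intro member_le_sum[of i _ "\<lambda>i. \<bar>d i u\<bar>"]) auto
  have w: "w u \<le> 0 + C * (LBINT r:{s..u}. w r)" if "s \<le> u" for u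
  proof -
    have "\<bar>d i u\<bar> \<le> (\<Sum>r<?N. \<bar>?G $$ (i, r)\<bar>) * (LBINT r:{s..u}. w r)" if i: "i < ?N" for i
    proof -
      have int_r: "set_integrable lborel {s..u} (\<lambda>r. \<Sum>j<?N. ?G $$ (i, j) * d j r)"
        using int_d by (intro set_integrable_setsum set_integrable_mult_right) auto
      have "\<bar>d i u\<bar> \<le> (LBINT r:{s..u}. \<bar>\<Sum>j<?N. ?G $$ (i, j) * d j r\<bar>)"
        unfolding d[OF i \<open>s \<le> u\<close>] using set_integral_norm_bound[OF int_r] by simp
      also have "\<dots> \<le> (LBINT r:{s..u}. (\<Sum>r<?N. \<bar>?G $$ (i, r)\<bar>) * w r)"
      proof (rule set_integral_mono)
        show "set_integrable lborel {s..u} (\<lambda>r. \<bar>\<Sum>j<?N. ?G $$ (i, j) * d j r\<bar>)"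
          by (rule set_integrable_abs[OF int_r])
        show "set_integrable lborel {s..u} (\<lambda>r. (\<Sum>r<?N. \<bar>?G $$ (i, r)\<bar>) * w r)"
          by (intro set_integrable_mult_right int_w)
        fix r
        have "\<bar>\<Sum>j<?N. ?G $$ (i, j) * d j r\<bar> \<le> (\<Sum>j<?N. \<bar>?G $$ (i, j)\<bar> * w r)"
          by (rule order.trans[OF sum_abs], rule sum_mono) (auto simp: abs_mult intro!: mult_left_mono w_le)
        then show "\<bar>\<Sum>j<?N. ?G $$ (i, j) * d j r\<bar> \<le> (\<Sum>r<?N. \<bar>?G $$ (i, r)\<bar>) * w r"
          by (simp only: sum_distrib_right)
      qed
      finally show ?thesis
        by simp
    qed
    then have "w u \<le> (\<Sum>i<?N. (\<Sum>r<?N. \<bar>?G $$ (i, r)\<bar>) * (LBINT r:{s..u}. w r))"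
      unfolding w_def[of u] by (intro sum_mono) simp
    also have "\<dots> \<le> C * (LBINT r:{s..u}. w r)"
    proof -
      have "0 \<le> (LBINT r:{s..u}. w r)"
        unfolding w_def[abs_def] set_lebesgue_integral_def by (intro integral_nonneg_AE AE_I2) (auto intro!: sum_nonneg mult_nonneg_nonneg)
      then show ?thesis
        unfolding sum_distrib_right[symmetric] C_def distrib_right by simp
    qed
    finally show ?thesis
      by simp
  qed
  \<comment> \<open>The a priori bound for Gronwall: the moments are bounded on the interval by
    \<open>mean_poly_bound\<close>, the exponential part by continuity and compactness.\<close>
  have "\<exists>B. \<forall>u\<in>{s..t}. \<bar>d i u\<bar> \<le> B" if i: "i < ?N" for i
  proof -
    obtain B1 where B1: "\<And>u. 0 \<le> u \<Longrightarrow> u \<le> t \<Longrightarrow> \<bar>\<mu> i u\<bar> \<le> B1"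
      unfolding \<mu>_def by (rule mean_poly_bound[OF Am, where T=t and y=y and q="monom 1 i"]) blast
    have "bounded (v i ` {s..t})"
      by (intro compact_imp_bounded compact_continuous_image cont_v i) simp
    then obtain B2 where B2: "\<And>x. x \<in> v i ` {s..t} \<Longrightarrow> norm x \<le> B2"
      unfolding bounded_iff by blast
    have "\<bar>d i u\<bar> \<le> B1 + B2" if "u \<in> {s..t}" for u
      using B1[of u] B2[OF imageI[OF that]] that s unfolding d_def by auto
    then show ?thesis
      by blast
  qed
  then obtain B where B: "\<And>i u. i < ?N \<Longrightarrow> u \<in> {s..t} \<Longrightarrow> \<bar>d i u\<bar> \<le> B i"
    by metis
  have "w t \<le> 2 * 0 * exp (2 * C * (t - s))"
  proof (rule gronwall[where B="\<Sum>i<?N. B i", OF _ int_w w C order.refl s(2)])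
    fix u assume "s \<le> u" "u \<le> t"
    then have "w u \<le> (\<Sum>i<?N. B i)"
      unfolding w_def by (intro sum_mono B) auto
    moreover have "0 \<le> w u"
      unfolding w_def by (intro sum_nonneg) auto
    ultimately show "\<bar>w u\<bar> \<le> (\<Sum>i<?N. B i)"
      by simp
  qed
  with w_le[OF i, of t] have "d i t = 0"
    by simp
  then show ?thesis
    by (simp add: d_def v_def \<mu>_def del: sum.lessThan_Suc)
qed

text \<open>The two sides are polynomials of the process at \<open>t\<close> and at
  \<open>s\<close>, the latter measurable for \<open>F s\<close>. Agreement of their integrals over
  all events of \<open>F s\<close>, which is the moment formula, characterizes the conditional
  expectation.\<close>

lemma real_cond_exp_poly:
  assumes a: "a \<in> carrier_mat 1 (n + 1)" and s: "0 \<le> s" "s \<le> t"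
  shows "AE \<omega> in P y. real_cond_exp (P y) (F s) (\<lambda>\<omega>. (a * monomials n (Y t \<omega>)) $$ (0, 0)) \<omega>
    = (a * (mat_exp ((t - s) \<cdot>\<^sub>m generator_matrix b \<sigma> l n) * monomials n (Y s \<omega>))) $$ (0, 0)"
proof -
  interpret sigma_finite_subalgebra "P y" "F s" by (rule sigma_finite_subalgebra_P)
  let ?N = "n + 1" and ?e = "mat_exp ((t - s) \<cdot>\<^sub>m generator_matrix b \<sigma> l n)"
  have e: "?e \<in> carrier_mat ?N ?N"
    using generator_matrix_carrier[of n] by (intro mat_exp_carrier) simp
  have t: "0 \<le> t"
    using s by simp
  have row: "(c * monomials n x) $$ (0, 0) = poly (sum_poly n (\<lambda>j. c $$ (0, j))) x"
    if "c \<in> carrier_mat 1 ?N" for c x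
    using index_mult_mat_sum[OF that monomials_carrier, of 0 0 x]
    by (simp add: poly_sum_poly monomials_def del: sum.lessThan_Suc)
  define q where "q = sum_poly n (\<lambda>j. a $$ (0, j))"
  define r where "r = sum_poly n (\<lambda>j. (a * ?e) $$ (0, j))"
  have "AE \<omega> in P y. real_cond_exp (P y) (F s) (\<lambda>\<omega>. poly q (Y t \<omega>)) \<omega> = poly r (Y s \<omega>)"
  proof (rule real_cond_exp_charact[where f="\<lambda>\<omega>. poly q (Y t \<omega>)" and g="\<lambda>\<omega>. poly r (Y s \<omega>)"])
    fix A assume A: "A \<in> sets (F s)"
    then have Am: "A \<in> sets M"
      by (rule sets_F_P)
    have "mean y A (poly q) t = (\<Sum>i<?N. a $$ (0, i) * mean y A (poly (monom 1 i)) t)"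
      unfolding q_def mean_poly_sum[OF degree_sum_poly t Am]
      by (intro sum.cong refl) (simp add: coeff_sum_poly)
    also have "\<dots> = (\<Sum>i<?N. \<Sum>j<?N. a $$ (0, i) * ?e $$ (i, j) * mean y A (poly (monom 1 j)) s)"
      by (intro sum.cong refl) (simp add: mean_monom_exp[OF s A] sum_distrib_left mult.assoc del: sum.lessThan_Suc)
    also have "\<dots> = (\<Sum>j<?N. \<Sum>i<?N. a $$ (0, i) * ?e $$ (i, j) * mean y A (poly (monom 1 j)) s)"
      by (rule sum.swap)
    also have "\<dots> = (\<Sum>j<?N. (a * ?e) $$ (0, j) * mean y A (poly (monom 1 j)) s)"
      using index_mult_mat_sum[OF a e, of 0]
      by (intro sum.cong refl) (simp add: sum_distrib_right del: sum.lessThan_Suc)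
    also have "\<dots> = mean y A (poly r) s"
      unfolding r_def mean_poly_sum[OF degree_sum_poly s(1) Am]
      by (intro sum.cong refl) (simp add: coeff_sum_poly)
    finally show "(\<integral>\<omega>\<in>A. poly q (Y t \<omega>) \<partial>P y) = (\<integral>\<omega>\<in>A. poly r (Y s \<omega>) \<partial>P y)"
      by (simp add: mean_def set_lebesgue_integral_def)
  next
    show "integrable (P y) (\<lambda>\<omega>. poly q (Y t \<omega>))" "integrable (P y) (\<lambda>\<omega>. poly r (Y s \<omega>))"
      by (intro integrable_poly t s)+
    show "(\<lambda>\<omega>. poly r (Y s \<omega>)) \<in> borel_measurable (F s)"
      by (rule measurable_compose[OF Y_measurable_F[OF s(1)] poly_measurable])
  qed
  moreover have "a * (?e * monomials n x) = a * ?e * monomials n x" for x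
    by (rule assoc_mult_mat[OF a e monomials_carrier, symmetric])
  ultimately show ?thesis
    using row[OF a] row[OF mult_carrier_mat[OF a e]] by (simp add: q_def r_def)
qed

text \<open>At \<open>r = 0\<close> both outer factors are identities, so the formula also covers
  \<open>generator_matrix b \<sigma> l n\<close>.\<close>

definition dup_generator :: "nat \<Rightarrow> nat \<Rightarrow> real mat" where
  "dup_generator n r = L_dup n r * generator_matrix b \<sigma> l (n * (r + 1)) * L_elim n r"

section \<open>Kronecker powers of the monomials under conditioning\<close>

lemma dup_generator_carrier: "dup_generator n r \<in> carrier_mat ((n + 1) ^ (r + 1)) ((n + 1) ^ (r + 1))"
  unfolding dup_generator_def
  by (rule mult_carrier_mat[OF mult_carrier_mat[OF L_dup_carrier generator_matrix_carrier] L_elim_carrier])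

lemma mat_exp_dup_generator_carrier:
  "mat_exp (x \<cdot>\<^sub>m dup_generator n r) \<in> carrier_mat ((n + 1) ^ (r + 1)) ((n + 1) ^ (r + 1))"
  using dup_generator_carrier by (intro mat_exp_carrier) simp

lemma kron_monomials_carrier: "kron_power (monomials n x) r \<in> carrier_mat ((n + 1) ^ r) 1"
  using kron_power_carrier[OF monomials_carrier, of n x r] by simp

lemma mat_exp_dup_generator:
  "mat_exp (\<tau> \<cdot>\<^sub>m dup_generator n r) = L_dup n r * mat_exp (\<tau> \<cdot>\<^sub>m generator_matrix b \<sigma> l (n * (r + 1))) * L_elim n r
    + (1\<^sub>m ((n + 1) ^ (r + 1)) - L_dup n r * L_elim n r)"
  unfolding dup_generator_def
  by (rule mat_exp_conjugate[OF L_dup_carrier generator_matrix_carrier L_elim_carrier L_elim_L_dup])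

lemma mat_exp_dup_generator_kron:
  "mat_exp (\<tau> \<cdot>\<^sub>m dup_generator n r) * kron_power (monomials n x) (Suc r)
    = L_dup n r * (mat_exp (\<tau> \<cdot>\<^sub>m generator_matrix b \<sigma> l (n * (r + 1))) * monomials (n * (r + 1)) x)"
  "L_dup n r * mat_exp (\<tau> \<cdot>\<^sub>m generator_matrix b \<sigma> l (n * (r + 1))) * L_elim n r * kron_power (monomials n x) (Suc r)
    = L_dup n r * (mat_exp (\<tau> \<cdot>\<^sub>m generator_matrix b \<sigma> l (n * (r + 1))) * monomials (n * (r + 1)) x)"
  unfolding dup_generator_def L_dup_monomials[symmetric]
  by (rule mat_exp_conjugate_mult[OF L_dup_carrier generator_matrix_carrier L_elim_carrier L_elim_L_dup
        monomials_carrier])+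

text \<open>Through \<open>L_dup\<close> a linear functional of the Kronecker power is a polynomial
  of degree at most \<open>n * (r + 1)\<close> in the process, so the formula for a single
  polynomial applies.\<close>

lemma real_cond_exp_kron:
  assumes c: "c \<in> carrier_mat ((n + 1) ^ (r + 1)) 1" and s: "0 \<le> s" "s \<le> t"
  shows "AE \<omega> in P y. real_cond_exp (P y) (F s) (\<lambda>\<omega>. (c\<^sup>T * kron_power (monomials n (Y t \<omega>)) (Suc r)) $$ (0, 0)) \<omega>
    = (c\<^sup>T * (mat_exp ((t - s) \<cdot>\<^sub>m dup_generator n r) * kron_power (monomials n (Y s \<omega>)) (Suc r))) $$ (0, 0)"
proof -
  have cT: "c\<^sup>T \<in> carrier_mat 1 ((n + 1) ^ (r + 1))"
    using c by simp
  have "mat_exp ((t - s) \<cdot>\<^sub>m generator_matrix b \<sigma> l (n * (r + 1))) \<in> carrier_mat (n * (r + 1) + 1) (n * (r + 1) + 1)"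
    using generator_matrix_carrier by (intro mat_exp_carrier) simp
  from mult_carrier_mat[OF this monomials_carrier]
  have eh: "mat_exp ((t - s) \<cdot>\<^sub>m generator_matrix b \<sigma> l (n * (r + 1))) * monomials (n * (r + 1)) x
      \<in> carrier_mat (n * (r + 1) + 1) 1" for x .
  show ?thesis
    unfolding mat_exp_dup_generator_kron(1) unfolding L_dup_monomials[symmetric]
      assoc_mult_mat[OF cT L_dup_carrier eh, symmetric]
      assoc_mult_mat[OF cT L_dup_carrier monomials_carrier, symmetric]
    by (rule real_cond_exp_poly[OF mult_carrier_mat[OF cT L_dup_carrier] s])
qed

section \<open>Recursion for the correlator\<close>

lemma correlator_integrand_Suc:
  "correlator_integrand Y (Suc m) p s \<omega>
    = poly (p (Suc m)) (Y (s 0) \<omega>) * correlator_integrand Y m p (\<lambda>k. s (Suc k)) \<omega>"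
  unfolding correlator_integrand_def by (subst prod.atMost_Suc_shift) simp

lemma correlator_integrand_integrable:
  assumes "\<And>k. k \<le> m \<Longrightarrow> 0 \<le> s k"
  shows "integrable (P y) (correlator_integrand Y m p s)"
proof (rule Bochner_Integration.integrable_bound)
  \<comment> \<open>The absolute value \<open>\<bar>v\<bar>\<close> is replaced by
    \<open>1 + v * v\<close> to stay within polynomials; the exponent \<open>m + 1\<close> is the
    number of factors in the product.\<close>
  let ?q = "\<lambda>k. ([:1:] + p (m - k) * p (m - k)) ^ (m + 1)"
  show "integrable (P y) (\<lambda>\<omega>. \<Sum>k\<le>m. poly (?q k) (Y (s k) \<omega>))"
    using assms by (intro Bochner_Integration.integrable_sum integrable_poly) auto
  have "(\<lambda>\<omega>. poly (p (m - k)) (Y (s k) \<omega>)) \<in> borel_measurable (P y)" if "k \<le> m" for k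
    by (rule measurable_compose[OF Y_measurable_P[OF assms[OF that]] poly_measurable])
  then show "correlator_integrand Y m p s \<in> borel_measurable (P y)"
    unfolding correlator_integrand_def[abs_def] by (intro borel_measurable_prod) simp
  show "AE \<omega> in P y. norm (correlator_integrand Y m p s \<omega>) \<le> norm (\<Sum>k\<le>m. poly (?q k) (Y (s k) \<omega>))"
  proof (rule AE_I2)
    fix \<omega>
    have a: "\<bar>v\<bar> \<le> 1 + v * v" for v :: real
      using zero_le_square[of "v - 1"] zero_le_square[of "v + 1"] by (simp add: algebra_simps abs_le_iff)
    have "\<bar>correlator_integrand Y m p s \<omega>\<bar> \<le> (\<Sum>k\<le>m. \<bar>poly (p (m - k)) (Y (s k) \<omega>)\<bar> ^ (m + 1))"
      unfolding correlator_integrand_def by (rule prod_abs_le_sum)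
    also have "\<dots> \<le> (\<Sum>k\<le>m. (1 + poly (p (m - k)) (Y (s k) \<omega>) * poly (p (m - k)) (Y (s k) \<omega>)) ^ (m + 1))"
      by (intro sum_mono power_mono a) auto
    also have "\<dots> = (\<Sum>k\<le>m. poly (?q k) (Y (s k) \<omega>))"
      by (intro sum.cong refl) (simp only: poly_power poly_add poly_mult poly_pCons poly_0 mult_zero_right add_0_right)
    finally show "norm (correlator_integrand Y m p s \<omega>) \<le> norm (\<Sum>k\<le>m. poly (?q k) (Y (s k) \<omega>))"
      by simp
  qed
qed

definition step_factor :: "nat \<Rightarrow> (nat \<Rightarrow> real poly) \<Rightarrow> (nat \<Rightarrow> real) \<Rightarrow> nat \<Rightarrow> nat \<Rightarrow> real mat" where
  "step_factor n p s m k = mat_exp ((s k - s (k - 1)) \<cdot>\<^sub>m (dup_generator n (m - k))\<^sup>T)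
    * kron_prefix (m - k) (1\<^sub>m (n + 1)) (coeff_col n (p (m - k)))"

lemma step_factor_eq:
  "step_factor n p s m k = (mat_exp ((s k - s (k - 1)) \<cdot>\<^sub>m dup_generator n (m - k)))\<^sup>T
    * (1\<^sub>m ((n + 1) ^ (m - k)) \<otimes>\<^sub>K coeff_col n (p (m - k)))"
  unfolding step_factor_def mat_exp_transpose[OF dup_generator_carrier] kron_prefix_eq kron_power_one ..

lemma kron_coeff_carrier: "1\<^sub>m ((n + 1) ^ r) \<otimes>\<^sub>K coeff_col n q \<in> carrier_mat ((n + 1) ^ (r + 1)) ((n + 1) ^ r)"
  using kron_carrier[OF one_carrier_mat coeff_col_carrier, of "(n + 1) ^ r" n q] by (simp add: mult.commute)

lemma step_factor_carrier:
  assumes "1 \<le> k" "k \<le> m"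
  shows "step_factor n p s m k \<in> carrier_mat ((n + 1) ^ (m - (k - 1))) ((n + 1) ^ (m - k))"
proof -
  have m: "m - (k - 1) = m - k + 1"
    using assms by simp
  have "(mat_exp ((s k - s (k - 1)) \<cdot>\<^sub>m dup_generator n (m - k)))\<^sup>T
      \<in> carrier_mat ((n + 1) ^ (m - k + 1)) ((n + 1) ^ (m - k + 1))"
    by (simp only: transpose_carrier_mat mat_exp_dup_generator_carrier)
  from mult_carrier_mat[OF this kron_coeff_carrier] show ?thesis
    unfolding step_factor_eq m .
qed

text \<open>The complete ordered product of the formula. It is a column, because the factor for
  \<open>k = m\<close> has \<open>(n + 1) ^ 0\<close> columns.\<close>

definition tail_vec :: "nat \<Rightarrow> (nat \<Rightarrow> real poly) \<Rightarrow> (nat \<Rightarrow> real) \<Rightarrow> nat \<Rightarrow> real mat" where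
  "tail_vec n p s m = mat_prod ((n + 1) ^ m) (step_factor n p s m) m"

lemma tail_vec_carrier: "tail_vec n p s m \<in> carrier_mat ((n + 1) ^ m) 1"
proof -
  have "mat_prod ((n + 1) ^ (m - 0)) (step_factor n p s m) m \<in> carrier_mat ((n + 1) ^ (m - 0)) ((n + 1) ^ (m - m))"
    by (rule mat_prod_carrier[where d="\<lambda>k. (n + 1) ^ (m - k)"]) (rule step_factor_carrier)
  then show ?thesis
    by (simp add: tail_vec_def)
qed

lemma tail_vec_kron_carrier: "tail_vec n p s m \<otimes>\<^sub>K coeff_col n q \<in> carrier_mat ((n + 1) ^ (m + 1)) 1"
  using kron_carrier[OF tail_vec_carrier coeff_col_carrier, of n p s m n q] by (simp add: mult.commute)

text \<open>The factor for \<open>k = 1\<close> is pulled out and the others are those of the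
  shifted times. Multiplying a column by an identity tensored with a coefficient vector appends that
  vector as the last tensor factor.\<close>

lemma tail_vec_Suc:
  "tail_vec n p s (Suc m) = (mat_exp ((s 1 - s 0) \<cdot>\<^sub>m dup_generator n m))\<^sup>T
    * (tail_vec n p (\<lambda>k. s (Suc k)) m \<otimes>\<^sub>K coeff_col n (p m))"
proof -
  let ?w = "tail_vec n p (\<lambda>k. s (Suc k)) m" and ?e = "(mat_exp ((s 1 - s 0) \<cdot>\<^sub>m dup_generator n m))\<^sup>T"
    and ?K = "1\<^sub>m ((n + 1) ^ m) \<otimes>\<^sub>K coeff_col n (p m)"
  have e: "?e \<in> carrier_mat ((n + 1) ^ (m + 1)) ((n + 1) ^ (m + 1))"
    using mat_exp_dup_generator_carrier[of "s 1 - s 0" n m] by simp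
  have "tail_vec n p s (Suc m) = step_factor n p s (Suc m) 1
      * mat_prod ((n + 1) ^ m) (\<lambda>k. step_factor n p s (Suc m) (Suc k)) m"
  proof -
    have "mat_prod ((n + 1) ^ (Suc m - 0)) (step_factor n p s (Suc m)) (Suc m) = step_factor n p s (Suc m) 1
        * mat_prod ((n + 1) ^ (Suc m - 1)) (\<lambda>k. step_factor n p s (Suc m) (Suc k)) m"
      by (rule mat_prod_Suc_left[where d="\<lambda>k. (n + 1) ^ (Suc m - k)"]) (rule step_factor_carrier)
    then show ?thesis
      by (simp only: tail_vec_def diff_zero diff_Suc_1)
  qed
  also have "mat_prod ((n + 1) ^ m) (\<lambda>k. step_factor n p s (Suc m) (Suc k)) m = ?w"
    unfolding tail_vec_def by (rule mat_prod_cong) (simp add: step_factor_def)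
  also have "step_factor n p s (Suc m) 1 = ?e * ?K"
    by (simp add: step_factor_eq)
  also have "?e * ?K * ?w = ?e * (?K * ?w)"
    by (rule assoc_mult_mat[OF e kron_coeff_carrier tail_vec_carrier])
  \<comment> \<open>Reading \<open>?w\<close> as its product with the \<open>1 \<times> 1\<close>
    identity brings the mixed-product rule into play.\<close>
  also have "?K * ?w = ?K * (?w \<otimes>\<^sub>K 1\<^sub>m 1)"
    by (simp only: kron_one_right)
  also have "\<dots> = (1\<^sub>m ((n + 1) ^ m) * ?w) \<otimes>\<^sub>K (coeff_col n (p m) * 1\<^sub>m 1)"
    by (rule kron_mult[OF one_carrier_mat coeff_col_carrier tail_vec_carrier one_carrier_mat])
  also have "\<dots> = ?w \<otimes>\<^sub>K coeff_col n (p m)"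
    by (simp only: left_mult_one_mat[OF tail_vec_carrier] right_mult_one_mat[OF coeff_col_carrier])
  finally show ?thesis .
qed

text \<open>By the mixed-product rule the pairing factors into two scalars, the last copy of the
  monomials meeting the coefficient vector.\<close>

lemma kron_coeff_mult:
  assumes w: "w \<in> carrier_mat ((n + 1) ^ r) 1" and q: "degree q \<le> n"
  shows "((w \<otimes>\<^sub>K coeff_col n q)\<^sup>T * kron_power (monomials n x) (Suc r)) $$ (0, 0)
    = poly q x * (w\<^sup>T * kron_power (monomials n x) r) $$ (0, 0)"
proof -
  have wT: "w\<^sup>T \<in> carrier_mat 1 ((n + 1) ^ r)" and cT: "(coeff_col n q)\<^sup>T \<in> carrier_mat 1 (n + 1)"
    using w coeff_col_carrier[of n q] by simp_all
  have "(w \<otimes>\<^sub>K coeff_col n q)\<^sup>T * kron_power (monomials n x) (Suc r)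
      = (w\<^sup>T * kron_power (monomials n x) r) \<otimes>\<^sub>K ((coeff_col n q)\<^sup>T * monomials n x)"
    unfolding kron_transpose kron_power.simps kron_power_right
    by (rule kron_mult[OF wT cT kron_monomials_carrier monomials_carrier])
  also have "\<dots> $$ (0, 0) = (w\<^sup>T * kron_power (monomials n x) r) $$ (0, 0) * ((coeff_col n q)\<^sup>T * monomials n x) $$ (0, 0)"
    by (rule kron_index_scalar[OF mult_carrier_mat[OF wT kron_monomials_carrier]
          mult_carrier_mat[OF cT monomials_carrier]])
  finally show ?thesis
    unfolding coeff_col_monomials[OF q] by simp
qed

text \<open>The induction keeps \<open>s\<close> and \<open>t\<close> free: given
  \<open>F (s 0)\<close>, the later times form the same problem with shifted times and
  \<open>s 0\<close> in the role of \<open>t\<close>. Since the earliest time carries the polynomial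
  with the highest index, removing it leaves the indices of the others unchanged.\<close>

lemma correlator_eq:
  assumes "\<And>k. k \<le> m \<Longrightarrow> degree (p k) \<le> n" "0 \<le> t" "t < s 0" "\<And>k. k < m \<Longrightarrow> s k < s (Suc k)"
  shows "AE \<omega> in P y. real_cond_exp (P y) (F t) (correlator_integrand Y m p s) \<omega>
    = ((tail_vec n p s m \<otimes>\<^sub>K coeff_col n (p m))\<^sup>T
      * (mat_exp ((s 0 - t) \<cdot>\<^sub>m dup_generator n m) * kron_power (monomials n (Y t \<omega>)) (Suc m))) $$ (0, 0)"
  using assms
proof (induction m arbitrary: s t)
  case 0
  have "correlator_integrand Y 0 p s
      = (\<lambda>\<omega>. ((tail_vec n p s 0 \<otimes>\<^sub>K coeff_col n (p 0))\<^sup>T * kron_power (monomials n (Y (s 0) \<omega>)) (Suc 0)) $$ (0, 0))"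
    unfolding kron_coeff_mult[OF tail_vec_carrier 0(1)[OF order.refl]]
    by (simp add: correlator_integrand_def tail_vec_def fun_eq_iff)
  then show ?case
    using real_cond_exp_kron[OF tail_vec_kron_carrier, of t "s 0" y n p s 0] 0 by simp
next
  case (Suc m)
  let ?s = "\<lambda>k. s (Suc k)" and ?w = "tail_vec n p s (Suc m)"
  let ?u = "\<lambda>x. (?w\<^sup>T * kron_power (monomials n x) (Suc m)) $$ (0, 0)"
  interpret St: sigma_finite_subalgebra "P y" "F t" by (rule sigma_finite_subalgebra_P)
  interpret S0: sigma_finite_subalgebra "P y" "F (s 0)" by (rule sigma_finite_subalgebra_P)
  have s0: "0 \<le> s 0"
    using Suc.prems by simp
  note less = Suc.prems(4)
  have mono: "s 0 \<le> s k" if "k \<le> Suc m" for k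
    using that
  proof (induction k)
    case (Suc k)
    then show ?case
      using less[of k] by simp
  qed simp
  have pos: "0 \<le> s k" if "k \<le> Suc m" for k
    using mono[OF that] s0 by simp
  have int: "integrable (P y) (correlator_integrand Y (Suc m) p s)" for y
    by (rule correlator_integrand_integrable[OF pos])
  have int': "integrable (P y) (correlator_integrand Y m p ?s)"
    by (rule correlator_integrand_integrable[OF pos]) simp
  have "AE \<omega> in P y. real_cond_exp (P y) (F (s 0)) (correlator_integrand Y m p ?s) \<omega>
      = ((tail_vec n p ?s m \<otimes>\<^sub>K coeff_col n (p m))\<^sup>T
        * (mat_exp ((?s 0 - s 0) \<cdot>\<^sub>m dup_generator n m) * kron_power (monomials n (Y (s 0) \<omega>)) (Suc m))) $$ (0, 0)"
    using Suc.prems s0 by (intro Suc.IH) auto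
  \<comment> \<open>The exponential acting on the monomials is moved, transposed, onto the vector on
    the left. This is the origin of the transposed exponentials in the ordered product.\<close>
  moreover have "(tail_vec n p ?s m \<otimes>\<^sub>K coeff_col n (p m))\<^sup>T
        * (mat_exp ((?s 0 - s 0) \<cdot>\<^sub>m dup_generator n m) * kron_power (monomials n x) (Suc m))
      = ?w\<^sup>T * kron_power (monomials n x) (Suc m)" for x
  proof -
    let ?c = "tail_vec n p ?s m \<otimes>\<^sub>K coeff_col n (p m)" and ?e = "mat_exp ((s 1 - s 0) \<cdot>\<^sub>m dup_generator n m)"
    have c: "?c \<in> carrier_mat ((n + 1) ^ (m + 1)) 1"
      by (rule tail_vec_kron_carrier)
    have e: "?e \<in> carrier_mat ((n + 1) ^ (m + 1)) ((n + 1) ^ (m + 1))"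
      by (rule mat_exp_dup_generator_carrier)
    have "kron_power (monomials n x) (Suc m) \<in> carrier_mat ((n + 1) ^ (m + 1)) 1"
      using kron_monomials_carrier[of n x "Suc m"] by simp
    from assoc_mult_mat[OF _ e this, of "?c\<^sup>T" 1]
    have "?c\<^sup>T * (?e * kron_power (monomials n x) (Suc m)) = ?c\<^sup>T * ?e * kron_power (monomials n x) (Suc m)"
      using c by simp
    also have "?c\<^sup>T * ?e = (?e\<^sup>T * ?c)\<^sup>T"
      using transpose_mult[OF _ c, of "?e\<^sup>T"] e by simp
    finally show ?thesis
      unfolding tail_vec_Suc by simp
  qed
  ultimately have IH: "AE \<omega> in P y. real_cond_exp (P y) (F (s 0)) (correlator_integrand Y m p ?s) \<omega> = ?u (Y (s 0) \<omega>)"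
    by simp
  have pm: "(\<lambda>\<omega>. poly (p (Suc m)) (Y (s 0) \<omega>)) \<in> borel_measurable (F (s 0))"
    by (rule measurable_compose[OF Y_measurable_F[OF s0] poly_measurable])
  have eq: "correlator_integrand Y (Suc m) p s
      = (\<lambda>\<omega>. poly (p (Suc m)) (Y (s 0) \<omega>) * correlator_integrand Y m p ?s \<omega>)"
    by (simp add: correlator_integrand_Suc fun_eq_iff)
  have "AE \<omega> in P y. real_cond_exp (P y) (F (s 0)) (correlator_integrand Y (Suc m) p s) \<omega>
      = poly (p (Suc m)) (Y (s 0) \<omega>) * real_cond_exp (P y) (F (s 0)) (correlator_integrand Y m p ?s) \<omega>"
    unfolding eq using int[of y] unfolding eq
    by (intro S0.real_cond_exp_mult pm borel_measurable_integrable[OF int'])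
  with IH have inner: "AE \<omega> in P y. real_cond_exp (P y) (F (s 0)) (correlator_integrand Y (Suc m) p s) \<omega>
      = ((?w \<otimes>\<^sub>K coeff_col n (p (Suc m)))\<^sup>T * kron_power (monomials n (Y (s 0) \<omega>)) (Suc (Suc m))) $$ (0, 0)"
    (is "AE \<omega> in P y. _ = ?v \<omega>")
  proof eventually_elim
    case (elim \<omega>)
    then show ?case
      by (simp only: kron_coeff_mult[OF tail_vec_carrier Suc.prems(1)[OF order.refl]])
  qed
  have sub: "subalgebra (F (s 0)) (F t)"
    using sets_F_mono[of t "s 0"] Suc.prems(3) by (simp add: subalgebra_def space_F)
  have "AE \<omega> in P y. real_cond_exp (P y) (F t) (real_cond_exp (P y) (F (s 0)) (correlator_integrand Y (Suc m) p s)) \<omega>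
      = real_cond_exp (P y) (F t) (correlator_integrand Y (Suc m) p s) \<omega>"
    by (rule St.real_cond_exp_nested_subalg[OF subalgebra_P sub int])
  moreover have "AE \<omega> in P y. real_cond_exp (P y) (F t) (real_cond_exp (P y) (F (s 0)) (correlator_integrand Y (Suc m) p s)) \<omega>
      = real_cond_exp (P y) (F t) ?v \<omega>"
  proof (rule St.real_cond_exp_cong[OF inner])
    show "real_cond_exp (P y) (F (s 0)) (correlator_integrand Y (Suc m) p s) \<in> borel_measurable (P y)"
      by simp
    \<comment> \<open>Written as a polynomial of \<open>Y (s 0)\<close>, the inner conditional
      expectation is visibly measurable.\<close>
    have "?v = (\<lambda>\<omega>. poly (sum_poly (n * (Suc m + 1))
        (\<lambda>j. ((?w \<otimes>\<^sub>K coeff_col n (p (Suc m)))\<^sup>T * L_dup n (Suc m)) $$ (0, j))) (Y (s 0) \<omega>))"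
      (is "_ = (\<lambda>\<omega>. poly ?q (Y (s 0) \<omega>))")
    proof
      fix \<omega>
      let ?c = "(?w \<otimes>\<^sub>K coeff_col n (p (Suc m)))\<^sup>T" and ?d = "n * (Suc m + 1)"
      have c: "?c \<in> carrier_mat 1 ((n + 1) ^ (Suc m + 1))"
        using tail_vec_kron_carrier[of n p s "Suc m"] by simp
      have "?v \<omega> = (?c * L_dup n (Suc m) * monomials ?d (Y (s 0) \<omega>)) $$ (0, 0)"
        unfolding L_dup_monomials[symmetric] assoc_mult_mat[OF c L_dup_carrier monomials_carrier] ..
      also have "\<dots> = (\<Sum>j<?d + 1. (?c * L_dup n (Suc m)) $$ (0, j) * monomials ?d (Y (s 0) \<omega>) $$ (j, 0))"
        by (rule index_mult_mat_sum[OF mult_carrier_mat[OF c L_dup_carrier] monomials_carrier]) simp_all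
      also have "\<dots> = poly ?q (Y (s 0) \<omega>)"
        unfolding poly_sum_poly by (intro sum.cong refl) (simp add: monomials_def)
      finally show "?v \<omega> = poly ?q (Y (s 0) \<omega>)" .
    qed
    then show "?v \<in> borel_measurable (P y)"
      using measurable_compose[OF Y_measurable_P[OF s0] poly_measurable] by simp
  qed
  moreover have "AE \<omega> in P y. real_cond_exp (P y) (F t) ?v \<omega>
      = ((?w \<otimes>\<^sub>K coeff_col n (p (Suc m)))\<^sup>T
        * (mat_exp ((s 0 - t) \<cdot>\<^sub>m dup_generator n (Suc m)) * kron_power (monomials n (Y t \<omega>)) (Suc (Suc m)))) $$ (0, 0)"
    using Suc.prems by (intro real_cond_exp_kron tail_vec_kron_carrier) auto
  ultimately show ?case
    by eventually_elim simp
qed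

end

theorem theorem4p5:
  fixes M :: "'w measure"
    and F :: "real \<Rightarrow> 'w measure"
    and P :: "real \<Rightarrow> 'w measure"
    and Y :: "real \<Rightarrow> 'w \<Rightarrow> real"
    and b \<sigma> :: "real \<Rightarrow> real"
    and l :: "real \<Rightarrow> real measure"
    and y :: real
    and m n :: nat
    and deg :: "nat \<Rightarrow> nat"
    and p :: "nat \<Rightarrow> real poly"
    and t :: real
    and s :: "nat \<Rightarrow> real"
  assumes Y: "polynomial_jump_diffusion M F P Y b \<sigma> l"
    and m: "1 \<le> m"
    and p: "\<And>k. k \<le> m \<Longrightarrow> degree (p k) \<le> deg k"
    and n: "n = Max (deg ` {0..m})" "1 \<le> n"
    and t: "0 \<le> t" "t < s 0"
    and s: "\<And>k. k < m \<Longrightarrow> s k < s (Suc k)"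
  shows "\<exists>Gt :: nat \<Rightarrow> real mat.
    (\<forall>r\<le>m. Gt r \<in> carrier_mat ((n + 1) ^ (r + 1)) ((n + 1) ^ (r + 1))) \<and>
    integrable (P y) (correlator_integrand Y m p s) \<and>
    (AE \<omega> in P y.
       correlator (P y) F Y m p s t \<omega> =
         ((coeff_col n (p m))\<^sup>T *
          unvectorize (n + 1) ((n + 1) ^ m)
            (mat_exp ((s 0 - t) \<cdot>\<^sub>m Gt m) * vectorize (X_mat n m (Y t \<omega>))) *
          mat_prod ((n + 1) ^ m)
            (\<lambda>k. mat_exp ((s k - s (k - 1)) \<cdot>\<^sub>m (Gt (m - k))\<^sup>T) *
                 kron_prefix (m - k) (1\<^sub>m (n + 1)) (coeff_col n (p (m - k)))) m) $$ (0, 0)) \<and>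
    Gt 0 = generator_matrix b \<sigma> l n \<and>
    (\<forall>r. 1 \<le> r \<and> r \<le> m \<longrightarrow>
       Gt r = L_dup n r * generator_matrix b \<sigma> l (n * (r + 1)) * L_elim n r \<and>
       (\<forall>\<tau> x. mat_exp (\<tau> \<cdot>\<^sub>m Gt r) * vectorize (X_mat n r x) =
          L_dup n r * mat_exp (\<tau> \<cdot>\<^sub>m generator_matrix b \<sigma> l (n * (r + 1))) * L_elim n r *
          vectorize (X_mat n r x)) \<and>
       (\<forall>\<tau>. mat_exp (\<tau> \<cdot>\<^sub>m Gt r) =
          L_dup n r * mat_exp (\<tau> \<cdot>\<^sub>m generator_matrix b \<sigma> l (n * (r + 1))) * L_elim n r +
          (1\<^sub>m ((n + 1) ^ (r + 1)) - L_dup n r * L_elim n r)))"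
proof -
  interpret polynomial_jump_diffusion M F P Y b \<sigma> l
    by (rule Y)
  have deg: "degree (p k) \<le> n" if "k \<le> m" for k
    using p[OF that] that unfolding n(1) by (intro order.trans[OF p[OF that] Max_ge]) auto
  have s_nonneg: "0 \<le> s k" if "k \<le> m" for k
    using that
  proof (induction k)
    case 0
    then show ?case
      using t by simp
  next
    case (Suc k)
    then show ?case
      using s[of k] by simp
  qed
  show ?thesis
  proof (intro exI[of _ "dup_generator n"] conjI allI impI)
    show "dup_generator n r \<in> carrier_mat ((n + 1) ^ (r + 1)) ((n + 1) ^ (r + 1))" for r
      by (rule dup_generator_carrier)
    show "integrable (P y) (correlator_integrand Y m p s)"
      by (rule correlator_integrand_integrable[OF s_nonneg])
    have tail: "mat_prod ((n + 1) ^ m) (\<lambda>k. mat_exp ((s k - s (k - 1)) \<cdot>\<^sub>m (dup_generator n (m - k))\<^sup>T) *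
        kron_prefix (m - k) (1\<^sub>m (n + 1)) (coeff_col n (p (m - k)))) m = tail_vec n p s m"
      unfolding tail_vec_def step_factor_def ..
    have form: "((coeff_col n (p m))\<^sup>T * unvectorize (n + 1) ((n + 1) ^ m)
          (mat_exp ((s 0 - t) \<cdot>\<^sub>m dup_generator n m) * vectorize (X_mat n m x)) * tail_vec n p s m) $$ (0, 0)
        = ((tail_vec n p s m \<otimes>\<^sub>K coeff_col n (p m))\<^sup>T
          * (mat_exp ((s 0 - t) \<cdot>\<^sub>m dup_generator n m) * kron_power (monomials n x) (Suc m))) $$ (0, 0)" for x
      unfolding vectorize_X_mat
    proof (rule unvectorize_form[OF coeff_col_carrier tail_vec_carrier])
      have "kron_power (monomials n x) (Suc m) \<in> carrier_mat ((n + 1) ^ (m + 1)) 1"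
        using kron_monomials_carrier[of n x "Suc m"] by simp
      from mult_carrier_mat[OF mat_exp_dup_generator_carrier this]
      show "mat_exp ((s 0 - t) \<cdot>\<^sub>m dup_generator n m) * kron_power (monomials n x) (Suc m)
          \<in> carrier_mat ((n + 1) ^ m * (n + 1)) 1"
        by (simp only: power_add power_one_right)
    qed
    show "AE \<omega> in P y. correlator (P y) F Y m p s t \<omega> = ((coeff_col n (p m))\<^sup>T *
        unvectorize (n + 1) ((n + 1) ^ m)
          (mat_exp ((s 0 - t) \<cdot>\<^sub>m dup_generator n m) * vectorize (X_mat n m (Y t \<omega>))) *
        mat_prod ((n + 1) ^ m) (\<lambda>k. mat_exp ((s k - s (k - 1)) \<cdot>\<^sub>m (dup_generator n (m - k))\<^sup>T) *
          kron_prefix (m - k) (1\<^sub>m (n + 1)) (coeff_col n (p (m - k)))) m) $$ (0, 0)"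
      unfolding tail form correlator_def by (rule correlator_eq[OF deg t s])
    show "dup_generator n 0 = generator_matrix b \<sigma> l n"
      using generator_matrix_carrier[of n] by (simp add: dup_generator_def)
    fix r
    show "dup_generator n r = L_dup n r * generator_matrix b \<sigma> l (n * (r + 1)) * L_elim n r"
      by (rule dup_generator_def)
    show "mat_exp (\<tau> \<cdot>\<^sub>m dup_generator n r) * vectorize (X_mat n r x) =
        L_dup n r * mat_exp (\<tau> \<cdot>\<^sub>m generator_matrix b \<sigma> l (n * (r + 1))) * L_elim n r *
        vectorize (X_mat n r x)" for \<tau> x
      unfolding vectorize_X_mat mat_exp_dup_generator_kron ..
    show "mat_exp (\<tau> \<cdot>\<^sub>m dup_generator n r) =
        L_dup n r * mat_exp (\<tau> \<cdot>\<^sub>m generator_matrix b \<sigma> l (n * (r + 1))) * L_elim n r +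
        (1\<^sub>m ((n + 1) ^ (r + 1)) - L_dup n r * L_elim n r)" for \<tau>
      by (rule mat_exp_dup_generator)
  qed
qed

end
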